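(* For all $f_0\in\widetilde{\mathcal{P}}(\mathbb{R}^d\times\mathcal{M})$ and all $T>0$, there exists a unique solution in $C\big([0,T],\widetilde{\mathcal{P}}(\mathbb{R}^d\times\mathcal{M})\big)$ of the BGK equation with kernel $K$, $$\partial_t f+\Phi(m)\cdot\nabla_x f=\rho_f M_{K*f}[x]-f,$$ with initial condition $f_0$. Moreover, if $t\mapsto f^1_t$ and $t\mapsto f^2_t$ are two solutions of this equation with respective initial conditions $f^1_0,f^2_0\in\widetilde{\mathcal{P}}(\mathbb{R}^d\times\mathcal{M})$, then $$\sup_{t\in[0,T]}\|f^1_t-f^2_t\|_{L^1(\mathbb{R}^d\times\mathcal{M})}\leq\|f^1_0-f^2_0\|_{L^1(\mathbb{R}^d\times\mathcal{M})}\,\exp\Big(\big(\alpha(\|K\|_{L^\infty})+\|K\|_{L^\infty}\theta(\|K\|_{L^\infty})\big)T\Big).$$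
   Context: **Setting.** $(\mathcal{M},g)$ is a compact finite-dimensional Riemannian manifold with Riemannian distance $d_{\mathcal{M}}$ and normalised volume measure $\mathrm{d}m$ ($\int_{\mathcal{M}}\mathrm{d}m=1$), isometrically embedded in a Euclidean space $E$ with norm $|\cdot|$, and $|m|\le 1$ for all $m\in\mathcal{M}$. The velocity map $\Phi:\mathcal{M}\to\mathbb{R}^d$ is $\lambda$-Lipschitz for a given $\lambda\ge0$. The observation kernel $K$ is a radial smooth bounded Lipschitz function on $\mathbb{R}^d$ tending to zero at infinity, with $K\ge0$ and $\int_{\mathbb{R}^d}K=1$. The interaction law assigns to each $J\in E$ a probability density $M_J$ on $\mathcal{M}$ (w.r.t. $\mathrm{d}m$), such that there are functions $\alpha,L,\theta$ of $a>0$ with, for all $a>0$ and all $J,J'\in E$ with $|J|,|J'|\le a$ and all $m_1,m_2\in\mathcal M$: $\|M_J\|_{L^\infty(\mathcal{M})}\le\alpha(a)$; $|M_J(m_1)-M_J(m_2)|\le L(a)d_{\mathcal{M}}(m_1,m_2)$; $\|M_J-M_{J'}\|_{L^\infty(\mathcal{M})}\le\theta(a)|J-J'|$. **Notation.** $\widetilde{\mathcal{P}}(\mathbb{R}^d\times\mathcal{M})$ is the set of probability densities w.r.t. $\mathrm{d}x\,\mathrm{d}m$, with the $L^1$ topology. For such $f$: $\rho_f(x)=\int_{\mathcal{M}}f(x,m)\,\mathrm{d}m$, $J_{K*f}(x)=\iint K(x-y)\,m f(y,m)\,\mathrm{d}y\,\mathrm{d}m\in E$, $M_{K*f}[x](m)=M_{J_{K*f}(x)}(m)$,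 $G^K_f(x,m)=\rho_f(x)M_{K*f}[x](m)$. **Solution.** A solution on $[0,T]$ with initial condition $f_0$ is an $f\in C([0,T],\widetilde{\mathcal{P}}(\mathbb{R}^d\times\mathcal{M}))$ such that for all $t\in[0,T]$ $$f_t(x,m)=e^{-t}f_0(x-t\Phi(m),m)+\int_0^te^{-(t-s)}G^K_{f_s}(x-(t-s)\Phi(m),m)\,\mathrm{d}s .$$ *)

theory Defs
  imports "HOL-Probability.Probability"
begin

section \<open>Smooth maps between Euclidean spaces\<close>

fun Ck_on :: "nat \<Rightarrow> 'a::euclidean_space set \<Rightarrow> ('a \<Rightarrow> 'b::euclidean_space) \<Rightarrow> bool" where
  "Ck_on 0 S f \<longleftrightarrow> continuous_on S f"
| "Ck_on (Suc k) S f \<longleftrightarrow>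
     (\<forall>x\<in>S. f differentiable at x) \<and> (\<forall>v. Ck_on k S (\<lambda>x. frechet_derivative f (at x) v))"

text \<open>Only used for open sets.\<close>

definition smooth_on :: "'a::euclidean_space set \<Rightarrow> ('a \<Rightarrow> 'b::euclidean_space) \<Rightarrow> bool" where
  "smooth_on S f \<longleftrightarrow> (\<forall>k. Ck_on k S f)"


section \<open>Embedded Riemannian manifolds\<close>

text \<open>
  A Riemannian manifold that is isometrically embedded in the Euclidean space \<open>'e\<close> is treated as
  an embedded smooth submanifold (without boundary) carrying the metric induced by the inner
  product of \<open>'e\<close>. Dimension 0 is allowed, and connectedness is not required.

  A slice chart is a diffeomorphism \<open>\<phi>\<close> between open subsets \<open>U\<close> and \<open>V\<close> of \<open>'e\<close> that maps the
  part of the coordinate subspace \<open>span B\<close> in \<open>U\<close> onto the part of the submanifold in \<open>V\<close>; its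
  restriction to \<open>U \<inter> span B\<close> is a local parametrization of the submanifold.
\<close>

definition slice_chart ::
  "'e::euclidean_space set \<Rightarrow> 'e set \<Rightarrow> 'e set \<Rightarrow> 'e set \<Rightarrow> ('e \<Rightarrow> 'e) \<Rightarrow> bool" where
  "slice_chart \<M> B U V \<phi> \<longleftrightarrow>
     B \<subseteq> Basis \<and> open U \<and> open V \<and> bij_betw \<phi> U V \<and>
     smooth_on U \<phi> \<and> smooth_on V (inv_into U \<phi>) \<and>
     \<phi> ` (U \<inter> span B) = \<M> \<inter> V"

definition embedded_submanifold :: "nat \<Rightarrow> 'e::euclidean_space set \<Rightarrow> bool" where
  "embedded_submanifold k \<M> \<longleftrightarrow>
     (\<forall>p\<in>\<M>. \<exists>B U V \<phi>. slice_chart \<M> B U V \<phi> \<and> card B = k \<and> p \<in> V)"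

definition curve_length :: "(real \<Rightarrow> 'e::euclidean_space) \<Rightarrow> ennreal" where
  "curve_length \<gamma> = (\<integral>\<^sup>+t\<in>{0..1}. ennreal (norm (vector_derivative \<gamma> (at t))) \<partial>lborel)"

text \<open>The distance is \<open>\<infinity>\<close> between different connected components.\<close>

definition riemannian_dist :: "'e::euclidean_space set \<Rightarrow> 'e \<Rightarrow> 'e \<Rightarrow> ereal" where
  "riemannian_dist \<M> p q =
     enn2ereal (INF \<gamma> \<in> {\<gamma>. valid_path \<gamma> \<and> path_image \<gamma> \<subseteq> \<M> \<and>
                             pathstart \<gamma> = p \<and> pathfinish \<gamma> = q}. curve_length \<gamma>)"

text \<open>
  Lebesgue measure on the coordinate subspace \<open>span B\<close>, as a Borel measure on \<open>'e\<close>
  (the Dirac measure at \<open>0\<close> if \<open>B\<close> is empty). For \<open>B = Basis\<close> this is \<^const>\<open>lborel\<close>.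
\<close>

definition coordinate_lebesgue :: "'e::euclidean_space set \<Rightarrow> 'e measure" where
  "coordinate_lebesgue B =
     distr (\<Pi>\<^sub>M b\<in>B. (lborel :: real measure)) borel (\<lambda>c. \<Sum>b\<in>B. c b *\<^sub>R b)"

text \<open>
  The determinant of the Gram matrix of the vectors \<open>v b\<close>, \<open>b \<in> B\<close>. With \<open>v b\<close> the partial
  derivatives of a local parametrization, this is the determinant of the metric tensor in the
  corresponding coordinates.
\<close>

definition gram_det :: "'e set \<Rightarrow> ('e \<Rightarrow> 'e::euclidean_space) \<Rightarrow> real" where
  "gram_det B v = (\<Sum>\<sigma> | \<sigma> permutes B. of_int (sign \<sigma>) * (\<Prod>b\<in>B. v b \<bullet> v (\<sigma> b)))"

definition riemannian_volume :: "'e::euclidean_space set \<Rightarrow> 'e measure \<Rightarrow> bool" where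
  "riemannian_volume \<M> vol \<longleftrightarrow>
     sets vol = sets (restrict_space borel \<M>) \<and>
     (\<forall>B U V \<phi> A. slice_chart \<M> B U V \<phi> \<longrightarrow> A \<in> sets borel \<longrightarrow> A \<subseteq> U \<inter> span B \<longrightarrow>
        emeasure vol (\<phi> ` A) =
          (\<integral>\<^sup>+u\<in>A. ennreal (sqrt (gram_det B (frechet_derivative \<phi> (at u))))
             \<partial>coordinate_lebesgue B))"

definition normalised_volume :: "'e::euclidean_space set \<Rightarrow> 'e measure \<Rightarrow> bool" where
  "normalised_volume \<M> \<nu> \<longleftrightarrow>
     (\<exists>vol. \<exists>c>0. riemannian_volume \<M> vol \<and> \<nu> = scale_measure (ennreal c) vol \<and>
        emeasure \<nu> \<M> = 1)"


section \<open>Norms and densities\<close>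

definition L1_norm :: "'a measure \<Rightarrow> ('a \<Rightarrow> real) \<Rightarrow> real" where
  "L1_norm N f = (LINT z|N. \<bar>f z\<bar>)"

definition Linf_norm :: "'a measure \<Rightarrow> ('a \<Rightarrow> real) \<Rightarrow> ereal" where
  "Linf_norm N f = esssup N (\<lambda>z. ereal \<bar>f z\<bar>)"

definition prob_density :: "'a measure \<Rightarrow> ('a \<Rightarrow> real) \<Rightarrow> bool" where
  "prob_density N f \<longleftrightarrow> has_bochner_integral N f 1 \<and> (AE z in N. 0 \<le> f z)"


section \<open>The BGK equation\<close>

definition observation_kernel :: "(real^'d \<Rightarrow> real) \<Rightarrow> bool" where
  "observation_kernel K \<longleftrightarrow>
     (\<forall>x y. norm x = norm y \<longrightarrow> K x = K y) \<and>
     smooth_on UNIV K \<and> bounded (range K) \<and> (\<exists>C. C-lipschitz_on UNIV K) \<and>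
     (K \<longlongrightarrow> 0) at_infinity \<and>
     (\<forall>x. 0 \<le> K x) \<and> has_bochner_integral lborel K 1"

text \<open>\<open>Q J m\<close> is the value at \<open>m\<close> of the density \<open>M\<^sub>J\<close>.\<close>

definition interaction_law ::
  "'e::euclidean_space set \<Rightarrow> 'e measure \<Rightarrow> (real \<Rightarrow> real) \<Rightarrow> (real \<Rightarrow> real) \<Rightarrow> (real \<Rightarrow> real) \<Rightarrow>
   ('e \<Rightarrow> 'e \<Rightarrow> real) \<Rightarrow> bool" where
  "interaction_law \<M> \<nu> \<alpha> L \<theta> Q \<longleftrightarrow>
     (\<forall>J. prob_density \<nu> (Q J)) \<and>
     (\<forall>a>0. \<forall>J J'. norm J \<le> a \<longrightarrow> norm J' \<le> a \<longrightarrow>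
        Linf_norm \<nu> (Q J) \<le> ereal (\<alpha> a) \<and>
        (\<forall>m1\<in>\<M>. \<forall>m2\<in>\<M>.
           ereal \<bar>Q J m1 - Q J m2\<bar> \<le> ereal (L a) * riemannian_dist \<M> m1 m2) \<and>
        Linf_norm \<nu> (\<lambda>m. Q J m - Q J' m) \<le> ereal (\<theta> a * norm (J - J')))"

definition phase_measure :: "'e::euclidean_space measure \<Rightarrow> ((real^'d) \<times> 'e) measure" where
  "phase_measure \<nu> = lborel \<Otimes>\<^sub>M \<nu>"

definition spatial_density ::
  "'e measure \<Rightarrow> ((real^'d) \<times> 'e \<Rightarrow> real) \<Rightarrow> real^'d \<Rightarrow> real" where
  "spatial_density \<nu> f x = (LINT m|\<nu>. f (x, m))"

definition flux ::
  "'e::euclidean_space measure \<Rightarrow> (real^'d \<Rightarrow> real) \<Rightarrow> ((real^'d) \<times> 'e \<Rightarrow> real) \<Rightarrow> real^'d \<Rightarrow> 'e" where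
  "flux \<nu> K f x = (LINT (y, m)|phase_measure \<nu>. (K (x - y) * f (y, m)) *\<^sub>R m)"

definition BGK_gain ::
  "'e::euclidean_space measure \<Rightarrow> (real^'d \<Rightarrow> real) \<Rightarrow> ('e \<Rightarrow> 'e \<Rightarrow> real) \<Rightarrow>
   ((real^'d) \<times> 'e \<Rightarrow> real) \<Rightarrow> (real^'d) \<times> 'e \<Rightarrow> real" where
  "BGK_gain \<nu> K Q f = (\<lambda>(x, m). spatial_density \<nu> f x * Q (flux \<nu> K f x) m)"

text \<open>
  Densities are represented by functions, and two of them stand for the same element of the space
  of probability densities iff they agree almost everywhere.
\<close>

definition continuous_density_path ::
  "'e::euclidean_space measure \<Rightarrow> real \<Rightarrow> (real \<Rightarrow> (real^'d) \<times> 'e \<Rightarrow> real) \<Rightarrow> bool" where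
  "continuous_density_path \<nu> T f \<longleftrightarrow>
     (\<forall>t\<in>{0..T}. prob_density (phase_measure \<nu>) (f t)) \<and>
     (\<forall>t\<in>{0..T}. ((\<lambda>s. L1_norm (phase_measure \<nu>) (\<lambda>z. f s z - f t z)) \<longlongrightarrow> 0)
                     (at t within {0..T}))"

text \<open>
  The solution formula is an identity in \<open>L\<^sup>1\<close> for every \<open>t\<close>. Its time integral is evaluated
  pointwise, which needs representatives \<open>g s\<close> of the \<open>f s\<close> that are jointly measurable in time
  and phase variables. Every \<open>L\<^sup>1\<close>-continuous path has such representatives, and by Fubini the
  integral does not depend (up to null sets) on their choice.
\<close>

definition BGK_solution ::
  "'e::euclidean_space measure \<Rightarrow> ('e \<Rightarrow> real^'d) \<Rightarrow> (real^'d \<Rightarrow> real) \<Rightarrow> ('e \<Rightarrow> 'e \<Rightarrow> real) \<Rightarrow>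
   real \<Rightarrow> ((real^'d) \<times> 'e \<Rightarrow> real) \<Rightarrow> (real \<Rightarrow> (real^'d) \<times> 'e \<Rightarrow> real) \<Rightarrow> bool" where
  "BGK_solution \<nu> \<Phi> K Q T f0 f \<longleftrightarrow>
     continuous_density_path \<nu> T f \<and>
     (\<exists>g. (\<lambda>(t, z). g t z) \<in> borel_measurable (borel \<Otimes>\<^sub>M phase_measure \<nu>) \<and>
          (\<forall>t\<in>{0..T}. AE z in phase_measure \<nu>. g t z = f t z) \<and>
          (\<forall>t\<in>{0..T}. AE (x, m) in phase_measure \<nu>.
             f t (x, m) =
               exp (- t) * f0 (x - t *\<^sub>R \<Phi> m, m) +
               (LINT s:{0..t}|lborel.
                  exp (- (t - s)) * BGK_gain \<nu> K Q (g s) (x - (t - s) *\<^sub>R \<Phi> m, m))))"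

end

theory Submission
  imports Defs
begin

text \<open>
  Along the characteristics \<open>(x, m) \<mapsto> (x - t \<Phi>(m), m)\<close>, which preserve \<open>dx dm\<close>, the equation is an
  ordinary differential equation in \<open>L\<^sup>1\<close> with the gain \<open>G(f)(x, m) = \<rho>\<^sub>f(x) M\<^sub>J(m)\<close>,
  \<open>J = J\<^sub>K\<^sub>*\<^sub>f(x)\<close>, as its nonlinearity. For a probability density \<open>f\<close> one has \<open>|J| \<le> a\<close> with
  \<open>a = \<parallel>K\<parallel>\<^sub>\<infinity>\<close>, because \<open>|m| \<le> 1\<close>. Writing
  \<open>G(f) - G(g) = (\<rho>\<^sub>f - \<rho>\<^sub>g) M\<^sub>J\<^sub>f + \<rho>\<^sub>g (M\<^sub>J\<^sub>f - M\<^sub>J\<^sub>g)\<close> and integrating in \<open>m\<close> first, where every \<open>M\<^sub>J\<close> has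
  mass one, shows that \<open>G\<close> maps probability densities to probability densities and is Lipschitz
  for the \<open>L\<^sup>1\<close> distance with constant \<open>1 + a \<theta>(a)\<close> (\<open>gain_Lipschitz\<close>). This is at most
  \<open>\<alpha>(a) + a \<theta>(a)\<close>, since a probability density on a space of mass one has supremum at least one.

  Two solutions therefore satisfy a Gronwall inequality (\<open>BGK_solution_stability\<close>), which is the
  stability estimate and gives uniqueness. Existence comes from Picard iteration on jointly
  measurable functions of time and phase variables: in the norm weighted by \<open>exp (- 2 L t)\<close> one
  iteration halves distances (\<open>exp_comparison_step\<close>), so the iterates converge almost everywhere and
  in \<open>L\<^sup>1\<close>, uniformly on bounded time intervals. Mass and positivity are kept by every iterate and
  pass to the limit. That the limit is a continuous path in \<open>L\<^sup>1\<close> (\<open>duhamel_continuous\<close>) rests on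
  strong continuity of free transport (\<open>integrable_imp_transport_continuous\<close>).

  Two measurability questions precede all this. First, \<open>\<Phi>\<close> and \<open>M\<^sub>J\<close> are Lipschitz only for the
  Riemannian distance; a straight segment in a slice chart shows that this distance is locally
  controlled by the Euclidean one, so both are continuous on the manifold. Second, the bound on
  \<open>M\<^sub>J - M\<^sub>J'\<close> holds outside a null set depending on \<open>J\<close> and \<open>J'\<close>, which says nothing about the
  function \<open>J \<mapsto> M\<^sub>J(m)\<close> for a fixed \<open>m\<close>. By continuity in \<open>m\<close> it holds at all points of the support
  of the volume measure, and there \<open>M\<^sub>J(m)\<close> is jointly continuous. Setting the law to zero
  outside the support gives a jointly measurable law without changing the solutions
  (\<open>BGK_solution_cong_law\<close>).
\<close>

section \<open>Lipschitz functions for the Riemannian distance are continuous\<close>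

lemma smooth_onD_C1:
  assumes "smooth_on U f"
  shows "\<And>x. x \<in> U \<Longrightarrow> f differentiable at x"
    and "\<And>v. continuous_on U (\<lambda>x. frechet_derivative f (at x) v)"
proof -
  have "Ck_on (Suc 0) U f" using assms unfolding smooth_on_def by blast
  then show "\<And>x. x \<in> U \<Longrightarrow> f differentiable at x"
    and "\<And>v. continuous_on U (\<lambda>x. frechet_derivative f (at x) v)" by simp_all
qed

lemma smooth_on_continuous_on: "smooth_on U f \<Longrightarrow> continuous_on U f"
  unfolding smooth_on_def using Ck_on.simps(1) by blast

lemma C1_derivative_bounded_on_compact:
  fixes f :: "'a::euclidean_space \<Rightarrow> 'b::euclidean_space"
  assumes "smooth_on U f" "compact C" "C \<subseteq> U"
  obtains c where "c \<ge> 0" "\<And>x v. x \<in> C \<Longrightarrow> norm (frechet_derivative f (at x) v) \<le> c * norm v"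
proof -
  have "\<exists>c. \<forall>x\<in>C. norm (frechet_derivative f (at x) b) \<le> c" for b
  proof -
    have "continuous_on C (\<lambda>x. frechet_derivative f (at x) b)"
      using smooth_onD_C1(2)[OF assms(1)] assms(3) continuous_on_subset by blast
    then have "bounded ((\<lambda>x. frechet_derivative f (at x) b) ` C)"
      using assms(2) compact_continuous_image compact_imp_bounded by blast
    then show ?thesis unfolding bounded_iff by auto
  qed
  then obtain cb where cb: "\<And>b x. x \<in> C \<Longrightarrow> norm (frechet_derivative f (at x) b) \<le> cb b" by metis
  define c where "c = (\<Sum>b\<in>Basis. \<bar>cb b\<bar>)"
  have "norm (frechet_derivative f (at x) v) \<le> c * norm v" if "x \<in> C" for x v
  proof -
    have lin: "linear (frechet_derivative f (at x))"
      using smooth_onD_C1(1)[OF assms(1)] that assms(3) linear_frechet_derivative by blast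
    have "frechet_derivative f (at x) v = frechet_derivative f (at x) (\<Sum>b\<in>Basis. (v \<bullet> b) *\<^sub>R b)"
      by (simp add: euclidean_representation)
    also have "\<dots> = (\<Sum>b\<in>Basis. (v \<bullet> b) *\<^sub>R frechet_derivative f (at x) b)"
      by (simp add: linear_sum[OF lin] linear_cmul[OF lin])
    finally have "norm (frechet_derivative f (at x) v) \<le> (\<Sum>b\<in>Basis. \<bar>v \<bullet> b\<bar> * norm (frechet_derivative f (at x) b))"
      using norm_sum[of "\<lambda>b. (v \<bullet> b) *\<^sub>R frechet_derivative f (at x) b" Basis] by simp
    also have "\<dots> \<le> (\<Sum>b\<in>Basis. norm v * \<bar>cb b\<bar>)"
    proof (intro sum_mono mult_mono)
      fix b :: 'a assume "b \<in> Basis"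
      then show "\<bar>v \<bullet> b\<bar> \<le> norm v" by (rule Basis_le_norm)
      show "norm (frechet_derivative f (at x) b) \<le> \<bar>cb b\<bar>" using cb[OF that, of b] by linarith
    qed auto
    finally show ?thesis by (simp add: c_def sum_distrib_left mult.commute)
  qed
  moreover have "c \<ge> 0" by (auto simp: c_def intro: sum_nonneg)
  ultimately show thesis using that by blast
qed

text \<open>
  The chart maps the straight segment from \<open>u\<close> to \<open>w\<close>, which lies in the subspace \<open>span B\<close>, to a
  curve in the submanifold whose speed is at most \<open>c * norm (w - u)\<close>.
\<close>

lemma riemannian_dist_le_in_slice_chart:
  fixes \<phi> :: "'e::euclidean_space \<Rightarrow> 'e"
  assumes chart: "slice_chart \<M> B U V \<phi>" and r: "cball u r \<subseteq> U"
    and c: "c \<ge> 0" "\<And>x v. x \<in> cball u r \<Longrightarrow> norm (frechet_derivative \<phi> (at x) v) \<le> c * norm v"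
    and u: "u \<in> span B" and w: "w \<in> span B" "w \<in> cball u r"
  shows "riemannian_dist \<M> (\<phi> u) (\<phi> w) \<le> ereal (c * norm (w - u))"
proof -
  define \<sigma> where "\<sigma> = (\<lambda>t::real. u + t *\<^sub>R (w - u))"
  define \<gamma> where "\<gamma> = \<phi> \<circ> \<sigma>"
  define D where "D = (\<lambda>t. frechet_derivative \<phi> (at (\<sigma> t)) (w - u))"
  have smooth: "smooth_on U \<phi>" and img: "\<phi> ` (U \<inter> span B) = \<M> \<inter> V"
    using chart unfolding slice_chart_def by auto
  have \<sigma>: "\<sigma> t \<in> cball u r \<inter> span B" if "t \<in> {0..1}" for t
  proof -
    have "\<bar>t\<bar> * norm (w - u) \<le> 1 * r"
      using that w by (intro mult_mono) (auto simp: dist_norm norm_minus_commute)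
    then show ?thesis using u w
      by (auto simp: \<sigma>_def dist_norm intro!: span_add span_scale span_diff)
  qed
  have \<sigma>U: "\<sigma> ` {0..1} \<subseteq> U" using \<sigma> r by auto
  have deriv: "(\<gamma> has_vector_derivative D t) (at t)" if "t \<in> {0..1}" for t
  proof -
    have s: "(\<sigma> has_derivative (\<lambda>h. h *\<^sub>R (w - u))) (at t)"
      unfolding \<sigma>_def by (auto intro!: derivative_eq_intros)
    have "\<phi> differentiable at (\<sigma> t)" using smooth_onD_C1(1)[OF smooth] \<sigma>U that by blast
    then have d: "(\<phi> has_derivative frechet_derivative \<phi> (at (\<sigma> t))) (at (\<sigma> t))"
      using frechet_derivative_works by blast
    from diff_chain_at[OF s d] show ?thesis
      unfolding has_vector_derivative_def \<gamma>_def D_def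
      by (simp add: comp_def linear_cmul[OF has_derivative_linear[OF d]])
  qed
  have contD: "continuous_on {0..1} D"
  proof -
    have "continuous_on {0..1} \<sigma>" unfolding \<sigma>_def by (intro continuous_intros)
    then show ?thesis
      unfolding D_def using continuous_on_compose2[OF smooth_onD_C1(2)[OF smooth] _ \<sigma>U] by blast
  qed
  have "\<gamma> C1_differentiable_on {0..1}"
    unfolding C1_differentiable_on_def using deriv contD by blast
  then have "valid_path \<gamma>"
    unfolding valid_path_def by (rule C1_differentiable_imp_piecewise)
  moreover have "path_image \<gamma> \<subseteq> \<M>"
  proof -
    have "\<phi> (\<sigma> t) \<in> \<M>" if "t \<in> {0..1}" for t
    proof -
      have "\<phi> (\<sigma> t) \<in> \<phi> ` (U \<inter> span B)" using \<sigma>[OF that] r by auto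
      then show ?thesis unfolding img by simp
    qed
    then show ?thesis unfolding path_image_def \<gamma>_def by auto
  qed
  moreover have "pathstart \<gamma> = \<phi> u" "pathfinish \<gamma> = \<phi> w"
    by (simp_all add: pathstart_def pathfinish_def \<gamma>_def \<sigma>_def)
  ultimately have "riemannian_dist \<M> (\<phi> u) (\<phi> w) \<le> enn2ereal (curve_length \<gamma>)"
    unfolding riemannian_dist_def less_eq_ennreal.rep_eq[symmetric] by (intro INF_lower) auto
  moreover have "curve_length \<gamma> \<le> (\<integral>\<^sup>+t\<in>{0..1::real}. ennreal (c * norm (w - u)) \<partial>lborel)"
    unfolding curve_length_def
  proof (rule nn_integral_mono)
    fix t :: real
    show "ennreal (norm (vector_derivative \<gamma> (at t))) * indicator {0..1} t
          \<le> ennreal (c * norm (w - u)) * indicator {0..1} t"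
      using c(2)[of "\<sigma> t" "w - u"] \<sigma>[of t] vector_derivative_at[OF deriv[of t]]
      by (auto simp: D_def indicator_def intro!: ennreal_leI)
  qed
  then have "curve_length \<gamma> \<le> ennreal (c * norm (w - u))"
    by (simp add: nn_integral_cmult_indicator)
  ultimately show ?thesis
    using c(1) by (auto simp: less_eq_ennreal.rep_eq enn2ereal_ennreal)
qed

lemma riemannian_dist_nonneg: "0 \<le> riemannian_dist \<M> p q"
  unfolding riemannian_dist_def by simp

text \<open>
  Near \<open>p\<close> the inverse chart is continuous, so that points close to \<open>p\<close> in the ambient space have
  close coordinates and are joined to \<open>p\<close> by a short curve.
\<close>

lemma riemannian_dist_tendsto_0:
  fixes \<M> :: "'e::euclidean_space set"
  assumes M: "embedded_submanifold k \<M>" and p: "p \<in> \<M>" and e: "e > 0"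
  obtains d where "d > 0" "\<And>q. q \<in> \<M> \<Longrightarrow> dist q p < d \<Longrightarrow> riemannian_dist \<M> p q \<le> ereal e"
proof -
  obtain B U V \<phi> where chart: "slice_chart \<M> B U V \<phi>" and pV: "p \<in> V"
    using M p unfolding embedded_submanifold_def by blast
  then have UV: "open U" "open V" and bij: "bij_betw \<phi> U V" and smooth: "smooth_on U \<phi>"
    and smooth': "smooth_on V (inv_into U \<phi>)" and img: "\<phi> ` (U \<inter> span B) = \<M> \<inter> V"
    unfolding slice_chart_def by auto
  define \<psi> where "\<psi> = inv_into U \<phi>"
  have chart_inv: "\<psi> q \<in> span B" "\<psi> q \<in> U" "\<phi> (\<psi> q) = q" if "q \<in> \<M>" "q \<in> V" for q
  proof -
    have "q \<in> \<phi> ` (U \<inter> span B)" unfolding img using that by simp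
    then obtain x where x: "x \<in> U" "x \<in> span B" "q = \<phi> x" by auto
    moreover have "\<psi> q = x" using x bij by (simp add: \<psi>_def bij_betw_def)
    ultimately show "\<psi> q \<in> span B" "\<psi> q \<in> U" "\<phi> (\<psi> q) = q" by auto
  qed
  obtain r where r: "r > 0" "cball (\<psi> p) r \<subseteq> U"
    using UV(1) chart_inv(2)[OF p pV] open_contains_cball by blast
  obtain c where c: "c \<ge> 0" "\<And>x v. x \<in> cball (\<psi> p) r \<Longrightarrow> norm (frechet_derivative \<phi> (at x) v) \<le> c * norm v"
    using C1_derivative_bounded_on_compact[OF smooth compact_cball r(2)] by blast
  \<comment> \<open>Dividing by \<open>c + 1\<close> allows for \<open>c = 0\<close>.\<close>
  define \<eta> where "\<eta> = min r (e / (c + 1))"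
  have \<eta>: "\<eta> > 0" using r e c by (simp add: \<eta>_def)
  have "continuous_on V \<psi>" unfolding \<psi>_def by (rule smooth_on_continuous_on[OF smooth'])
  then obtain d1 where d1: "d1 > 0" "\<And>q. q \<in> V \<Longrightarrow> dist q p < d1 \<Longrightarrow> dist (\<psi> q) (\<psi> p) < \<eta>"
    using pV \<eta> unfolding continuous_on_iff by meson
  obtain d2 where d2: "d2 > 0" "ball p d2 \<subseteq> V" using UV(2) pV open_contains_ball by blast
  show thesis
  proof (rule that)
    show "min d1 d2 > 0" using d1 d2 by simp
    fix q assume q: "q \<in> \<M>" "dist q p < min d1 d2"
    then have qV: "q \<in> V" using d2 by (auto simp: dist_commute)
    have close: "dist (\<psi> q) (\<psi> p) < \<eta>" using d1(2) qV q by auto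
    have "riemannian_dist \<M> (\<phi> (\<psi> p)) (\<phi> (\<psi> q)) \<le> ereal (c * norm (\<psi> q - \<psi> p))"
      by (rule riemannian_dist_le_in_slice_chart[OF chart r(2) c chart_inv(1)[OF p pV] chart_inv(1)[OF q(1) qV]])
         (use close in \<open>auto simp: \<eta>_def dist_commute\<close>)
    moreover have "c * norm (\<psi> q - \<psi> p) \<le> e"
    proof -
      have "c * norm (\<psi> q - \<psi> p) \<le> (c + 1) * (e / (c + 1))"
        using close c(1) by (intro mult_mono) (auto simp: \<eta>_def dist_norm)
      then show ?thesis using c(1) by simp
    qed
    ultimately show "riemannian_dist \<M> p q \<le> ereal e"
      unfolding chart_inv(3)[OF p pV] chart_inv(3)[OF q(1) qV] by (simp add: order_trans)
  qed
qed

text \<open>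
  The constant may be negative: then the hypothesis bounds a nonnegative number by a nonpositive
  one, and \<open>\<bar>c\<bar>\<close> still works as a Lipschitz constant.
\<close>

lemma Lipschitz_riemannian_imp_continuous_on:
  fixes h :: "'e::euclidean_space \<Rightarrow> 'b::metric_space"
  assumes M: "embedded_submanifold k \<M>"
    and h: "\<And>p q. p \<in> \<M> \<Longrightarrow> q \<in> \<M> \<Longrightarrow> ereal (dist (h p) (h q)) \<le> ereal c * riemannian_dist \<M> p q"
  shows "continuous_on \<M> h"
  unfolding continuous_on_iff
proof (intro ballI allI impI)
  fix p and e :: real assume p: "p \<in> \<M>" and e: "e > 0"
  \<comment> \<open>The factor 2 makes the final inequality strict, and adding 1 allows for \<open>c = 0\<close>.\<close>
  define e' where "e' = e / (2 * (\<bar>c\<bar> + 1))"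
  have e': "e' > 0" using e by (simp add: e'_def add_nonneg_pos)
  obtain d where d: "d > 0" "\<And>q. q \<in> \<M> \<Longrightarrow> dist q p < d \<Longrightarrow> riemannian_dist \<M> p q \<le> ereal e'"
    using riemannian_dist_tendsto_0[OF M p e'] by blast
  have "dist (h q) (h p) < e" if q: "q \<in> \<M>" "dist q p < d" for q
  proof -
    have "ereal (dist (h p) (h q)) \<le> ereal c * riemannian_dist \<M> p q" using h p q by blast
    also have "\<dots> \<le> ereal \<bar>c\<bar> * riemannian_dist \<M> p q"
      using riemannian_dist_nonneg by (intro ereal_mult_right_mono) auto
    also have "\<dots> \<le> ereal \<bar>c\<bar> * ereal e'"
      using d(2)[OF q] by (intro ereal_mult_left_mono) auto
    finally have "dist (h p) (h q) \<le> \<bar>c\<bar> * e'" by simp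
    also have "\<dots> \<le> (\<bar>c\<bar> + 1) * e'" using e' by (simp add: algebra_simps)
    also have "\<dots> = e / 2" by (simp add: e'_def field_simps)
    also have "\<dots> < e" using e by simp
    finally show ?thesis by (simp add: dist_commute)
  qed
  then show "\<exists>d>0. \<forall>q\<in>\<M>. dist q p < d \<longrightarrow> dist (h q) (h p) < e" using d(1) by blast
qed

section \<open>Pointwise regularity of the interaction law and the kernel\<close>

text \<open>
  The closed support, relative to the space of the measure.
\<close>

definition measure_support :: "'a::topological_space measure \<Rightarrow> 'a set" where
  "measure_support \<nu> = space \<nu> - \<Union>{U. open U \<and> emeasure \<nu> (U \<inter> space \<nu>) = 0}"

text \<open>
  By Lindelof's theorem countably many of the null open sets already cover the complement of the
  support.
\<close>

lemma AE_in_measure_support: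
  fixes \<nu> :: "'a::second_countable_topology measure"
  assumes sets: "sets \<nu> = sets (restrict_space borel M)"
  shows "AE m in \<nu>. m \<in> measure_support \<nu>"
proof -
  have sp: "space \<nu> = M" using sets_eq_imp_space_eq[OF sets] by (simp add: space_restrict_space)
  obtain \<F> where \<F>: "\<F> \<subseteq> {U. open U \<and> emeasure \<nu> (U \<inter> space \<nu>) = 0}" "countable \<F>"
    "\<Union>\<F> = \<Union>{U. open U \<and> emeasure \<nu> (U \<inter> space \<nu>) = 0}"
    using Lindelof[of "{U. open U \<and> emeasure \<nu> (U \<inter> space \<nu>) = 0}"] by blast
  have "U \<inter> space \<nu> \<in> null_sets \<nu>" if "U \<in> \<F>" for U
  proof -
    have "open U" "emeasure \<nu> (U \<inter> space \<nu>) = 0" using that \<F>(1) by auto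
    moreover have "U \<inter> space \<nu> \<in> sets \<nu>"
      unfolding sets sp sets_restrict_space using \<open>open U\<close> by (auto simp: Int_commute)
    ultimately show ?thesis by auto
  qed
  then have "(\<Union>U\<in>\<F>. U \<inter> space \<nu>) \<in> null_sets \<nu>" using \<F>(2) by (intro null_sets_UN')
  then show ?thesis
    by (rule AE_I') (auto simp: measure_support_def \<F>(3)[symmetric])
qed

text \<open>
  A continuous function that exceeds \<open>c\<close> at a point of the support does so on a relatively open set
  of positive measure.
\<close>

lemma AE_le_imp_le_on_measure_support:
  fixes h :: "'a::metric_space \<Rightarrow> real"
  assumes sets: "sets \<nu> = sets (restrict_space borel M)"
    and h: "continuous_on M h" and le: "AE m in \<nu>. h m \<le> c" and m: "m \<in> measure_support \<nu>"
  shows "h m \<le> c"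
proof (rule ccontr)
  assume "\<not> h m \<le> c"
  have sp: "space \<nu> = M" using sets_eq_imp_space_eq[OF sets] by (simp add: space_restrict_space)
  obtain U where U: "open U" "U \<inter> M = h -` {c<..} \<inter> M"
    using h open_greaterThan[of c] unfolding continuous_on_open_invariant by blast
  have "AE x in \<nu>. x \<notin> U \<inter> space \<nu>" using le by eventually_elim (use U sp in auto)
  moreover have "U \<inter> space \<nu> \<in> sets \<nu>"
    unfolding sets sp sets_restrict_space using \<open>open U\<close> by (auto simp: Int_commute)
  ultimately have "emeasure \<nu> (U \<inter> space \<nu>) = 0"
    using AE_iff_measurable[of "U \<inter> space \<nu>" \<nu> "\<lambda>x. x \<notin> U \<inter> space \<nu>"] by auto
  moreover have "m \<in> U" using \<open>\<not> h m \<le> c\<close> m U sp unfolding measure_support_def by auto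
  ultimately show False using m U(1) unfolding measure_support_def by auto
qed

lemma AE_le_Linf_norm: "Linf_norm N f \<le> ereal c \<Longrightarrow> AE z in N. \<bar>f z\<bar> \<le> c"
proof -
  assume "Linf_norm N f \<le> ereal c"
  moreover have "AE z in N. ereal \<bar>f z\<bar> \<le> Linf_norm N f"
    unfolding Linf_norm_def by (rule esssup_AE)
  ultimately show ?thesis
    by (auto elim!: eventually_mono dest: order_trans)
qed

text \<open>
  Nonempty open sets are not negligible for Lebesgue measure, so that a continuous function
  exceeds its essential supremum nowhere.
\<close>

lemma abs_le_Linf_norm_lborel:
  fixes K :: "'a::euclidean_space \<Rightarrow> real"
  assumes "continuous_on UNIV K" and "bounded (range K)"
  shows "\<bar>K x\<bar> \<le> real_of_ereal (Linf_norm lborel K)"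
proof -
  obtain b where b: "\<And>x. \<bar>K x\<bar> \<le> b" using assms(2) unfolding bounded_iff by auto
  have meas: "(\<lambda>x. ereal \<bar>K x\<bar>) \<in> borel_measurable lborel"
    using borel_measurable_continuous_onI[OF assms(1)] by simp
  have up: "Linf_norm lborel K \<le> ereal b"
    unfolding Linf_norm_def using meas b by (intro esssup_I) auto
  have ae: "AE x in lborel. ereal \<bar>K x\<bar> \<le> Linf_norm lborel K"
    unfolding Linf_norm_def by (rule esssup_AE)
  have lo: "0 \<le> Linf_norm lborel K"
  proof (rule ccontr)
    assume "\<not> 0 \<le> Linf_norm lborel K"
    then have "\<not> ereal \<bar>K x\<bar> \<le> Linf_norm lborel K" for x
      using order_trans[of 0 "ereal \<bar>K x\<bar>" "Linf_norm lborel K"] by auto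
    then have "AE x in (lborel :: 'a measure). False" using ae by simp
    then have "emeasure (lborel :: 'a measure) UNIV = 0"
      using AE_iff_measurable[of UNIV lborel "\<lambda>_. False"] by auto
    then show False by (simp add: emeasure_lborel_UNIV)
  qed
  have fin: "Linf_norm lborel K = ereal (real_of_ereal (Linf_norm lborel K))"
    using up lo by (cases "Linf_norm lborel K") auto
  define c where "c = real_of_ereal (Linf_norm lborel K)"
  have c: "Linf_norm lborel K = ereal c" using fin c_def by simp
  show "\<bar>K x\<bar> \<le> real_of_ereal (Linf_norm lborel K)" unfolding c_def[symmetric]
  proof (rule ccontr)
    assume *: "\<not> \<bar>K x\<bar> \<le> c"
    define S where "S = {x. c < \<bar>K x\<bar>}"
    have "open S" unfolding S_def
      by (intro open_Collect_less continuous_intros assms(1))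
    moreover have "x \<in> S" using * by (simp add: S_def)
    ultimately have "\<not> negligible S" using open_not_negligible by blast
    moreover have "S \<in> null_sets lborel"
      using ae AE_iff_null_sets[of S lborel] \<open>open S\<close> by (auto simp: S_def c not_less)
    ultimately show False
      using negligible_iff_null_sets null_sets_completionI by blast
  qed
qed

text \<open>
  For fixed \<open>J\<close> the law is continuous in \<open>m\<close>; therefore the almost everywhere bounds of the
  interaction law, whose exceptional sets depend on \<open>J\<close> and \<open>J'\<close>, hold at every point of the support.
  Continuity in \<open>m\<close> and a local Lipschitz bound in \<open>J\<close> give joint continuity on the support, hence
  joint measurability after extension by zero.
\<close>

lemma interaction_law_regular_on_support:
  fixes \<M> :: "'e::euclidean_space set"
  assumes M: "embedded_submanifold k \<M>" and comp: "compact \<M>"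
    and sets: "sets \<nu> = sets (restrict_space borel \<M>)"
    and law: "interaction_law \<M> \<nu> \<alpha> L \<theta> Q"
  shows "0 \<le> indicator (measure_support \<nu>) m * Q J m"
    and "a > 0 \<Longrightarrow> norm J \<le> a \<Longrightarrow> norm J' \<le> a \<Longrightarrow> m \<in> measure_support \<nu> \<Longrightarrow>
           \<bar>Q J m - Q J' m\<bar> \<le> \<theta> a * norm (J - J')"
    and "(\<lambda>(J, m). indicator (measure_support \<nu>) m * Q J m) \<in> borel_measurable (borel \<Otimes>\<^sub>M \<nu>)"
proof -
  have sp: "space \<nu> = \<M>" using sets_eq_imp_space_eq[OF sets] by (simp add: space_restrict_space)
  define S where "S = measure_support \<nu>"
  have SM: "S \<subseteq> \<M>" unfolding S_def measure_support_def sp by auto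
  have contQ: "continuous_on \<M> (Q J)" for J
  proof (rule Lipschitz_riemannian_imp_continuous_on[OF M])
    fix p q assume "p \<in> \<M>" "q \<in> \<M>"
    have "norm J + 1 > 0" "norm J \<le> norm J + 1" by (simp_all add: add_nonneg_pos)
    then have "ereal \<bar>Q J p - Q J q\<bar> \<le> ereal (L (norm J + 1)) * riemannian_dist \<M> p q"
      using law \<open>p \<in> \<M>\<close> \<open>q \<in> \<M>\<close> unfolding interaction_law_def by blast
    then show "ereal (dist (Q J p) (Q J q)) \<le> ereal (L (norm J + 1)) * riemannian_dist \<M> p q"
      by (simp add: dist_real_def)
  qed
  have nonneg: "0 \<le> Q J m" if "m \<in> S" for J m
  proof -
    have "AE m in \<nu>. 0 \<le> Q J m"
      using law unfolding interaction_law_def prob_density_def by blast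
    then have "- Q J m \<le> 0"
      using that unfolding S_def
      by (intro AE_le_imp_le_on_measure_support[OF sets, of "\<lambda>m. - Q J m"] continuous_intros contQ) auto
    then show ?thesis by simp
  qed
  then show "0 \<le> indicator (measure_support \<nu>) m * Q J m"
    by (auto simp: indicator_def S_def)
  have lip: "\<bar>Q J m - Q J' m\<bar> \<le> \<theta> a * norm (J - J')"
    if "a > 0" "norm J \<le> a" "norm J' \<le> a" "m \<in> S" for a J J' m
  proof -
    have "Linf_norm \<nu> (\<lambda>m. Q J m - Q J' m) \<le> ereal (\<theta> a * norm (J - J'))"
      using law that(1-3) unfolding interaction_law_def by blast
    then have "AE m in \<nu>. \<bar>Q J m - Q J' m\<bar> \<le> \<theta> a * norm (J - J')"
      by (rule AE_le_Linf_norm)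
    then show ?thesis
      using that(4) unfolding S_def
      by (intro AE_le_imp_le_on_measure_support[OF sets, of "\<lambda>m. \<bar>Q J m - Q J' m\<bar>"] continuous_intros contQ)
  qed
  then show "a > 0 \<Longrightarrow> norm J \<le> a \<Longrightarrow> norm J' \<le> a \<Longrightarrow> m \<in> measure_support \<nu> \<Longrightarrow>
           \<bar>Q J m - Q J' m\<bar> \<le> \<theta> a * norm (J - J')" unfolding S_def by blast
  have "continuous_on (UNIV \<times> S) (\<lambda>(J, m). Q J m)"
    unfolding continuous_on_sequentially
  proof (intro allI ballI impI, elim conjE)
    fix z :: "nat \<Rightarrow> 'e \<times> 'e" and z0 assume z0: "z0 \<in> UNIV \<times> S" and z: "\<forall>n. z n \<in> UNIV \<times> S" and lim: "z \<longlonglongrightarrow> z0"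
    define J0 m0 J m where "J0 = fst z0" and "m0 = snd z0" and "J = (\<lambda>n. fst (z n))" and "m = (\<lambda>n. snd (z n))"
    have J: "J \<longlonglongrightarrow> J0" and m: "m \<longlonglongrightarrow> m0" and mS: "m0 \<in> S" "\<And>n. m n \<in> S"
      using tendsto_fst[OF lim] tendsto_snd[OF lim] z z0
      by (simp_all add: J_def m_def J0_def m0_def mem_Times_iff)
    \<comment> \<open>Almost all \<open>J n\<close> lie in the ball of radius \<open>a\<close>, where \<open>\<theta> a\<close> is a Lipschitz constant.\<close>
    define a where "a = norm J0 + 1"
    have "(\<lambda>n. norm (J n)) \<longlonglongrightarrow> norm J0" using J by (rule tendsto_norm)
    then have Ja: "\<forall>\<^sub>F n in sequentially. norm (J n) \<le> a"
      by (intro eventually_mono[OF order_tendstoD(2)[of _ _ _ a]]) (auto simp: a_def)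
    have "(\<lambda>n. Q (J n) (m n) - Q J0 (m n)) \<longlonglongrightarrow> 0"
    proof (rule Lim_null_comparison)
      show "\<forall>\<^sub>F n in sequentially. norm (Q (J n) (m n) - Q J0 (m n)) \<le> \<theta> a * norm (J n - J0)"
        using Ja by eventually_elim
          (use lip[of a] mS in \<open>auto simp: a_def add_nonneg_pos\<close>)
      have "(\<lambda>n. \<theta> a * norm (J n - J0)) \<longlonglongrightarrow> \<theta> a * norm (J0 - J0)"
        by (intro tendsto_intros J)
      then show "(\<lambda>n. \<theta> a * norm (J n - J0)) \<longlonglongrightarrow> 0" by simp
    qed
    moreover have "(\<lambda>n. Q J0 (m n)) \<longlonglongrightarrow> Q J0 m0"
      using mS SM by (intro continuous_on_tendsto_compose[OF contQ[of J0] m] always_eventually) auto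
    ultimately have "(\<lambda>n. (Q (J n) (m n) - Q J0 (m n)) + Q J0 (m n)) \<longlonglongrightarrow> 0 + Q J0 m0"
      by (rule tendsto_add)
    then show "((\<lambda>(J, m). Q J m) \<circ> z) \<longlonglongrightarrow> (case z0 of (J, m) \<Rightarrow> Q J m)"
      by (simp add: comp_def case_prod_beta J_def m_def J0_def m0_def)
  qed
  moreover have "S \<in> sets borel"
  proof -
    have "closed S" unfolding S_def measure_support_def sp
      using comp by (intro closed_Diff compact_imp_closed open_Union) auto
    then show ?thesis by simp
  qed
  then have "UNIV \<times> S \<in> sets (borel :: ('e \<times> 'e) measure)"
    unfolding borel_prod[symmetric] by (intro pair_measureI) auto
  ultimately have "(\<lambda>z. indicator (UNIV \<times> S) z *\<^sub>R (case z of (J, m) \<Rightarrow> Q J m)) \<in> borel_measurable (borel \<Otimes>\<^sub>M borel)"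
    unfolding borel_prod by (intro borel_measurable_continuous_on_indicator)
  moreover have "(\<lambda>z. z) \<in> borel \<Otimes>\<^sub>M \<nu> \<rightarrow>\<^sub>M borel \<Otimes>\<^sub>M borel"
  proof -
    have [measurable]: "(\<lambda>m. m) \<in> \<nu> \<rightarrow>\<^sub>M borel"
      using measurable_restrict_space1[OF measurable_ident_sets[OF refl]] measurable_cong_sets[OF sets refl]
      by blast
    have "(\<lambda>z. (fst z, snd z)) \<in> borel \<Otimes>\<^sub>M \<nu> \<rightarrow>\<^sub>M borel \<Otimes>\<^sub>M borel" by measurable
    then show ?thesis by simp
  qed
  ultimately have "(\<lambda>z. indicator (UNIV \<times> S) z *\<^sub>R (case z of (J, m) \<Rightarrow> Q J m)) \<in> borel_measurable (borel \<Otimes>\<^sub>M \<nu>)"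
    using measurable_compose by blast
  moreover have "(\<lambda>z. indicator (UNIV \<times> S) z *\<^sub>R (case z of (J, m) \<Rightarrow> Q J m)) = (\<lambda>(J, m). indicator S m * Q J m)"
    by (auto simp: indicator_def)
  ultimately show "(\<lambda>(J, m). indicator (measure_support \<nu>) m * Q J m) \<in> borel_measurable (borel \<Otimes>\<^sub>M \<nu>)"
    unfolding S_def by simp
qed

lemma normalised_volumeD:
  assumes "normalised_volume \<M> \<nu>"
  shows "sets \<nu> = sets (restrict_space borel \<M>)" and "prob_space \<nu>"
proof -
  obtain vol c where v: "riemannian_volume \<M> vol" "\<nu> = scale_measure (ennreal c) vol" "emeasure \<nu> \<M> = 1"
    using assms unfolding normalised_volume_def by blast
  then show s: "sets \<nu> = sets (restrict_space borel \<M>)"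
    unfolding riemannian_volume_def by simp
  have "space \<nu> = \<M>" using sets_eq_imp_space_eq[OF s] by (simp add: space_restrict_space)
  with v(3) show "prob_space \<nu>" by (intro prob_spaceI) simp
qed

text \<open>
  The space has mass one, so a probability density on it must exceed every number below one. The
  Lipschitz bound for two different arguments forces the second inequality.
\<close>

lemma interaction_law_constants:
  assumes "prob_space \<nu>" and law: "interaction_law \<M> \<nu> \<alpha> L \<theta> Q" and a: "a > 0"
  shows "1 \<le> \<alpha> a" and "0 \<le> \<theta> a"
proof -
  interpret prob_space \<nu> by fact
  have "Linf_norm \<nu> (Q 0) \<le> ereal (\<alpha> a)"
    using law a unfolding interaction_law_def by (metis norm_zero less_imp_le)
  then have "AE m in \<nu>. \<bar>Q 0 m\<bar> \<le> \<alpha> a" by (rule AE_le_Linf_norm)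
  then have le: "AE m in \<nu>. Q 0 m \<le> \<alpha> a" by (auto elim: eventually_mono)
  have "has_bochner_integral \<nu> (Q 0) 1"
    using law unfolding interaction_law_def prob_density_def by blast
  then have "1 = (LINT m|\<nu>. Q 0 m)" "integrable \<nu> (Q 0)" by (auto simp: has_bochner_integral_iff)
  moreover have "(LINT m|\<nu>. Q 0 m) \<le> (LINT m|\<nu>. \<alpha> a)"
    using calculation le by (intro integral_mono_AE) auto
  ultimately have "1 \<le> (LINT m|\<nu>. \<alpha> a)" by (simp only:)
  then show "1 \<le> \<alpha> a" using prob_space by simp
  obtain b :: 'a where b: "b \<in> Basis" using nonempty_Basis by blast
  have "norm (a *\<^sub>R b) \<le> a" "norm (0 :: 'a) \<le> a" using a b by simp_all
  then have "Linf_norm \<nu> (\<lambda>m. Q (a *\<^sub>R b) m - Q 0 m) \<le> ereal (\<theta> a * norm (a *\<^sub>R b - 0))"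
    using law a unfolding interaction_law_def by blast
  then have "AE m in \<nu>. \<bar>Q (a *\<^sub>R b) m - Q 0 m\<bar> \<le> \<theta> a * norm (a *\<^sub>R b - 0)" by (rule AE_le_Linf_norm)
  then have "AE m in \<nu>. 0 \<le> \<theta> a * norm (a *\<^sub>R b - 0)"
    by eventually_elim (rule order_trans[OF abs_ge_zero])
  then have "0 \<le> \<theta> a * a" using a b by simp
  then show "0 \<le> \<theta> a" using a by (simp add: zero_le_mult_iff)
qed

lemma observation_kernel_sup:
  assumes "observation_kernel K"
  shows "continuous_on UNIV K" and "\<bar>K x\<bar> \<le> real_of_ereal (Linf_norm lborel K)"
    and "real_of_ereal (Linf_norm lborel K) > 0"
proof -
  show cont: "continuous_on UNIV K"
    using assms smooth_on_continuous_on unfolding observation_kernel_def by blast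
  moreover have "bounded (range K)" using assms unfolding observation_kernel_def by blast
  ultimately show bd: "\<bar>K x\<bar> \<le> real_of_ereal (Linf_norm lborel K)" for x
    by (rule abs_le_Linf_norm_lborel)
  show "real_of_ereal (Linf_norm lborel K) > 0"
  proof (rule ccontr)
    assume "\<not> ?thesis"
    then have "K = (\<lambda>_. 0)" using bd by (intro ext) (smt (verit))
    then have "has_bochner_integral lborel (\<lambda>_ :: real^'a. 0 :: real) 1"
      using assms unfolding observation_kernel_def by simp
    then show False by (simp add: has_bochner_integral_iff)
  qed
qed

section \<open>The L1 norm with extended values\<close>

text \<open>
  The \<open>L\<^sup>1\<close> norm with values in \<open>[0, \<infinity>]\<close>, for which the triangle inequality and Tonelli's theorem ask
  for measurability only.
\<close>

definition L1_enorm :: "'a measure \<Rightarrow> ('a \<Rightarrow> real) \<Rightarrow> ennreal" where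
  "L1_enorm N f = (\<integral>\<^sup>+z. ennreal \<bar>f z\<bar> \<partial>N)"

lemma tendsto_0_le_ennreal:
  fixes u v :: "'a \<Rightarrow> ennreal"
  assumes "(v \<longlongrightarrow> 0) F" "\<And>x. u x \<le> v x"
  shows "(u \<longlongrightarrow> 0) F"
  using assms by (intro tendsto_sandwich[OF _ _ tendsto_const assms(1)] always_eventually) auto

lemma L1_enorm_triangle:
  assumes "f \<in> borel_measurable N" "g \<in> borel_measurable N" "h \<in> borel_measurable N"
  shows "L1_enorm N (\<lambda>z. f z - h z) \<le> L1_enorm N (\<lambda>z. f z - g z) + L1_enorm N (\<lambda>z. g z - h z)"
proof -
  have "L1_enorm N (\<lambda>z. f z - h z) \<le> (\<integral>\<^sup>+z. ennreal \<bar>f z - g z\<bar> + ennreal \<bar>g z - h z\<bar> \<partial>N)"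
    unfolding L1_enorm_def by (intro nn_integral_mono) (auto simp: ennreal_plus[symmetric] simp del: ennreal_plus intro!: ennreal_leI)
  also have "\<dots> = L1_enorm N (\<lambda>z. f z - g z) + L1_enorm N (\<lambda>z. g z - h z)"
    unfolding L1_enorm_def using assms by (intro nn_integral_add) auto
  finally show ?thesis .
qed

lemma L1_enorm_diff_le:
  assumes "f \<in> borel_measurable N" "g \<in> borel_measurable N"
  shows "L1_enorm N (\<lambda>z. f z - g z) \<le> L1_enorm N f + L1_enorm N g"
  using L1_enorm_triangle[OF assms(1) _ assms(2), of "\<lambda>_. 0"] by (simp add: L1_enorm_def)

lemma L1_enorm_minus_commute: "L1_enorm N (\<lambda>z. f z - g z) = L1_enorm N (\<lambda>z. g z - f z)"
  unfolding L1_enorm_def by (simp add: abs_minus_commute)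

lemma L1_enorm_cong_AE:
  "AE z in N. f z = g z \<Longrightarrow> L1_enorm N f = L1_enorm N g"
  unfolding L1_enorm_def by (intro nn_integral_cong_AE) auto

lemma L1_norm_eq_L1_enorm:
  "f \<in> borel_measurable N \<Longrightarrow> L1_norm N f = enn2real (L1_enorm N f)"
  unfolding L1_norm_def L1_enorm_def by (intro integral_eq_nn_integral) auto

lemma integrable_iff_L1_enorm:
  "integrable N f \<longleftrightarrow> f \<in> borel_measurable N \<and> L1_enorm N f < \<infinity>"
  unfolding integrable_iff_bounded L1_enorm_def by simp

lemma L1_enorm_eq_0D:
  assumes "f \<in> borel_measurable N" "g \<in> borel_measurable N" "L1_enorm N (\<lambda>z. f z - g z) = 0"
  shows "AE z in N. f z = g z"
proof -
  have "AE z in N. ennreal \<bar>f z - g z\<bar> = 0"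
    using assms by (subst nn_integral_0_iff_AE[symmetric]) (auto simp: L1_enorm_def)
  then show ?thesis by eventually_elim simp
qed

lemma prob_density_iff_L1_enorm:
  "prob_density N f \<longleftrightarrow> f \<in> borel_measurable N \<and> (AE z in N. 0 \<le> f z) \<and> L1_enorm N f = 1"
proof -
  have *: "(\<integral>\<^sup>+z. ennreal (f z) \<partial>N) = L1_enorm N f" if "AE z in N. 0 \<le> f z"
    unfolding L1_enorm_def using that by (intro nn_integral_cong_AE) auto
  have "has_bochner_integral N f 1 \<longleftrightarrow> f \<in> borel_measurable N \<and> (\<integral>\<^sup>+z. ennreal (f z) \<partial>N) = 1"
    if ae: "AE z in N. 0 \<le> f z"
  proof
    assume h: "has_bochner_integral N f 1"
    then have "(\<integral>\<^sup>+z. ennreal (f z) \<partial>N) = ennreal (integral\<^sup>L N f)"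
      using ae by (intro nn_integral_eq_integral) (auto simp: has_bochner_integral_iff)
    then show "f \<in> borel_measurable N \<and> (\<integral>\<^sup>+z. ennreal (f z) \<partial>N) = 1"
      using h by (auto simp: has_bochner_integral_iff)
  next
    assume "f \<in> borel_measurable N \<and> (\<integral>\<^sup>+z. ennreal (f z) \<partial>N) = 1"
    then show "has_bochner_integral N f 1"
      using ae by (intro has_bochner_integral_nn_integral) auto
  qed
  with * show ?thesis unfolding prob_density_def by metis
qed

lemma L1_enorm_cmult:
  "f \<in> borel_measurable N \<Longrightarrow> L1_enorm N (\<lambda>z. k * f z) = ennreal \<bar>k\<bar> * L1_enorm N f"
  unfolding L1_enorm_def by (subst nn_integral_cmult[symmetric]) (auto simp: abs_mult ennreal_mult)

lemma L1_enorm_add_le: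
  assumes "f \<in> borel_measurable N" "g \<in> borel_measurable N"
  shows "L1_enorm N (\<lambda>z. f z + g z) \<le> L1_enorm N f + L1_enorm N g"
  using L1_enorm_diff_le[of f N "\<lambda>z. - g z"] assms by (simp add: L1_enorm_def)

lemma L1_enorm_add_nonneg:
  assumes "f \<in> borel_measurable N" "g \<in> borel_measurable N" "\<And>z. 0 \<le> f z" "\<And>z. 0 \<le> g z"
  shows "L1_enorm N (\<lambda>z. f z + g z) = L1_enorm N f + L1_enorm N g"
  unfolding L1_enorm_def using assms by (subst nn_integral_add[symmetric]) auto

section \<open>Free transport and its strong continuity\<close>

locale free_transport = prob_space \<nu> for \<nu> :: "'e::euclidean_space measure" +
  fixes \<Phi> :: "'e \<Rightarrow> real^'d"
  assumes measurable_velocity[measurable]: "\<Phi> \<in> borel_measurable \<nu>"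
begin

abbreviation P :: "((real^'d) \<times> 'e) measure" where "P \<equiv> phase_measure \<nu>"

text \<open>
  The flow of the equation without collisions, followed backwards in time.
\<close>

definition transport :: "real \<Rightarrow> (real^'d) \<times> 'e \<Rightarrow> (real^'d) \<times> 'e" where
  "transport t = (\<lambda>(x, m). (x - t *\<^sub>R \<Phi> m, m))"

lemma sets_phase_measure[measurable_cong]: "sets P = sets (borel \<Otimes>\<^sub>M \<nu>)"
  unfolding phase_measure_def by (intro sets_pair_measure_cong) auto

lemma space_phase_measure: "space P = UNIV \<times> space \<nu>"
  unfolding phase_measure_def by (simp add: space_pair_measure)

sublocale phase: pair_sigma_finite "lborel :: (real^'d) measure" \<nu> ..

lemma sigma_finite_phase: "sigma_finite_measure P"
  unfolding phase_measure_def by (rule phase.P.sigma_finite_measure_axioms)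

lemma nn_integral_phase:
  assumes "f \<in> borel_measurable P"
  shows "(\<integral>\<^sup>+x. \<integral>\<^sup>+m. f (x, m) \<partial>\<nu> \<partial>lborel) = integral\<^sup>N P f"
    and "(\<integral>\<^sup>+m. \<integral>\<^sup>+x. f (x, m) \<partial>lborel \<partial>\<nu>) = integral\<^sup>N P f"
  using assms unfolding phase_measure_def
  by (intro nn_integral_fst phase.nn_integral_snd; simp)+

lemma transport_joint_measurable[measurable]:
  "(\<lambda>(t, z). transport t z) \<in> borel \<Otimes>\<^sub>M P \<rightarrow>\<^sub>M P"
  unfolding transport_def case_prod_beta by measurable

lemma measurable_transport[measurable]: "transport t \<in> P \<rightarrow>\<^sub>M P"
  unfolding transport_def case_prod_beta by measurable

lemma transport_add: "transport s (transport t z) = transport (s + t) z"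
  by (simp add: transport_def case_prod_beta algebra_simps)

text \<open>
  For each fixed \<open>m\<close> the map is a translation in \<open>x\<close>.
\<close>

lemma nn_integral_transport:
  assumes f[measurable]: "f \<in> borel_measurable P"
  shows "(\<integral>\<^sup>+z. f (transport t z) \<partial>P) = integral\<^sup>N P f"
proof -
  have "(\<integral>\<^sup>+z. f (transport t z) \<partial>P) = (\<integral>\<^sup>+m. \<integral>\<^sup>+x. f (transport t (x, m)) \<partial>lborel \<partial>\<nu>)"
    by (intro nn_integral_phase(2)[symmetric]) measurable
  also have "\<dots> = (\<integral>\<^sup>+m. \<integral>\<^sup>+x. f (x, m) \<partial>lborel \<partial>\<nu>)"
  proof (rule nn_integral_cong)
    fix m assume m[measurable]: "m \<in> space \<nu>"
    have "(\<integral>\<^sup>+x. f (x, m) \<partial>lborel) = (\<integral>\<^sup>+x. f (x, m) \<partial>distr lborel borel ((+) (- t *\<^sub>R \<Phi> m)))"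
      by (simp only: lborel_distr_plus)
    also have "\<dots> = (\<integral>\<^sup>+x. f (- t *\<^sub>R \<Phi> m + x, m) \<partial>lborel)"
      by (intro nn_integral_distr) measurable
    finally show "(\<integral>\<^sup>+x. f (transport t (x, m)) \<partial>lborel) = (\<integral>\<^sup>+x. f (x, m) \<partial>lborel)"
      by (simp add: transport_def)
  qed
  also have "\<dots> = integral\<^sup>N P f" by (intro nn_integral_phase(2)) measurable
  finally show ?thesis .
qed

lemma AE_transport:
  assumes "AE z in P. R z"
  shows "AE z in P. R (transport t z)"
proof -
  have "distr P P (transport t) = P"
  proof (rule measure_eqI)
    fix A assume "A \<in> sets (distr P P (transport t))"
    then have A[measurable]: "A \<in> sets P" by simp
    have "emeasure (distr P P (transport t)) A = (\<integral>\<^sup>+z. indicator A z \<partial>distr P P (transport t))"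
      by simp
    also have "\<dots> = (\<integral>\<^sup>+z. indicator A (transport t z) \<partial>P)" by (intro nn_integral_distr) measurable
    also have "\<dots> = emeasure P A" by (simp add: nn_integral_transport)
    finally show "emeasure (distr P P (transport t)) A = emeasure P A" .
  qed simp
  then have "AE z in distr P P (transport t). R z"
    using assms by (rule ssubst[where P = "\<lambda>M. AE z in M. R z"])
  then show ?thesis by (rule AE_distrD[OF measurable_transport])
qed

lemma L1_enorm_transport:
  assumes f[measurable]: "f \<in> borel_measurable P"
  shows "L1_enorm P (\<lambda>z. f (transport t z)) = L1_enorm P f"
  unfolding L1_enorm_def using nn_integral_transport[of "\<lambda>z. ennreal \<bar>f z\<bar>" t] by simp

text \<open>
  Continuity at time zero suffices: transport is a group of isometries of \<open>L\<^sup>1\<close>, so continuity at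
  any other time follows.
\<close>

definition transport_continuous :: "((real^'d) \<times> 'e \<Rightarrow> real) \<Rightarrow> bool" where
  "transport_continuous f \<longleftrightarrow>
     (\<forall>h. h \<longlonglongrightarrow> 0 \<longrightarrow> (\<lambda>n::nat. L1_enorm P (\<lambda>z. f (transport (h n) z) - f z)) \<longlonglongrightarrow> 0)"

lemma transport_continuous_add:
  assumes [measurable]: "f \<in> borel_measurable P" "g \<in> borel_measurable P"
    and "transport_continuous f" "transport_continuous g"
  shows "transport_continuous (\<lambda>z. f z + g z)"
  unfolding transport_continuous_def
proof (intro allI impI)
  fix h :: "nat \<Rightarrow> real" assume h: "h \<longlonglongrightarrow> 0"
  have "(\<lambda>n. L1_enorm P (\<lambda>z. f (transport (h n) z) - f z) + L1_enorm P (\<lambda>z. g (transport (h n) z) - g z)) \<longlonglongrightarrow> 0 + 0"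
    using assms(3,4) h unfolding transport_continuous_def by (intro tendsto_add) auto
  then show "(\<lambda>n. L1_enorm P (\<lambda>z. f (transport (h n) z) + g (transport (h n) z) - (f z + g z))) \<longlonglongrightarrow> 0"
    unfolding add_0
  proof (rule tendsto_0_le_ennreal)
    fix n
    let ?T = "transport (h n)"
    have "L1_enorm P (\<lambda>z. f (?T z) + g (?T z) - (f z + g z))
        = L1_enorm P (\<lambda>z. (f (?T z) - f z) - (g z - g (?T z)))" by (simp add: algebra_simps)
    also have "\<dots> \<le> L1_enorm P (\<lambda>z. f (?T z) - f z) + L1_enorm P (\<lambda>z. g z - g (?T z))"
      by (intro L1_enorm_diff_le) measurable
    finally show "L1_enorm P (\<lambda>z. f (?T z) + g (?T z) - (f z + g z))
      \<le> L1_enorm P (\<lambda>z. f (?T z) - f z) + L1_enorm P (\<lambda>z. g (?T z) - g z)"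
      by (simp add: L1_enorm_minus_commute[of P g])
  qed
qed

lemma transport_continuous_cmult:
  assumes [measurable]: "f \<in> borel_measurable P" and "transport_continuous f"
  shows "transport_continuous (\<lambda>z. c * f z)"
  unfolding transport_continuous_def
proof (intro allI impI)
  fix h :: "nat \<Rightarrow> real" assume h: "h \<longlonglongrightarrow> 0"
  have "L1_enorm P (\<lambda>z. c * f (transport (h n) z) - c * f z)
      = ennreal \<bar>c\<bar> * L1_enorm P (\<lambda>z. f (transport (h n) z) - f z)" for n
    unfolding L1_enorm_def right_diff_distrib[symmetric] abs_mult
    by (subst nn_integral_cmult[symmetric]) (auto simp: ennreal_mult)
  moreover have "(\<lambda>n. ennreal \<bar>c\<bar> * L1_enorm P (\<lambda>z. f (transport (h n) z) - f z)) \<longlonglongrightarrow> ennreal \<bar>c\<bar> * 0"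
    using assms(2) h unfolding transport_continuous_def by (intro ennreal_tendsto_cmult) auto
  ultimately show "(\<lambda>n. L1_enorm P (\<lambda>z. c * f (transport (h n) z) - c * f z)) \<longlonglongrightarrow> 0" by simp
qed

text \<open>
  A three epsilon argument, with \<open>s i\<close> close to \<open>f\<close> and transport an isometry of \<open>L\<^sup>1\<close>.
\<close>

lemma transport_continuous_L1_limit:
  assumes [measurable]: "f \<in> borel_measurable P" "\<And>i. s i \<in> borel_measurable P"
    and s: "\<And>i::nat. transport_continuous (s i)"
    and lim: "(\<lambda>i. L1_enorm P (\<lambda>z. f z - s i z)) \<longlonglongrightarrow> 0"
  shows "transport_continuous f"
  unfolding transport_continuous_def
proof (intro allI impI)
  fix h :: "nat \<Rightarrow> real" assume h: "h \<longlonglongrightarrow> 0"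
  show "(\<lambda>n. L1_enorm P (\<lambda>z. f (transport (h n) z) - f z)) \<longlonglongrightarrow> 0"
  proof (rule order_tendstoI)
    fix e :: ennreal assume e: "0 < e"
    \<comment> \<open>As \<open>e\<close> may be infinite, \<open>\<delta>\<close> is a third of some real number below \<open>e\<close>.\<close>
    then obtain \<delta> :: ennreal where \<delta>: "\<delta> > 0" "\<delta> + \<delta> + \<delta> < e"
    proof -
      obtain q where q: "0 < q" "q < e" using e dense by blast
      then obtain r where r: "q = ennreal r" "r > 0"
        by (cases q) (auto simp: less_top[symmetric] ennreal_less_zero_iff)
      have "ennreal (r / 3) + ennreal (r / 3) + ennreal (r / 3) = ennreal r"
        using r by (simp add: ennreal_plus[symmetric] del: ennreal_plus)
      then show thesis using that[of "ennreal (r / 3)"] q r by (auto simp: ennreal_less_zero_iff)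
    qed
    obtain i where i: "L1_enorm P (\<lambda>z. f z - s i z) < \<delta>"
      using order_tendstoD(2)[OF lim \<delta>(1)] by (auto simp: eventually_sequentially)
    have "(\<lambda>n. L1_enorm P (\<lambda>z. s i (transport (h n) z) - s i z)) \<longlonglongrightarrow> 0"
      using s h unfolding transport_continuous_def by blast
    from order_tendstoD(2)[OF this \<delta>(1)]
    show "\<forall>\<^sub>F n in sequentially. L1_enorm P (\<lambda>z. f (transport (h n) z) - f z) < e"
    proof eventually_elim
      fix n assume n: "L1_enorm P (\<lambda>z. s i (transport (h n) z) - s i z) < \<delta>"
      let ?T = "transport (h n)"
      have 1: "L1_enorm P (\<lambda>z. f (?T z) - f z)
          \<le> L1_enorm P (\<lambda>z. f (?T z) - s i (?T z)) + L1_enorm P (\<lambda>z. s i (?T z) - f z)"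
        by (intro L1_enorm_triangle) measurable
      have 2: "L1_enorm P (\<lambda>z. s i (?T z) - f z)
          \<le> L1_enorm P (\<lambda>z. s i (?T z) - s i z) + L1_enorm P (\<lambda>z. s i z - f z)"
        by (intro L1_enorm_triangle) measurable
      have 3: "L1_enorm P (\<lambda>z. f (?T z) - s i (?T z)) = L1_enorm P (\<lambda>z. f z - s i z)"
        using L1_enorm_transport[of "\<lambda>z. f z - s i z" "h n"] by simp
      have 4: "L1_enorm P (\<lambda>z. s i z - f z) = L1_enorm P (\<lambda>z. f z - s i z)"
        by (rule L1_enorm_minus_commute)
      have "L1_enorm P (\<lambda>z. f (?T z) - s i (?T z)) + L1_enorm P (\<lambda>z. s i (?T z) - f z) \<le> \<delta> + (\<delta> + \<delta>)"
        unfolding 3 using i n 4 by (intro add_mono order_trans[OF 2]) (auto intro: less_imp_le)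
      with 1 have "L1_enorm P (\<lambda>z. f (?T z) - f z) \<le> \<delta> + (\<delta> + \<delta>)"
        by (rule order_trans)
      with \<delta>(2) show "L1_enorm P (\<lambda>z. f (?T z) - f z) < e" by (simp add: add.assoc)
    qed
  qed simp
qed

lemma transport_continuous_dominated_limit:
  assumes [measurable]: "f \<in> borel_measurable P" "\<And>i. s i \<in> borel_measurable P" "w \<in> borel_measurable P"
    and s: "\<And>i::nat. transport_continuous (s i)"
    and "\<And>z. z \<in> space P \<Longrightarrow> (\<lambda>i. s i z) \<longlonglongrightarrow> f z"
    and "\<And>i z. z \<in> space P \<Longrightarrow> \<bar>s i z\<bar> \<le> w z" and "(\<integral>\<^sup>+z. ennreal (w z) \<partial>P) < \<infinity>"
  shows "transport_continuous f"
proof (rule transport_continuous_L1_limit[OF _ _ s])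
  have "(\<lambda>i. (\<integral>\<^sup>+z. norm (f z - s i z) \<partial>P)) \<longlonglongrightarrow> 0"
    by (rule nn_integral_dominated_convergence_norm[of s P f w]) (use assms(5-7) in auto)
  then show "(\<lambda>i. L1_enorm P (\<lambda>z. f z - s i z)) \<longlonglongrightarrow> 0" by (simp add: L1_enorm_def)
qed measurable

lemma emeasure_phase_box_Times:
  "B \<in> sets \<nu> \<Longrightarrow> emeasure P (box a b \<times> B) < \<infinity>"
  unfolding phase_measure_def
  by (subst emeasure_pair_measure_Times)
    (use emeasure_lborel_box_finite[of a b] in \<open>auto simp: ennreal_mult_less_top emeasure_eq_measure\<close>)

text \<open>
  Off the boundary of the box, a null set, the transported indicators converge pointwise. They all
  have the same norm, and Scheffe's lemma turns pointwise convergence into convergence in \<open>L\<^sup>1\<close>.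
\<close>

lemma transport_continuous_indicator_box_Times:
  assumes B[measurable]: "B \<in> sets \<nu>"
  shows "transport_continuous (indicator (box a b \<times> B))"
  unfolding transport_continuous_def
proof (intro allI impI)
  fix h :: "nat \<Rightarrow> real" assume h: "h \<longlonglongrightarrow> 0"
  define f :: "(real^'d) \<times> 'e \<Rightarrow> real" where "f = indicator (box a b \<times> B)"
  have [measurable]: "f \<in> borel_measurable P" unfolding f_def by measurable
  have null: "cbox a b - box a b \<in> null_sets lborel"
    using negligible_frontier_interval[of a b]
    by (simp add: negligible_iff_null_sets null_sets_completion_iff)
  have "AE z in P. fst z \<notin> cbox a b - box a b"
    unfolding phase_measure_def
  proof (rule phase.AE_pair_measure)
    have "AE x in lborel. x \<notin> cbox a b - box a b" by (rule AE_not_in[OF null])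
    then show "AE x in lborel. AE m in \<nu>. fst (x, m) \<notin> cbox a b - box a b" by simp
  qed measurable
  then have conv: "AE z in P. (\<lambda>n. f (transport (h n) z)) \<longlonglongrightarrow> f z"
  proof eventually_elim
    fix z :: "(real^'d) \<times> 'e" assume z: "fst z \<notin> cbox a b - box a b"
    obtain x m where zxm: "z = (x, m)" by fastforce
    have lim: "(\<lambda>n. x - h n *\<^sub>R \<Phi> m) \<longlonglongrightarrow> x"
      using tendsto_diff[OF tendsto_const tendsto_scaleR[OF h tendsto_const], of x "\<Phi> m"] by simp
    have "\<forall>\<^sub>F n in sequentially. (x - h n *\<^sub>R \<Phi> m \<in> box a b) = (x \<in> box a b)"
    proof (cases "x \<in> box a b")
      case True
      then show ?thesis using topological_tendstoD[OF lim open_box] by auto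
    next
      case False
      then have "x \<in> - cbox a b" using z zxm by auto
      moreover have "open (- cbox a b)" by (intro open_Compl closed_cbox)
      ultimately have "\<forall>\<^sub>F n in sequentially. x - h n *\<^sub>R \<Phi> m \<in> - cbox a b"
        using topological_tendstoD[OF lim] by blast
      then show ?thesis
        by eventually_elim (use False box_subset_cbox in blast)
    qed
    then have "\<forall>\<^sub>F n in sequentially. f (transport (h n) z) = f z"
      by eventually_elim (auto simp: f_def zxm transport_def indicator_def)
    then show "(\<lambda>n. f (transport (h n) z)) \<longlonglongrightarrow> f z" by (rule tendsto_eventually)
  qed
  have "(\<lambda>n. \<integral>\<^sup>+z. norm (f (transport (h n) z) - f z) \<partial>P) \<longlonglongrightarrow> 0"
  proof (rule Scheffe_lemma2)
    show "integrable P f"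
      unfolding f_def using emeasure_phase_box_Times[OF B] by (intro integrable_real_indicator) measurable
    show "(\<integral>\<^sup>+z. norm (f (transport (h n) z)) \<partial>P) \<le> (\<integral>\<^sup>+z. norm (f z) \<partial>P)" for n
      using nn_integral_transport[of "\<lambda>z. ennreal (norm (f z))" "h n"] by simp
  qed (use conv in measurable)
  then show "(\<lambda>n. L1_enorm P (\<lambda>z. indicator (box a b \<times> B) (transport (h n) z) - indicator (box a b \<times> B) z)) \<longlonglongrightarrow> 0"
    by (simp add: L1_enorm_def f_def)
qed

lemma sets_phase_measure_generated:
  "sets P = sigma_sets (UNIV \<times> space \<nu>) {box a b \<times> B | a b B. B \<in> sets \<nu>}"
proof -
  have "sets P = sets (sigma (space (borel :: (real^'d) measure) \<times> space \<nu>)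
          {A \<times> B | A B. A \<in> range (\<lambda>(a, b). box a b) \<and> B \<in> sets \<nu>})"
    unfolding sets_phase_measure
  proof (rule sets_pair_eq)
    show "sets (borel :: (real^'d) measure) = sigma_sets (space borel) (range (\<lambda>(a, b). box a b))"
      by (simp add: borel_eq_box)
    show "\<Union>(range (\<lambda>n::nat. box (- real n *\<^sub>R One) (real n *\<^sub>R One))) = space (borel :: (real^'d) measure)"
      using UN_box_eq_UNIV by (simp add: scaleR_minus_left)
    show "sets \<nu> = sigma_sets (space \<nu>) (sets \<nu>)" by (simp add: sets.sigma_sets_eq)
    show "sets \<nu> \<subseteq> Pow (space \<nu>)" using sets.space_closed .
    show "countable {space \<nu>}" "{space \<nu>} \<subseteq> sets \<nu>" "\<Union>{space \<nu>} = space \<nu>" by auto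
  qed auto
  also have "\<dots> = sigma_sets (UNIV \<times> space \<nu>) {A \<times> B | A B. A \<in> range (\<lambda>(a, b). box a b) \<and> B \<in> sets \<nu>}"
    by (subst sets_measure_of) (auto dest: sets.sets_into_space)
  also have "{A \<times> B | A B. A \<in> range (\<lambda>(a, b). box a b :: (real^'d) set) \<and> B \<in> sets \<nu>} = {box a b \<times> B | a b B. B \<in> sets \<nu>}"
    by auto
  finally show ?thesis .
qed

text \<open>
  The sets with this property form a Dynkin system that contains the intersection stable generator
  of boxes times measurable sets. Intersecting with a fixed set \<open>C\<close> of finite measure keeps the
  indicators of complements integrable.
\<close>

lemma transport_continuous_indicator_Int_box:
  assumes "A \<in> sets P"
  shows "transport_continuous (indicator (A \<inter> (box a b \<times> space \<nu>)))"
proof -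
  define C where "C = box a b \<times> space \<nu>"
  have C[measurable]: "C \<in> sets P" unfolding C_def by measurable
  have finC: "emeasure P C < \<infinity>" unfolding C_def by (intro emeasure_phase_box_Times) simp
  have tcC: "transport_continuous (indicator C)"
    unfolding C_def by (intro transport_continuous_indicator_box_Times) simp
  let ?G = "{box a b \<times> B | a b B. B \<in> sets \<nu>} :: ((real^'d) \<times> 'e) set set"
  have "Int_stable ?G"
  proof (rule Int_stableI)
    fix U V assume "U \<in> ?G" "V \<in> ?G"
    then obtain p q p' q' B B' where "U = box p q \<times> B" "V = box p' q' \<times> B'" "B \<in> sets \<nu>" "B' \<in> sets \<nu>"
      by blast
    moreover obtain p'' q'' where "box p q \<inter> box p' q' = box p'' q''" using box_Int_box by blast
    ultimately have "U \<inter> V = box p'' q'' \<times> (B \<inter> B')" "B \<inter> B' \<in> sets \<nu>"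
      by (auto simp: Times_Int_Times)
    then show "U \<inter> V \<in> ?G" by blast
  qed
  moreover have "?G \<subseteq> Pow (UNIV \<times> space \<nu>)" by (auto dest: sets.sets_into_space)
  moreover have "A \<in> sigma_sets (UNIV \<times> space \<nu>) ?G" using assms sets_phase_measure_generated by simp
  ultimately have "transport_continuous (indicator (A \<inter> C))"
  proof (induction rule: sigma_sets_induct_disjoint)
    case (basic A)
    then obtain a' b' B where A: "A = box a' b' \<times> B" "B \<in> sets \<nu>" by blast
    obtain a'' b'' where "box a' b' \<inter> box a b = box a'' b''" using box_Int_box by blast
    then have "A \<inter> C = box a'' b'' \<times> B"
      using A sets.sets_into_space[OF A(2)] by (auto simp: C_def)
    then show ?case using transport_continuous_indicator_box_Times[OF A(2)] by simp
  next
    case empty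
    then show ?case by (simp add: transport_continuous_def L1_enorm_def)
  next
    case (compl A)
    then have [measurable]: "A \<in> sets P" using sets_phase_measure_generated by simp
    have "transport_continuous (\<lambda>z. indicator C z + (- 1) * indicator (A \<inter> C) z)"
      by (intro transport_continuous_add transport_continuous_cmult tcC compl.IH) measurable
    moreover have "(\<lambda>z. indicator C z + (- 1) * indicator (A \<inter> C) z) = (indicator ((UNIV \<times> space \<nu> - A) \<inter> C) :: _ \<Rightarrow> real)"
      by (auto simp: C_def indicator_def fun_eq_iff)
    ultimately show ?case by simp
  next
    case (union A)
    then have A[measurable]: "A i \<in> sets P" for i using sets_phase_measure_generated by auto
    have fin: "transport_continuous (indicator ((\<Union>i<n. A i) \<inter> C))" for n :: nat
    proof (induction n)
      case 0
      then show ?case by (simp add: transport_continuous_def L1_enorm_def)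
    next
      case (Suc n)
      have "transport_continuous (\<lambda>z. indicator ((\<Union>i<n. A i) \<inter> C) z + indicator (A n \<inter> C) z)"
        by (intro transport_continuous_add Suc union.IH) measurable
      moreover have "(\<lambda>z. indicator ((\<Union>i<n. A i) \<inter> C) z + indicator (A n \<inter> C) z)
          = (indicator ((\<Union>i<Suc n. A i) \<inter> C) :: _ \<Rightarrow> real)"
      proof -
        have "A n \<inter> A i = {}" if "i < n" for i
          using union.hyps(1) that unfolding disjoint_family_on_def by auto
        then show ?thesis
          by (auto simp: indicator_def fun_eq_iff lessThan_Suc)
      qed
      ultimately show ?case by simp
    qed
    show ?case
    proof (rule transport_continuous_dominated_limit[OF _ _ _ fin])
      show "(\<integral>\<^sup>+z. ennreal (indicator C z) \<partial>P) < \<infinity>" using finC by (simp add: ennreal_indicator)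
      show "(\<lambda>i. indicator ((\<Union>i<i. A i) \<inter> C) z) \<longlonglongrightarrow> (indicator ((\<Union>i. A i) \<inter> C) z :: real)" for z
      proof (rule tendsto_eventually)
        show "\<forall>\<^sub>F i in sequentially. indicator ((\<Union>i<i. A i) \<inter> C) z = (indicator ((\<Union>i. A i) \<inter> C) z :: real)"
        proof (cases "\<exists>i. z \<in> A i")
          case True
          then obtain j where "z \<in> A j" by blast
          then show ?thesis
            by (intro eventually_sequentiallyI[of "Suc j"]) (auto simp: indicator_def)
        qed (auto simp: indicator_def)
      qed
      show "\<bar>indicator ((\<Union>i<i. A i) \<inter> C) z\<bar> \<le> (indicator C z :: real)" for i z
        by (auto simp: indicator_def)
    qed measurable
  qed
  then show ?thesis by (simp add: C_def)
qed

lemma transport_continuous_indicator: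
  assumes A[measurable]: "A \<in> sets P" and fin: "emeasure P A < \<infinity>"
  shows "transport_continuous (indicator A)"
proof -
  define C where "C = (\<lambda>n::nat. box (- real n *\<^sub>R One) (real n *\<^sub>R One) \<times> space \<nu> :: ((real^'d) \<times> 'e) set)"
  have [measurable]: "C n \<in> sets P" for n unfolding C_def by measurable
  show ?thesis
  proof (rule transport_continuous_dominated_limit[of _ "\<lambda>n. indicator (A \<inter> C n)" "indicator A"])
    show "transport_continuous (indicator (A \<inter> C n))" for n
      unfolding C_def by (rule transport_continuous_indicator_Int_box[OF A])
    show "(\<integral>\<^sup>+z. ennreal (indicator A z) \<partial>P) < \<infinity>" using fin by (simp add: ennreal_indicator)
    fix z assume z: "z \<in> space P"
    obtain N :: nat where N: "\<And>n. n \<ge> N \<Longrightarrow> fst z \<in> box (- real n *\<^sub>R One) (real n *\<^sub>R One)"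
    proof -
      obtain N :: nat where "norm (fst z) < real N" using reals_Archimedean2 by blast
      then have "\<And>n b. n \<ge> N \<Longrightarrow> b \<in> Basis \<Longrightarrow> \<bar>fst z \<bullet> b\<bar> < real n"
        using Basis_le_norm[of _ "fst z"] by (meson le_less_trans less_le_trans of_nat_mono)
      then show thesis using that[of N] by (fastforce simp: mem_box abs_less_iff)
    qed
    then have "\<forall>\<^sub>F n in sequentially. indicator (A \<inter> C n) z = (indicator A z :: real)"
      using z by (intro eventually_sequentiallyI[of N])
        (auto simp: indicator_def C_def space_phase_measure mem_Times_iff)
    then show "(\<lambda>n. indicator (A \<inter> C n) z) \<longlonglongrightarrow> (indicator A z :: real)" by (rule tendsto_eventually)
  qed (auto simp: indicator_def)
qed

lemma integrable_imp_transport_continuous: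
  assumes "integrable P f"
  shows "transport_continuous f"
  using assms
proof induction
  case (base A c)
  then have "transport_continuous (\<lambda>z. c * indicator A z)"
    by (intro transport_continuous_cmult transport_continuous_indicator) auto
  then show ?case by (simp add: mult.commute)
next
  case (add f g)
  then show ?case by (intro transport_continuous_add) auto
next
  case (lim f s)
  show ?case
  proof (rule transport_continuous_dominated_limit[of _ s "\<lambda>z. 2 * \<bar>f z\<bar>"])
    have "integrable P (\<lambda>z. 2 * f z)" using lim by simp
    then show "(\<integral>\<^sup>+z. ennreal (2 * \<bar>f z\<bar>) \<partial>P) < \<infinity>"
      unfolding integrable_iff_bounded by (simp add: abs_mult)
  qed (use lim in auto)
qed

end

section \<open>The gain operator is Lipschitz in L1\<close>

lemma ennreal_norm_integral_le:
  fixes f :: "'a \<Rightarrow> 'b::{banach, second_countable_topology}"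
  shows "ennreal (norm (integral\<^sup>L M f)) \<le> (\<integral>\<^sup>+x. ennreal (norm (f x)) \<partial>M)"
  by (cases "integrable M f") (auto simp: integral_norm_bound_ennreal not_integrable_integral_eq)

text \<open>
  The abstract data behind the gain. The fluxes of probability densities have norm at most \<open>a\<close>, so
  the law has to be Lipschitz with constant \<open>c\<close> on that ball only. Unlike in the interaction law,
  the conditions on \<open>Q\<close> hold at every point of the space, and \<open>Q\<close> is jointly measurable.
\<close>

locale bgk_gain = free_transport \<nu> \<Phi> for \<nu> :: "'e::euclidean_space measure" and \<Phi> :: "'e \<Rightarrow> real^'d" +
  fixes K :: "real^'d \<Rightarrow> real" and Q :: "'e \<Rightarrow> 'e \<Rightarrow> real" and a c :: real
  assumes measurable_id[measurable]: "(\<lambda>m. m) \<in> borel_measurable \<nu>"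
    and norm_le_1: "m \<in> space \<nu> \<Longrightarrow> norm m \<le> 1"
    and measurable_kernel[measurable]: "K \<in> borel_measurable borel"
    and kernel_bound: "\<bar>K x\<bar> \<le> a"
    and measurable_law: "(\<lambda>(J, m). Q J m) \<in> borel_measurable (borel \<Otimes>\<^sub>M \<nu>)"
    and law_nonneg: "0 \<le> Q J m"
    and law_mass: "(\<integral>\<^sup>+m. ennreal (Q J m) \<partial>\<nu>) = 1"
    and law_Lipschitz: "norm J \<le> a \<Longrightarrow> norm J' \<le> a \<Longrightarrow> m \<in> space \<nu> \<Longrightarrow>
      \<bar>Q J m - Q J' m\<bar> \<le> c * norm (J - J')"
    and c_nonneg: "0 \<le> c"
begin

lemma a_nonneg: "0 \<le> a" using kernel_bound[of 0] by simp

lemma measurable_law_compose[measurable]: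
  assumes [measurable]: "J \<in> borel_measurable N" "h \<in> N \<rightarrow>\<^sub>M \<nu>"
  shows "(\<lambda>z. Q (J z) (h z)) \<in> borel_measurable N"
  using measurable_compose[OF _ measurable_law, of "\<lambda>z. (J z, h z)" N] by simp

lemma measurable_spatial_density_path:
  assumes g[measurable]: "(\<lambda>(t, z). g t z) \<in> borel_measurable (N \<Otimes>\<^sub>M P)"
  shows "(\<lambda>(t, x). spatial_density \<nu> (g t) x) \<in> borel_measurable (N \<Otimes>\<^sub>M borel)"
proof -
  have "(\<lambda>w. LINT m|\<nu>. (\<lambda>(t, z). g t z) (fst w, (snd w, m))) \<in> borel_measurable (N \<Otimes>\<^sub>M borel)"
    by measurable
  then show ?thesis by (simp add: spatial_density_def case_prod_beta)
qed

lemma measurable_flux_path: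
  assumes g[measurable]: "(\<lambda>(t, z). g t z) \<in> borel_measurable (N \<Otimes>\<^sub>M P)"
  shows "(\<lambda>(t, x). flux \<nu> K (g t) x) \<in> borel_measurable (N \<Otimes>\<^sub>M borel)"
proof -
  interpret ph: sigma_finite_measure P by (rule sigma_finite_phase)
  have [measurable]: "fst \<in> P \<rightarrow>\<^sub>M borel" "snd \<in> P \<rightarrow>\<^sub>M \<nu>" by measurable
  have "(\<lambda>w. LINT z|P. (K (snd w - fst z) * (\<lambda>(t, z). g t z) (fst w, z)) *\<^sub>R snd z)
      \<in> borel_measurable (N \<Otimes>\<^sub>M borel)"
    by measurable
  then show ?thesis by (simp add: flux_def case_prod_beta)
qed

lemma measurable_gain_path[measurable (raw)]:
  assumes g[measurable]: "(\<lambda>(t, z). g t z) \<in> borel_measurable (N \<Otimes>\<^sub>M P)"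
  shows "(\<lambda>(t, z). BGK_gain \<nu> K Q (g t) z) \<in> borel_measurable (N \<Otimes>\<^sub>M P)"
proof -
  note [measurable] = measurable_spatial_density_path[OF g] measurable_flux_path[OF g]
  have "(\<lambda>w. (\<lambda>(t, x). spatial_density \<nu> (g t) x) (fst w, fst (snd w)) *
        Q ((\<lambda>(t, x). flux \<nu> K (g t) x) (fst w, fst (snd w))) (snd (snd w)))
      \<in> borel_measurable (N \<Otimes>\<^sub>M P)"
    by measurable
  then show ?thesis by (simp add: BGK_gain_def case_prod_beta)
qed

lemma measurable_spatial_density:
  assumes [measurable]: "f \<in> borel_measurable P"
  shows "spatial_density \<nu> f \<in> borel_measurable borel"
  unfolding spatial_density_def by measurable

lemma measurable_flux:
  assumes [measurable]: "f \<in> borel_measurable P"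
  shows "flux \<nu> K f \<in> borel_measurable borel"
  \<comment> \<open>A single density is a path indexed by a one-point space.\<close>
  using measurable_compose[OF _ measurable_flux_path[of "\<lambda>_. f" "count_space {()}"], of "\<lambda>x. ((), x)" borel]
  by simp

lemma measurable_gain[measurable]:
  assumes [measurable]: "f \<in> borel_measurable P"
  shows "BGK_gain \<nu> K Q f \<in> borel_measurable P"
  using measurable_compose[OF _ measurable_gain_path[of "\<lambda>_. f" "count_space {()}"], of "\<lambda>x. ((), x)" P]
  by simp

lemma gain_nonneg: "(\<And>z. 0 \<le> f z) \<Longrightarrow> 0 \<le> BGK_gain \<nu> K Q f z"
  by (auto simp: BGK_gain_def spatial_density_def case_prod_beta law_nonneg intro!: mult_nonneg_nonneg integral_nonneg_AE)

lemma nn_integral_spatial_density_le: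
  assumes [measurable]: "f \<in> borel_measurable P"
  shows "(\<integral>\<^sup>+x. ennreal \<bar>spatial_density \<nu> f x\<bar> \<partial>lborel) \<le> L1_enorm P f"
proof -
  have "(\<integral>\<^sup>+x. ennreal \<bar>spatial_density \<nu> f x\<bar> \<partial>lborel)
      \<le> (\<integral>\<^sup>+x. \<integral>\<^sup>+m. ennreal \<bar>f (x, m)\<bar> \<partial>\<nu> \<partial>lborel)"
    unfolding spatial_density_def
    by (intro nn_integral_mono) (use ennreal_norm_integral_le[where 'b = real] in simp)
  also have "\<dots> = L1_enorm P f" unfolding L1_enorm_def by (rule nn_integral_phase(1)) measurable
  finally show ?thesis .
qed

lemma AE_integrable_section:
  fixes f :: "(real^'d) \<times> 'e \<Rightarrow> real"
  assumes "integrable P f"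
  shows "AE x in lborel. integrable \<nu> (\<lambda>m. f (x, m))"
  using phase.AE_integrable_fst'[of f] assms unfolding phase_measure_def by simp

lemma nn_integral_spatial_density_diff_le:
  assumes "integrable P f" "integrable P g"
  shows "(\<integral>\<^sup>+x. ennreal \<bar>spatial_density \<nu> f x - spatial_density \<nu> g x\<bar> \<partial>lborel)
    \<le> L1_enorm P (\<lambda>z. f z - g z)"
proof -
  have "(\<integral>\<^sup>+x. ennreal \<bar>spatial_density \<nu> f x - spatial_density \<nu> g x\<bar> \<partial>lborel)
      = (\<integral>\<^sup>+x. ennreal \<bar>spatial_density \<nu> (\<lambda>z. f z - g z) x\<bar> \<partial>lborel)"
    using AE_integrable_section[OF assms(1)] AE_integrable_section[OF assms(2)]
    by (intro nn_integral_cong_AE, eventually_elim) (simp add: spatial_density_def)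
  also have "\<dots> \<le> L1_enorm P (\<lambda>z. f z - g z)"
    using assms by (intro nn_integral_spatial_density_le) auto
  finally show ?thesis .
qed

lemma nn_integral_spatial_density_nonneg:
  assumes f: "integrable P f" and nn: "\<And>z. 0 \<le> f z"
  shows "(\<integral>\<^sup>+x. ennreal \<bar>spatial_density \<nu> f x\<bar> \<partial>lborel) = L1_enorm P f"
proof -
  have "(\<integral>\<^sup>+x. ennreal \<bar>spatial_density \<nu> f x\<bar> \<partial>lborel)
      = (\<integral>\<^sup>+x. \<integral>\<^sup>+m. ennreal \<bar>f (x, m)\<bar> \<partial>\<nu> \<partial>lborel)"
    using AE_integrable_section[OF f]
  proof (intro nn_integral_cong_AE, eventually_elim)
    fix x assume "integrable \<nu> (\<lambda>m. f (x, m))"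
    then show "ennreal \<bar>spatial_density \<nu> f x\<bar> = (\<integral>\<^sup>+m. ennreal \<bar>f (x, m)\<bar> \<partial>\<nu>)"
      using nn by (subst nn_integral_eq_integral) (auto simp: spatial_density_def integral_nonneg_AE)
  qed
  also have "\<dots> = L1_enorm P f"
    unfolding L1_enorm_def using borel_measurable_integrable[OF f] by (intro nn_integral_phase(1)) simp
  finally show ?thesis .
qed

text \<open>
  Integrating in \<open>m\<close> first removes the law, which has mass one for every flux.
\<close>

lemma nn_integral_density_times_law:
  assumes [measurable]: "\<rho> \<in> borel_measurable borel" "J \<in> borel_measurable borel"
  shows "(\<integral>\<^sup>+z. ennreal (\<bar>\<rho> (fst z)\<bar> * Q (J (fst z)) (snd z)) \<partial>P) = (\<integral>\<^sup>+x. ennreal \<bar>\<rho> x\<bar> \<partial>lborel)"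
proof -
  have "(\<integral>\<^sup>+z. ennreal (\<bar>\<rho> (fst z)\<bar> * Q (J (fst z)) (snd z)) \<partial>P)
      = (\<integral>\<^sup>+x. \<integral>\<^sup>+m. ennreal (\<bar>\<rho> x\<bar> * Q (J x) m) \<partial>\<nu> \<partial>lborel)"
    by (subst nn_integral_phase(1)[symmetric]) simp_all
  also have "\<dots> = (\<integral>\<^sup>+x. ennreal \<bar>\<rho> x\<bar> \<partial>lborel)"
    by (intro nn_integral_cong) (simp add: ennreal_mult law_nonneg nn_integral_cmult law_mass)
  finally show ?thesis .
qed

lemma L1_enorm_gain:
  assumes [measurable]: "f \<in> borel_measurable P"
  shows "L1_enorm P (BGK_gain \<nu> K Q f) = (\<integral>\<^sup>+x. ennreal \<bar>spatial_density \<nu> f x\<bar> \<partial>lborel)"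
  unfolding L1_enorm_def
  by (subst nn_integral_density_times_law[OF measurable_spatial_density measurable_flux, symmetric])
    (auto intro!: nn_integral_cong simp: BGK_gain_def abs_mult law_nonneg)

lemma L1_enorm_gain_le:
  "f \<in> borel_measurable P \<Longrightarrow> L1_enorm P (BGK_gain \<nu> K Q f) \<le> L1_enorm P f"
  using nn_integral_spatial_density_le by (simp add: L1_enorm_gain)

lemma L1_enorm_gain_nonneg:
  "integrable P f \<Longrightarrow> (\<And>z. 0 \<le> f z) \<Longrightarrow> L1_enorm P (BGK_gain \<nu> K Q f) = L1_enorm P f"
  using nn_integral_spatial_density_nonneg by (simp add: L1_enorm_gain)

lemma norm_flux_le:
  assumes [measurable]: "f \<in> borel_measurable P"
  shows "ennreal (norm (flux \<nu> K f x)) \<le> ennreal a * L1_enorm P f"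
proof -
  have "ennreal (norm (flux \<nu> K f x))
      \<le> (\<integral>\<^sup>+z. ennreal (norm (case z of (y, m) \<Rightarrow> (K (x - y) * f (y, m)) *\<^sub>R m)) \<partial>P)"
    unfolding flux_def by (rule ennreal_norm_integral_le)
  also have "\<dots> \<le> (\<integral>\<^sup>+z. ennreal a * ennreal \<bar>f z\<bar> \<partial>P)"
  proof (rule nn_integral_mono)
    fix z assume "z \<in> space P"
    then obtain y m where z: "z = (y, m)" "m \<in> space \<nu>" by (auto simp: space_phase_measure)
    have "\<bar>K (x - y)\<bar> * \<bar>f z\<bar> * norm m \<le> a * \<bar>f z\<bar> * 1"
      using kernel_bound norm_le_1 z a_nonneg by (intro mult_mono) auto
    then show "ennreal (norm (case z of (y, m) \<Rightarrow> (K (x - y) * f (y, m)) *\<^sub>R m)) \<le> ennreal a * ennreal \<bar>f z\<bar>"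
      using z(1) a_nonneg by (simp add: ennreal_mult[symmetric] abs_mult ennreal_leI)
  qed
  also have "\<dots> = ennreal a * L1_enorm P f"
    unfolding L1_enorm_def by (intro nn_integral_cmult) measurable
  finally show ?thesis .
qed

lemma norm_flux_le_a:
  assumes "f \<in> borel_measurable P" "L1_enorm P f = 1"
  shows "norm (flux \<nu> K f x) \<le> a"
  using norm_flux_le[OF assms(1), of x] assms(2) a_nonneg by (simp add: ennreal_le_iff)

lemma flux_diff:
  assumes "integrable P f" "integrable P g"
  shows "flux \<nu> K f x - flux \<nu> K g x = flux \<nu> K (\<lambda>z. f z - g z) x"
proof -
  have int: "integrable P (\<lambda>z. (K (x - fst z) * h z) *\<^sub>R snd z)" if h: "integrable P h" for h
  proof (rule Bochner_Integration.integrable_bound)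
    show "integrable P (\<lambda>z. a * h z)" using h by simp
    have [measurable]: "h \<in> borel_measurable P" "fst \<in> P \<rightarrow>\<^sub>M borel" "snd \<in> P \<rightarrow>\<^sub>M \<nu>"
      using h by (auto, measurable)
    show "(\<lambda>z. (K (x - fst z) * h z) *\<^sub>R snd z) \<in> borel_measurable P" by measurable
    show "AE z in P. norm ((K (x - fst z) * h z) *\<^sub>R snd z) \<le> norm (a * h z)"
    proof (rule AE_I2)
      fix z assume "z \<in> space P"
      then have "\<bar>K (x - fst z)\<bar> * \<bar>h z\<bar> * norm (snd z) \<le> a * \<bar>h z\<bar> * 1"
        using kernel_bound norm_le_1 a_nonneg
        by (intro mult_mono) (auto simp: space_phase_measure)
      then show "norm ((K (x - fst z) * h z) *\<^sub>R snd z) \<le> norm (a * h z)"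
        using a_nonneg by (simp add: abs_mult)
    qed
  qed
  show ?thesis
    unfolding flux_def case_prod_beta
    using Bochner_Integration.integral_diff[OF int[OF assms(1)] int[OF assms(2)]]
    by (simp add: algebra_simps)
qed

text \<open>
  The difference of the gains is \<open>(\<rho>\<^sub>f - \<rho>\<^sub>g) Q\<^sub>J\<^sub>f + \<rho>\<^sub>g (Q\<^sub>J\<^sub>f - Q\<^sub>J\<^sub>g)\<close>. The first term contributes the
  distance of the densities, because \<open>Q\<^sub>J\<^sub>f\<close> has mass one. In the second the fluxes differ by at most
  \<open>a\<close> times that distance uniformly in \<open>x\<close>, and \<open>\<rho>\<^sub>g\<close> has mass one.
\<close>

lemma gain_Lipschitz:
  assumes [measurable]: "f \<in> borel_measurable P" "g \<in> borel_measurable P"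
    and f1: "L1_enorm P f = 1" and g1: "L1_enorm P g = 1"
  shows "L1_enorm P (\<lambda>z. BGK_gain \<nu> K Q f z - BGK_gain \<nu> K Q g z)
    \<le> ennreal (1 + a * c) * L1_enorm P (\<lambda>z. f z - g z)"
proof -
  have int: "integrable P f" "integrable P g"
    using f1 g1 by (auto simp: integrable_iff_L1_enorm)
  note [measurable] = measurable_spatial_density[of f] measurable_spatial_density[of g]
    measurable_flux[of f] measurable_flux[of g]
  define N where "N = L1_enorm P (\<lambda>z. f z - g z)"
  let ?\<rho>f = "spatial_density \<nu> f" and ?\<rho>g = "spatial_density \<nu> g"
  let ?Jf = "flux \<nu> K f" and ?Jg = "flux \<nu> K g"
  have "L1_enorm P (\<lambda>z. BGK_gain \<nu> K Q f z - BGK_gain \<nu> K Q g z)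
    \<le> (\<integral>\<^sup>+z. ennreal (\<bar>?\<rho>f (fst z) - ?\<rho>g (fst z)\<bar> * Q (?Jf (fst z)) (snd z))
           + ennreal (a * c) * N * ennreal \<bar>?\<rho>g (fst z)\<bar> \<partial>P)"
    unfolding L1_enorm_def
  proof (rule nn_integral_mono)
    fix z assume "z \<in> space P"
    then obtain x m where z: "z = (x, m)" "m \<in> space \<nu>" by (auto simp: space_phase_measure)
    have "\<bar>?\<rho>f x * Q (?Jf x) m - ?\<rho>g x * Q (?Jg x) m\<bar>
        = \<bar>(?\<rho>f x - ?\<rho>g x) * Q (?Jf x) m + ?\<rho>g x * (Q (?Jf x) m - Q (?Jg x) m)\<bar>"
      by (simp add: algebra_simps)
    also have "\<dots> \<le> \<bar>?\<rho>f x - ?\<rho>g x\<bar> * Q (?Jf x) m + \<bar>?\<rho>g x\<bar> * \<bar>Q (?Jf x) m - Q (?Jg x) m\<bar>"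
      by (rule order_trans[OF abs_triangle_ineq]) (simp add: abs_mult law_nonneg)
    finally have le: "ennreal \<bar>?\<rho>f x * Q (?Jf x) m - ?\<rho>g x * Q (?Jg x) m\<bar>
        \<le> ennreal (\<bar>?\<rho>f x - ?\<rho>g x\<bar> * Q (?Jf x) m) + ennreal \<bar>Q (?Jf x) m - Q (?Jg x) m\<bar> * ennreal \<bar>?\<rho>g x\<bar>"
      by (simp add: ennreal_plus[symmetric] ennreal_mult[symmetric] law_nonneg mult.commute ennreal_leI del: ennreal_plus)
    have "ennreal \<bar>Q (?Jf x) m - Q (?Jg x) m\<bar> \<le> ennreal (c * norm (?Jf x - ?Jg x))"
      using z f1 g1 by (intro ennreal_leI law_Lipschitz norm_flux_le_a) auto
    also have "\<dots> = ennreal c * ennreal (norm (flux \<nu> K (\<lambda>z. f z - g z) x))"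
      using c_nonneg by (simp add: ennreal_mult flux_diff[OF int])
    also have "\<dots> \<le> ennreal c * (ennreal a * N)"
      unfolding N_def by (intro mult_left_mono norm_flux_le) auto
    also have "\<dots> = ennreal (a * c) * N"
      using a_nonneg c_nonneg by (simp add: ennreal_mult mult_ac)
    finally have "ennreal \<bar>Q (?Jf x) m - Q (?Jg x) m\<bar> * ennreal \<bar>?\<rho>g x\<bar> \<le> ennreal (a * c) * N * ennreal \<bar>?\<rho>g x\<bar>"
      by (rule mult_right_mono) simp
    from order_trans[OF le add_left_mono[OF this]]
    show "ennreal \<bar>BGK_gain \<nu> K Q f z - BGK_gain \<nu> K Q g z\<bar>
      \<le> ennreal (\<bar>?\<rho>f (fst z) - ?\<rho>g (fst z)\<bar> * Q (?Jf (fst z)) (snd z))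
           + ennreal (a * c) * N * ennreal \<bar>?\<rho>g (fst z)\<bar>"
      by (simp add: z BGK_gain_def)
  qed
  also have "\<dots> = (\<integral>\<^sup>+z. ennreal (\<bar>?\<rho>f (fst z) - ?\<rho>g (fst z)\<bar> * Q (?Jf (fst z)) (snd z)) \<partial>P)
      + ennreal (a * c) * N * (\<integral>\<^sup>+z. ennreal \<bar>?\<rho>g (fst z)\<bar> \<partial>P)"
    by (subst nn_integral_add) (auto simp: nn_integral_cmult)
  also have "\<dots> \<le> N + ennreal (a * c) * N * 1"
  proof (intro add_mono mult_left_mono)
    have "(\<integral>\<^sup>+z. ennreal (\<bar>?\<rho>f (fst z) - ?\<rho>g (fst z)\<bar> * Q (?Jf (fst z)) (snd z)) \<partial>P)
        = (\<integral>\<^sup>+x. ennreal \<bar>?\<rho>f x - ?\<rho>g x\<bar> \<partial>lborel)"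
      by (rule nn_integral_density_times_law) measurable
    also have "\<dots> \<le> N" unfolding N_def by (rule nn_integral_spatial_density_diff_le[OF int])
    finally show "(\<integral>\<^sup>+z. ennreal (\<bar>?\<rho>f (fst z) - ?\<rho>g (fst z)\<bar> * Q (?Jf (fst z)) (snd z)) \<partial>P) \<le> N" .
    have "(\<integral>\<^sup>+z. ennreal \<bar>?\<rho>g (fst z)\<bar> \<partial>P) = (\<integral>\<^sup>+x. ennreal \<bar>?\<rho>g x\<bar> \<partial>lborel)"
      by (subst nn_integral_phase(1)[symmetric]) (auto simp: emeasure_space_1)
    also have "\<dots> \<le> 1" using nn_integral_spatial_density_le[of g] g1 by simp
    finally show "(\<integral>\<^sup>+z. ennreal \<bar>?\<rho>g (fst z)\<bar> \<partial>P) \<le> 1" .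
  qed simp
  also have "\<dots> = ennreal (1 + a * c) * N"
    using a_nonneg c_nonneg by (simp add: algebra_simps)
  finally show ?thesis unfolding N_def .
qed

end

section \<open>Duhamel's formula\<close>

lemma nn_integral_exp_Icc:
  assumes "k > 0" "t \<ge> 0"
  shows "(\<integral>\<^sup>+s\<in>{0..t}. ennreal (exp (k * s)) \<partial>lborel) = ennreal ((exp (k * t) - 1) / k)"
proof -
  have "(\<integral>\<^sup>+s. ennreal (exp (k * s)) * indicator {0..t} s \<partial>lborel) = ennreal (exp (k * t) / k - exp (k * 0) / k)"
    by (rule nn_integral_FTC_Icc)
      (use assms in \<open>auto intro!: derivative_eq_intros simp flip: has_real_derivative_iff_has_vector_derivative\<close>)
  then show ?thesis by (simp add: diff_divide_distrib)
qed

context free_transport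
begin

text \<open>
  The gain accumulated over the times in \<open>A\<close>, seen in coordinates that move with the particles and
  with the exponential decay divided out. In these coordinates solutions are Lipschitz in time, and
  the domain of integration is the only place where the final time enters.
\<close>

definition source_integral :: "(real \<Rightarrow> (real^'d) \<times> 'e \<Rightarrow> real) \<Rightarrow> real set \<Rightarrow> (real^'d) \<times> 'e \<Rightarrow> real" where
  "source_integral H A z = (LINT s:A|lborel. exp s * H s (transport (- s) z))"

definition comoving_density where
  "comoving_density f0 H t z = f0 z + source_integral H {0..t} z"

text \<open>
  The right-hand side of the solution formula for a given gain \<open>H\<close>; see \<open>duhamel_eq\<close>.
\<close>

definition duhamel where
  "duhamel f0 H t z = exp (- t) * comoving_density f0 H t (transport t z)"

lemma duhamel_eq:
  "duhamel f0 H t (x, m) = exp (- t) * f0 (x - t *\<^sub>R \<Phi> m, m) +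
     (LINT s:{0..t}|lborel. exp (- (t - s)) * H s (x - (t - s) *\<^sub>R \<Phi> m, m))"
proof -
  have "exp (- t) * (exp s * H s (transport (- s) (transport t (x, m))))
      = exp (- (t - s)) * H s (x - (t - s) *\<^sub>R \<Phi> m, m)" for s
    unfolding transport_add by (simp add: transport_def exp_diff exp_minus field_simps)
  then have "exp (- t) * source_integral H {0..t} (transport t (x, m))
      = (LINT s:{0..t}|lborel. exp (- (t - s)) * H s (x - (t - s) *\<^sub>R \<Phi> m, m))"
    unfolding source_integral_def set_lebesgue_integral_def integral_mult_right_zero[symmetric]
    by (intro Bochner_Integration.integral_cong) (auto simp: indicator_def)
  then show ?thesis
    by (simp add: duhamel_def comoving_density_def distrib_left transport_def)
qed

lemma measurable_source:
  assumes [measurable]: "(\<lambda>(s, z). H s z) \<in> borel_measurable (borel \<Otimes>\<^sub>M P)"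
  shows "(\<lambda>(s, z). H s (transport (- s) z)) \<in> borel_measurable (borel \<Otimes>\<^sub>M P)"
proof -
  have "(\<lambda>w. (fst w, (\<lambda>(t, z). transport t z) (- fst w, snd w))) \<in> borel \<Otimes>\<^sub>M P \<rightarrow>\<^sub>M borel \<Otimes>\<^sub>M P"
    by measurable
  from measurable_compose[OF this assms] show ?thesis by (simp add: case_prod_beta)
qed

lemma measurable_source_integral_path:
  assumes [measurable]: "(\<lambda>(s, z). H s z) \<in> borel_measurable (borel \<Otimes>\<^sub>M P)"
  shows "(\<lambda>(t, z). source_integral H {0..t} z) \<in> borel_measurable (borel \<Otimes>\<^sub>M P)"
proof -
  define S where "S = (\<lambda>(s, z). H s (transport (- s) z))"
  have [measurable]: "S \<in> borel_measurable (borel \<Otimes>\<^sub>M P)"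
    unfolding S_def by (rule measurable_source) fact
  have "(\<lambda>w. LINT s|lborel. (if 0 \<le> s \<and> s \<le> fst w then 1 else 0) *\<^sub>R
        (exp s * S (s, snd w))) \<in> borel_measurable (borel \<Otimes>\<^sub>M P)"
    by measurable
  moreover have "(if 0 \<le> s \<and> s \<le> t then 1 else 0) = (indicator {0..t} s :: real)" for s t :: real
    by (auto simp: indicator_def)
  ultimately show ?thesis
    by (simp add: S_def source_integral_def set_lebesgue_integral_def case_prod_beta)
qed

lemma measurable_source_integral[measurable]:
  assumes [measurable]: "(\<lambda>(s, z). H s z) \<in> borel_measurable (borel \<Otimes>\<^sub>M P)" "A \<in> sets borel"
  shows "source_integral H A \<in> borel_measurable P"
proof -
  define S where "S = (\<lambda>(s, z). H s (transport (- s) z))"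
  have [measurable]: "S \<in> borel_measurable (borel \<Otimes>\<^sub>M P)"
    unfolding S_def by (rule measurable_source) fact
  have "(\<lambda>z. LINT s|lborel. indicator A s *\<^sub>R (exp s * S (s, z))) \<in> borel_measurable P"
    by measurable
  then show ?thesis by (simp add: S_def source_integral_def[abs_def] set_lebesgue_integral_def)
qed

lemma measurable_duhamel_path:
  assumes [measurable]: "(\<lambda>(s, z). H s z) \<in> borel_measurable (borel \<Otimes>\<^sub>M P)" "f0 \<in> borel_measurable P"
  shows "(\<lambda>(t, z). duhamel f0 H t z) \<in> borel_measurable (borel \<Otimes>\<^sub>M P)"
proof -
  define S where "S = (\<lambda>(t, z). source_integral H {0..t} z)"
  have [measurable]: "S \<in> borel_measurable (borel \<Otimes>\<^sub>M P)"
    unfolding S_def by (rule measurable_source_integral_path) fact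
  have "(\<lambda>w. exp (- fst w) * (f0 ((\<lambda>(t, z). transport t z) w)
      + S (fst w, (\<lambda>(t, z). transport t z) w)))
      \<in> borel_measurable (borel \<Otimes>\<^sub>M P)" by measurable
  then show ?thesis by (simp add: S_def duhamel_def comoving_density_def case_prod_beta)
qed

lemma measurable_comoving_density[measurable]:
  assumes [measurable]: "(\<lambda>(s, z). H s z) \<in> borel_measurable (borel \<Otimes>\<^sub>M P)" "f0 \<in> borel_measurable P"
  shows "comoving_density f0 H t \<in> borel_measurable P"
  unfolding comoving_density_def[abs_def] by measurable

lemma measurable_duhamel[measurable]:
  assumes [measurable]: "(\<lambda>(s, z). H s z) \<in> borel_measurable (borel \<Otimes>\<^sub>M P)" "f0 \<in> borel_measurable P"
  shows "duhamel f0 H t \<in> borel_measurable P"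
  unfolding duhamel_def[abs_def] by measurable

text \<open>
  Tonelli's theorem and the isometry property of transport at each time.
\<close>

lemma nn_integral_source:
  assumes H[measurable]: "(\<lambda>(s, z). H s z) \<in> borel_measurable (borel \<Otimes>\<^sub>M P)" and [measurable]: "A \<in> sets borel"
  shows "(\<integral>\<^sup>+z. \<integral>\<^sup>+s. ennreal \<bar>indicator A s *\<^sub>R (exp s * H s (transport (- s) z))\<bar> \<partial>lborel \<partial>P)
    = (\<integral>\<^sup>+s\<in>A. ennreal (exp s) * L1_enorm P (H s) \<partial>lborel)"
proof -
  define S where "S = (\<lambda>(s, z). H s (transport (- s) z))"
  have [measurable]: "S \<in> borel_measurable (borel \<Otimes>\<^sub>M P)"
    unfolding S_def by (rule measurable_source) fact
  interpret P: sigma_finite_measure P by (rule sigma_finite_phase)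
  interpret tP: pair_sigma_finite lborel P ..
  have Hs[measurable]: "H s \<in> borel_measurable P" for s
    using measurable_compose[OF _ H, of "\<lambda>z. (s, z)" P] by simp
  have "(\<integral>\<^sup>+z. \<integral>\<^sup>+s. ennreal \<bar>indicator A s *\<^sub>R (exp s * H s (transport (- s) z))\<bar> \<partial>lborel \<partial>P)
      = (\<integral>\<^sup>+s. \<integral>\<^sup>+z. ennreal \<bar>indicator A s *\<^sub>R (exp s * H s (transport (- s) z))\<bar> \<partial>P \<partial>lborel)"
  proof (rule tP.Fubini')
    have "(\<lambda>w. ennreal \<bar>indicator A (fst w) *\<^sub>R (exp (fst w) * S w)\<bar>)
       \<in> borel_measurable (lborel \<Otimes>\<^sub>M P)" by measurable
    then show "(\<lambda>(s, z). ennreal \<bar>indicator A s *\<^sub>R (exp s * H s (transport (- s) z))\<bar>)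
       \<in> borel_measurable (lborel \<Otimes>\<^sub>M P)" by (simp add: S_def case_prod_beta)
  qed
  also have "\<dots> = (\<integral>\<^sup>+s\<in>A. ennreal (exp s) * L1_enorm P (H s) \<partial>lborel)"
  proof (rule nn_integral_cong)
    fix s :: real
    have "(\<integral>\<^sup>+z. ennreal \<bar>indicator A s *\<^sub>R (exp s * H s (transport (- s) z))\<bar> \<partial>P)
        = (\<integral>\<^sup>+z. indicator A s * (ennreal (exp s) * ennreal \<bar>H s (transport (- s) z)\<bar>) \<partial>P)"
      by (intro nn_integral_cong) (auto simp: indicator_def abs_mult ennreal_mult)
    also have "\<dots> = indicator A s * (ennreal (exp s) * L1_enorm P (\<lambda>z. H s (transport (- s) z)))"
      by (simp add: nn_integral_cmult L1_enorm_def)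
    finally show "(\<integral>\<^sup>+z. ennreal \<bar>indicator A s *\<^sub>R (exp s * H s (transport (- s) z))\<bar> \<partial>P)
        = ennreal (exp s) * L1_enorm P (H s) * indicator A s"
      by (simp add: L1_enorm_transport mult_ac)
  qed
  finally show ?thesis .
qed

lemma L1_enorm_source_integral_le:
  assumes "(\<lambda>(s, z). H s z) \<in> borel_measurable (borel \<Otimes>\<^sub>M P)" "A \<in> sets borel"
  shows "L1_enorm P (source_integral H A) \<le> (\<integral>\<^sup>+s\<in>A. ennreal (exp s) * L1_enorm P (H s) \<partial>lborel)"
  unfolding nn_integral_source[OF assms, symmetric] unfolding L1_enorm_def source_integral_def set_lebesgue_integral_def
  by (intro nn_integral_mono) (use ennreal_norm_integral_le[where 'b = real] in simp)

text \<open>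
  The time integral in the solution formula is a Bochner integral, which is zero by convention when
  the integrand is not integrable. Tonelli's theorem confines this to a null set.
\<close>

lemma AE_source_integrable:
  assumes H[measurable]: "(\<lambda>(s, z). H s z) \<in> borel_measurable (borel \<Otimes>\<^sub>M P)" and A[measurable]: "A \<in> sets borel"
    and fin: "(\<integral>\<^sup>+s\<in>A. ennreal (exp s) * L1_enorm P (H s) \<partial>lborel) < \<infinity>"
  shows "AE z in P. set_integrable lborel A (\<lambda>s. exp s * H s (transport (- s) z))"
proof -
  have meas: "(\<lambda>(z, s). indicator A s *\<^sub>R (exp s * H s (transport (- s) z))) \<in> borel_measurable (P \<Otimes>\<^sub>M lborel)"
  proof -
    define S where "S = (\<lambda>(s, z). H s (transport (- s) z))"
    have [measurable]: "S \<in> borel_measurable (borel \<Otimes>\<^sub>M P)"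
      unfolding S_def by (rule measurable_source) fact
    have "(\<lambda>w. indicator A (snd w) *\<^sub>R (exp (snd w) * S (snd w, fst w)))
      \<in> borel_measurable (P \<Otimes>\<^sub>M lborel)" by measurable
    then show ?thesis by (simp add: S_def case_prod_beta)
  qed
  have "AE z in P. (\<integral>\<^sup>+s. ennreal \<bar>indicator A s *\<^sub>R (exp s * H s (transport (- s) z))\<bar> \<partial>lborel) \<noteq> \<infinity>"
  proof (rule nn_integral_PInf_AE)
    show "(\<lambda>z. \<integral>\<^sup>+s. ennreal \<bar>indicator A s *\<^sub>R (exp s * H s (transport (- s) z))\<bar> \<partial>lborel) \<in> borel_measurable P"
      using meas by measurable
    show "(\<integral>\<^sup>+z. \<integral>\<^sup>+s. ennreal \<bar>indicator A s *\<^sub>R (exp s * H s (transport (- s) z))\<bar> \<partial>lborel \<partial>P) \<noteq> \<infinity>"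
      unfolding nn_integral_source[OF H A] using fin by simp
  qed
  with AE_space show ?thesis
  proof eventually_elim
    fix z assume z[measurable]: "z \<in> space P"
      and fin: "(\<integral>\<^sup>+s. ennreal \<bar>indicator A s *\<^sub>R (exp s * H s (transport (- s) z))\<bar> \<partial>lborel) \<noteq> \<infinity>"
    show "set_integrable lborel A (\<lambda>s. exp s * H s (transport (- s) z))"
      unfolding set_integrable_def
    proof (rule integrableI_bounded)
      show "(\<lambda>s. indicator A s *\<^sub>R (exp s * H s (transport (- s) z))) \<in> borel_measurable lborel"
        using measurable_compose[OF measurable_Pair1'[OF z] meas] by simp
    qed (use fin in \<open>simp add: less_top\<close>)
  qed
qed

lemma L1_enorm_source_integral_nonneg:
  assumes H[measurable]: "(\<lambda>(s, z). H s z) \<in> borel_measurable (borel \<Otimes>\<^sub>M P)" and A[measurable]: "A \<in> sets borel"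
    and fin: "(\<integral>\<^sup>+s\<in>A. ennreal (exp s) * L1_enorm P (H s) \<partial>lborel) < \<infinity>" and nn: "\<And>s z. 0 \<le> H s z"
  shows "L1_enorm P (source_integral H A) = (\<integral>\<^sup>+s\<in>A. ennreal (exp s) * L1_enorm P (H s) \<partial>lborel)"
  unfolding nn_integral_source[OF H A, symmetric] unfolding L1_enorm_def
  using AE_source_integrable[OF H A fin]
proof (intro nn_integral_cong_AE, eventually_elim)
  fix z assume "set_integrable lborel A (\<lambda>s. exp s * H s (transport (- s) z))"
  then show "ennreal \<bar>source_integral H A z\<bar>
      = (\<integral>\<^sup>+s. ennreal \<bar>indicator A s *\<^sub>R (exp s * H s (transport (- s) z))\<bar> \<partial>lborel)"
    unfolding set_integrable_def source_integral_def set_lebesgue_integral_def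
    by (subst nn_integral_eq_integral) (auto simp: nn intro!: integral_nonneg_AE)
qed

lemma nn_integral_source_le:
  assumes "\<And>s. s \<in> A \<Longrightarrow> L1_enorm P (H s) \<le> 1" "\<And>s. s \<in> A \<Longrightarrow> s \<le> T" "A \<in> sets borel"
  shows "(\<integral>\<^sup>+s\<in>A. ennreal (exp s) * L1_enorm P (H s) \<partial>lborel) \<le> ennreal (exp T) * emeasure lborel A"
proof -
  have "(\<integral>\<^sup>+s\<in>A. ennreal (exp s) * L1_enorm P (H s) \<partial>lborel) \<le> (\<integral>\<^sup>+s. ennreal (exp T) * indicator A s \<partial>lborel)"
  proof (rule nn_integral_mono)
    fix s
    show "ennreal (exp s) * L1_enorm P (H s) * indicator A s \<le> ennreal (exp T) * indicator A s"
    proof (cases "s \<in> A")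
      case True
      then have "ennreal (exp s) * L1_enorm P (H s) \<le> ennreal (exp T) * 1"
        using assms by (intro mult_mono) (auto intro: ennreal_leI)
      with True show ?thesis by simp
    qed simp
  qed
  also have "\<dots> = ennreal (exp T) * emeasure lborel A" using assms(3) by (simp add: nn_integral_cmult_indicator)
  finally show ?thesis .
qed

lemma AE_source_integrable_bounded:
  assumes H: "(\<lambda>(s, z). H s z) \<in> borel_measurable (borel \<Otimes>\<^sub>M P)"
    and bd: "\<And>s. s \<in> {0..T} \<Longrightarrow> L1_enorm P (H s) \<le> 1" and A: "A \<in> sets borel" "A \<subseteq> {0..T}"
  shows "AE z in P. set_integrable lborel A (\<lambda>s. exp s * H s (transport (- s) z))"
proof (rule AE_source_integrable[OF H A(1)])
  have "(\<integral>\<^sup>+s\<in>A. ennreal (exp s) * L1_enorm P (H s) \<partial>lborel) \<le> ennreal (exp T) * emeasure lborel A"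
    using bd A by (intro nn_integral_source_le) auto
  also have "\<dots> \<le> ennreal (exp T) * emeasure lborel {0..T}"
    using A by (intro mult_left_mono emeasure_mono) auto
  also have "\<dots> < \<infinity>" by (cases "0 \<le> T") (auto simp: ennreal_mult_less_top)
  finally show "(\<integral>\<^sup>+s\<in>A. ennreal (exp s) * L1_enorm P (H s) \<partial>lborel) < \<infinity>" .
qed

text \<open>
  Linearity of the source integral holds only where both integrands are integrable, hence almost
  everywhere.
\<close>

lemma L1_enorm_source_integral_diff_le:
  assumes H1[measurable]: "(\<lambda>(s, z). H1 s z) \<in> borel_measurable (borel \<Otimes>\<^sub>M P)"
    and H2[measurable]: "(\<lambda>(s, z). H2 s z) \<in> borel_measurable (borel \<Otimes>\<^sub>M P)"
    and bd: "\<And>s. s \<in> {0..t} \<Longrightarrow> L1_enorm P (H1 s) \<le> 1" "\<And>s. s \<in> {0..t} \<Longrightarrow> L1_enorm P (H2 s) \<le> 1"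
  shows "L1_enorm P (\<lambda>z. source_integral H1 {0..t} z - source_integral H2 {0..t} z)
    \<le> (\<integral>\<^sup>+s\<in>{0..t}. ennreal (exp s) * L1_enorm P (\<lambda>z. H1 s z - H2 s z) \<partial>lborel)"
proof -
  have i1: "AE z in P. set_integrable lborel {0..t} (\<lambda>s. exp s * H1 s (transport (- s) z))"
    by (rule AE_source_integrable_bounded[OF H1 bd(1)]) auto
  have i2: "AE z in P. set_integrable lborel {0..t} (\<lambda>s. exp s * H2 s (transport (- s) z))"
    by (rule AE_source_integrable_bounded[OF H2 bd(2)]) auto
  from i1 i2 have "AE z in P. source_integral H1 {0..t} z - source_integral H2 {0..t} z
      = source_integral (\<lambda>s z. H1 s z - H2 s z) {0..t} z"
  proof eventually_elim
    fix z assume "set_integrable lborel {0..t} (\<lambda>s. exp s * H1 s (transport (- s) z))"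
      "set_integrable lborel {0..t} (\<lambda>s. exp s * H2 s (transport (- s) z))"
    from set_integral_diff(2)[OF this]
    show "source_integral H1 {0..t} z - source_integral H2 {0..t} z
      = source_integral (\<lambda>s z. H1 s z - H2 s z) {0..t} z"
      unfolding source_integral_def by (simp add: right_diff_distrib)
  qed
  then have "L1_enorm P (\<lambda>z. source_integral H1 {0..t} z - source_integral H2 {0..t} z)
      = L1_enorm P (source_integral (\<lambda>s z. H1 s z - H2 s z) {0..t})"
    by (rule L1_enorm_cong_AE)
  also have "\<dots> \<le> (\<integral>\<^sup>+s\<in>{0..t}. ennreal (exp s) * L1_enorm P (\<lambda>z. H1 s z - H2 s z) \<partial>lborel)"
  proof (rule L1_enorm_source_integral_le)
    have "(\<lambda>w. (\<lambda>(s, z). H1 s z) w - (\<lambda>(s, z). H2 s z) w) \<in> borel_measurable (borel \<Otimes>\<^sub>M P)"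
      by measurable
    then show "(\<lambda>(s, z). H1 s z - H2 s z) \<in> borel_measurable (borel \<Otimes>\<^sub>M P)" by (simp add: case_prod_beta)
  qed simp
  finally show ?thesis .
qed

text \<open>
  The exponential weights inside and outside the time integral combine to \<open>exp (- (t - s)) \<le> 1\<close>.
\<close>

lemma duhamel_stability:
  assumes H1[measurable]: "(\<lambda>(s, z). H1 s z) \<in> borel_measurable (borel \<Otimes>\<^sub>M P)"
    and H2[measurable]: "(\<lambda>(s, z). H2 s z) \<in> borel_measurable (borel \<Otimes>\<^sub>M P)"
    and bd: "\<And>s. s \<in> {0..t} \<Longrightarrow> L1_enorm P (H1 s) \<le> 1" "\<And>s. s \<in> {0..t} \<Longrightarrow> L1_enorm P (H2 s) \<le> 1"
    and [measurable]: "f1 \<in> borel_measurable P" "f2 \<in> borel_measurable P" and t: "0 \<le> t"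
  shows "L1_enorm P (\<lambda>z. duhamel f1 H1 t z - duhamel f2 H2 t z)
    \<le> L1_enorm P (\<lambda>z. f1 z - f2 z) + (\<integral>\<^sup>+s\<in>{0..t}. L1_enorm P (\<lambda>z. H1 s z - H2 s z) \<partial>lborel)"
proof -
  let ?C = "\<lambda>z. comoving_density f1 H1 t z - comoving_density f2 H2 t z"
  let ?N = "\<lambda>s. L1_enorm P (\<lambda>z. H1 s z - H2 s z)"
  have [measurable]: "source_integral H1 {0..t} \<in> borel_measurable P" "source_integral H2 {0..t} \<in> borel_measurable P"
    by (intro measurable_source_integral H1 H2; simp)+
  have [measurable]: "?C \<in> borel_measurable P"
    by (intro borel_measurable_diff measurable_comoving_density H1 H2) measurable
  define D I I' F where "D = L1_enorm P (\<lambda>z. duhamel f1 H1 t z - duhamel f2 H2 t z)"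
    and "I = (\<integral>\<^sup>+s\<in>{0..t}. ?N s \<partial>lborel)"
    and "I' = (\<integral>\<^sup>+s\<in>{0..t}. ennreal (exp s) * ?N s \<partial>lborel)"
    and "F = L1_enorm P (\<lambda>z. f1 z - f2 z)"
  have "D = L1_enorm P (\<lambda>z. exp (- t) * ?C (transport t z))"
    by (simp add: D_def duhamel_def right_diff_distrib)
  also have "\<dots> = ennreal (exp (- t)) * L1_enorm P (\<lambda>z. ?C (transport t z))"
    by (subst L1_enorm_cmult) simp_all
  finally have D: "D = ennreal (exp (- t)) * L1_enorm P ?C"
    using L1_enorm_transport[of ?C t] by simp
  have "L1_enorm P ?C = L1_enorm P (\<lambda>z. (f1 z - f2 z) + (source_integral H1 {0..t} z - source_integral H2 {0..t} z))"
    by (simp add: comoving_density_def algebra_simps)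
  also have "\<dots> \<le> F + L1_enorm P (\<lambda>z. source_integral H1 {0..t} z - source_integral H2 {0..t} z)"
    unfolding F_def by (intro L1_enorm_add_le) measurable
  also have "\<dots> \<le> F + I'"
    unfolding I'_def by (intro add_left_mono L1_enorm_source_integral_diff_le H1 H2 bd)
  finally have C: "L1_enorm P ?C \<le> F + I'" .
  have "I' \<le> (\<integral>\<^sup>+s. ennreal (exp t) * (?N s * indicator {0..t} s) \<partial>lborel)"
    unfolding I'_def by (intro nn_integral_mono) (auto simp: indicator_def intro!: mult_right_mono ennreal_leI)
  also have "\<dots> = ennreal (exp t) * I"
    unfolding I_def
  proof (rule nn_integral_cmult)
    interpret P: sigma_finite_measure P by (rule sigma_finite_phase)
    have "(\<lambda>w. ennreal \<bar>(\<lambda>(s, z). H1 s z) w - (\<lambda>(s, z). H2 s z) w\<bar>) \<in> borel_measurable (lborel \<Otimes>\<^sub>M P)"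
      by measurable
    from P.borel_measurable_nn_integral_fst[OF this]
    have [measurable]: "?N \<in> borel_measurable lborel" by (simp add: L1_enorm_def)
    show "(\<lambda>s. ?N s * indicator {0..t} s) \<in> borel_measurable lborel" by measurable
  qed
  finally have I: "I' \<le> ennreal (exp t) * I" .
  have "D \<le> ennreal (exp (- t)) * (F + ennreal (exp t) * I)"
    unfolding D by (intro mult_left_mono order_trans[OF C] add_left_mono I) simp
  also have "\<dots> = ennreal (exp (- t)) * F + I"
    by (simp add: distrib_left mult.assoc[symmetric] ennreal_mult[symmetric] flip: exp_add)
  also have "\<dots> \<le> 1 * F + I"
    using t by (intro add_right_mono mult_right_mono) (auto simp flip: ennreal_1 intro!: ennreal_leI)
  finally show ?thesis by (simp add: D_def F_def I_def)
qed

lemma duhamel_nonneg: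
  assumes "\<And>z. 0 \<le> f0 z" "\<And>s z. 0 \<le> H s z"
  shows "0 \<le> duhamel f0 H t z"
  unfolding duhamel_def comoving_density_def source_integral_def set_lebesgue_integral_def
  using assms by (auto intro!: integral_nonneg_AE add_nonneg_nonneg)

text \<open>
  The mass at time \<open>t\<close> is \<open>exp (- t) * (1 + \<integral>\<^sub>0\<^sup>t exp s ds) = 1\<close>; positivity makes norms add up.
\<close>

lemma duhamel_mass:
  assumes H[measurable]: "(\<lambda>(s, z). H s z) \<in> borel_measurable (borel \<Otimes>\<^sub>M P)"
    and f0[measurable]: "f0 \<in> borel_measurable P"
    and nn: "\<And>z. 0 \<le> f0 z" "\<And>s z. 0 \<le> H s z"
    and mass: "L1_enorm P f0 = 1" "\<And>s. s \<in> {0..t} \<Longrightarrow> L1_enorm P (H s) = 1" and t: "0 \<le> t"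
  shows "L1_enorm P (duhamel f0 H t) = 1"
proof -
  have S: "source_integral H {0..t} \<in> borel_measurable P" "0 \<le> source_integral H {0..t} z" for z
    by (rule measurable_source_integral[OF H], simp)
      (auto simp: source_integral_def set_lebesgue_integral_def nn intro!: integral_nonneg_AE)
  have src: "(\<integral>\<^sup>+s\<in>{0..t}. ennreal (exp s) * L1_enorm P (H s) \<partial>lborel) = ennreal (exp t - 1)"
  proof -
    have "(\<integral>\<^sup>+s\<in>{0..t}. ennreal (exp s) * L1_enorm P (H s) \<partial>lborel) = (\<integral>\<^sup>+s\<in>{0..t}. ennreal (exp (1 * s)) \<partial>lborel)"
      by (intro nn_integral_cong) (auto simp: indicator_def mass)
    then show ?thesis using nn_integral_exp_Icc[of 1 t] t by simp
  qed
  have C: "L1_enorm P (comoving_density f0 H t) = ennreal (exp t)"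
  proof -
    have "L1_enorm P (comoving_density f0 H t) = L1_enorm P f0 + L1_enorm P (source_integral H {0..t})"
      unfolding comoving_density_def[abs_def] using S nn by (intro L1_enorm_add_nonneg f0) auto
    also have "L1_enorm P (source_integral H {0..t}) = ennreal (exp t - 1)"
      using L1_enorm_source_integral_nonneg[OF H _ _ nn(2), of "{0..t}"] src by simp
    finally show ?thesis
      using t by (simp add: mass ennreal_plus[symmetric] flip: ennreal_1 del: ennreal_plus)
  qed
  have "L1_enorm P (duhamel f0 H t) = ennreal (exp (- t)) * L1_enorm P (comoving_density f0 H t)"
    unfolding duhamel_def[abs_def]
    by (subst L1_enorm_cmult) (auto simp: L1_enorm_transport intro!: measurable_comoving_density H)
  then show ?thesis
    unfolding C by (simp add: ennreal_mult[symmetric] flip: exp_add)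
qed

text \<open>
  The increment between two times is the source accumulated in between.
\<close>

lemma comoving_density_Lipschitz:
  assumes H[measurable]: "(\<lambda>(s, z). H s z) \<in> borel_measurable (borel \<Otimes>\<^sub>M P)"
    and bd: "\<And>s. s \<in> {0..T} \<Longrightarrow> L1_enorm P (H s) \<le> 1" and r: "0 \<le> r'" "r' \<le> r" "r \<le> T"
  shows "L1_enorm P (\<lambda>z. comoving_density f0 H r z - comoving_density f0 H r' z) \<le> ennreal (exp T * (r - r'))"
proof -
  have i1: "AE z in P. set_integrable lborel {0..r'} (\<lambda>s. exp s * H s (transport (- s) z))"
    by (rule AE_source_integrable_bounded[OF H bd]) (use r in auto)
  have i2: "AE z in P. set_integrable lborel {r'<..r} (\<lambda>s. exp s * H s (transport (- s) z))"
    by (rule AE_source_integrable_bounded[OF H bd]) (use r in auto)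
  from i1 i2 have "AE z in P. comoving_density f0 H r z - comoving_density f0 H r' z = source_integral H {r'<..r} z"
  proof eventually_elim
    fix z assume "set_integrable lborel {0..r'} (\<lambda>s. exp s * H s (transport (- s) z))"
      "set_integrable lborel {r'<..r} (\<lambda>s. exp s * H s (transport (- s) z))"
    moreover have "{0..r'} \<inter> {r'<..r} = {}" by auto
    ultimately have "source_integral H ({0..r'} \<union> {r'<..r}) z
        = source_integral H {0..r'} z + source_integral H {r'<..r} z"
      unfolding source_integral_def by (intro set_integral_Un)
    moreover have "{0..r'} \<union> {r'<..r} = {0..r}" using r by auto
    ultimately show "comoving_density f0 H r z - comoving_density f0 H r' z = source_integral H {r'<..r} z"
      by (simp add: comoving_density_def)
  qed
  then have "L1_enorm P (\<lambda>z. comoving_density f0 H r z - comoving_density f0 H r' z) = L1_enorm P (source_integral H {r'<..r})"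
    by (rule L1_enorm_cong_AE)
  also have "\<dots> \<le> (\<integral>\<^sup>+s\<in>{r'<..r}. ennreal (exp s) * L1_enorm P (H s) \<partial>lborel)"
    by (rule L1_enorm_source_integral_le[OF H]) simp
  also have "\<dots> \<le> ennreal (exp T) * emeasure lborel {r'<..r}"
    using r by (intro nn_integral_source_le bd) auto
  also have "\<dots> = ennreal (exp T * (r - r'))" using r by (simp add: ennreal_mult)
  finally show ?thesis .
qed

text \<open>
  In the moving coordinates the path is Lipschitz in time. Returning to fixed coordinates costs the
  continuity of transport at the single function \<open>C t\<close>, which does not depend on the sequence of
  times.
\<close>

lemma duhamel_continuous:
  assumes H[measurable]: "(\<lambda>(s, z). H s z) \<in> borel_measurable (borel \<Otimes>\<^sub>M P)"
    and bd: "\<And>s. s \<in> {0..T} \<Longrightarrow> L1_enorm P (H s) \<le> 1" and f0: "integrable P f0"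
    and t: "t \<in> {0..T}" and X: "\<And>n::nat. X n \<in> {0..T}" "X \<longlonglongrightarrow> t"
  shows "(\<lambda>n. L1_enorm P (\<lambda>z. duhamel f0 H (X n) z - duhamel f0 H t z)) \<longlonglongrightarrow> 0"
proof -
  have [measurable]: "f0 \<in> borel_measurable P" using f0 by auto
  define C where "C = (\<lambda>r. comoving_density f0 H r)"
  have [measurable]: "C r \<in> borel_measurable P" for r
    unfolding C_def by (rule measurable_comoving_density[OF H]) simp
  have Lip: "L1_enorm P (\<lambda>z. C r z - C r' z) \<le> ennreal (exp T * \<bar>r - r'\<bar>)" if "r \<in> {0..T}" "r' \<in> {0..T}" for r r'
  proof (cases "r' \<le> r")
    case True
    then show ?thesis using comoving_density_Lipschitz[OF H bd, where r = r and r' = r' and ?f0.0 = f0] that by (simp add: C_def)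
  next
    case False
    then show ?thesis using comoving_density_Lipschitz[OF H bd, where r = r' and r' = r and ?f0.0 = f0] that
      by (subst L1_enorm_minus_commute) (simp add: C_def)
  qed
  have C_fin: "L1_enorm P (C t) < \<infinity>"
  proof -
    have "L1_enorm P (C t) \<le> L1_enorm P f0 + L1_enorm P (source_integral H {0..t})"
      unfolding C_def comoving_density_def[abs_def]
      by (intro L1_enorm_add_le measurable_source_integral H) auto
    also have "\<dots> \<le> L1_enorm P f0 + (\<integral>\<^sup>+s\<in>{0..t}. ennreal (exp s) * L1_enorm P (H s) \<partial>lborel)"
      by (intro add_left_mono L1_enorm_source_integral_le H) simp
    also have "\<dots> \<le> L1_enorm P f0 + ennreal (exp T) * emeasure lborel {0..t}"
      using t by (intro add_left_mono nn_integral_source_le bd) auto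
    also have "\<dots> < \<infinity>"
      using f0 t by (auto simp: integrable_iff_L1_enorm ennreal_mult_less_top)
    finally show ?thesis .
  qed
  then have "transport_continuous (C t)"
    by (intro integrable_imp_transport_continuous) (simp add: integrable_iff_L1_enorm)
  moreover have "(\<lambda>n. X n - t) \<longlonglongrightarrow> 0" using X(2) by (simp add: LIM_zero)
  ultimately have tr: "(\<lambda>n. L1_enorm P (\<lambda>z. C t (transport (X n - t) z) - C t z)) \<longlonglongrightarrow> 0"
    unfolding transport_continuous_def by blast
  \<comment> \<open>The three terms control the change of the moving coordinates' density, of the decay factor and of
     the transport.\<close>
  define U where "U = (\<lambda>n. ennreal (exp T * \<bar>X n - t\<bar>) + ennreal \<bar>exp (- X n) - exp (- t)\<bar> * L1_enorm P (C t)
      + L1_enorm P (\<lambda>z. C t (transport (X n - t) z) - C t z))"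
  have "U \<longlonglongrightarrow> ennreal (exp T * \<bar>t - t\<bar>) + ennreal \<bar>exp (- t) - exp (- t)\<bar> * L1_enorm P (C t) + 0"
    unfolding U_def
    by (intro tendsto_add tr tendsto_mult_ennreal tendsto_ennrealI tendsto_intros X(2)) (use C_fin in auto)
  then have "U \<longlonglongrightarrow> 0" by simp
  then show ?thesis
  proof (rule tendsto_0_le_ennreal)
    fix n
    let ?x = "X n"
    have x0: "0 \<le> ?x" using X(1)[of n] by simp
    have "L1_enorm P (\<lambda>z. duhamel f0 H ?x z - duhamel f0 H t z)
       \<le> L1_enorm P (\<lambda>z. duhamel f0 H ?x z - exp (- t) * C t (transport ?x z))
        + L1_enorm P (\<lambda>z. exp (- t) * C t (transport ?x z) - duhamel f0 H t z)"
      unfolding duhamel_def C_def[symmetric] by (intro L1_enorm_triangle) measurable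
    also have "\<dots> \<le> (ennreal (exp T * \<bar>?x - t\<bar>) + ennreal \<bar>exp (- ?x) - exp (- t)\<bar> * L1_enorm P (C t))
        + L1_enorm P (\<lambda>z. C t (transport (?x - t) z) - C t z)"
    proof (rule add_mono)
      have "L1_enorm P (\<lambda>z. duhamel f0 H ?x z - exp (- t) * C t (transport ?x z))
          = L1_enorm P (\<lambda>z. exp (- ?x) * C ?x z - exp (- t) * C t z)"
        using L1_enorm_transport[of "\<lambda>z. exp (- ?x) * C ?x z - exp (- t) * C t z" ?x]
        unfolding duhamel_def C_def[symmetric] by simp
      also have "\<dots> = L1_enorm P (\<lambda>z. exp (- ?x) * (C ?x z - C t z) + (exp (- ?x) - exp (- t)) * C t z)"
        by (simp add: algebra_simps)
      also have "\<dots> \<le> L1_enorm P (\<lambda>z. exp (- ?x) * (C ?x z - C t z)) + L1_enorm P (\<lambda>z. (exp (- ?x) - exp (- t)) * C t z)"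
        by (intro L1_enorm_add_le) measurable
      also have "\<dots> = ennreal (exp (- ?x)) * L1_enorm P (\<lambda>z. C ?x z - C t z) + ennreal \<bar>exp (- ?x) - exp (- t)\<bar> * L1_enorm P (C t)"
        by (subst (1 2) L1_enorm_cmult) simp_all
      also have "\<dots> \<le> 1 * ennreal (exp T * \<bar>?x - t\<bar>) + ennreal \<bar>exp (- ?x) - exp (- t)\<bar> * L1_enorm P (C t)"
        using x0 X(1)[of n] t
        by (intro add_right_mono mult_mono Lip) (auto simp flip: ennreal_1 intro!: ennreal_leI)
      finally show "L1_enorm P (\<lambda>z. duhamel f0 H ?x z - exp (- t) * C t (transport ?x z))
          \<le> ennreal (exp T * \<bar>?x - t\<bar>) + ennreal \<bar>exp (- ?x) - exp (- t)\<bar> * L1_enorm P (C t)" by simp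
      have "L1_enorm P (\<lambda>z. exp (- t) * C t (transport ?x z) - duhamel f0 H t z)
          = L1_enorm P (\<lambda>z. exp (- t) * (\<lambda>z. C t (transport (?x - t) z) - C t z) (transport t z))"
        by (simp add: duhamel_def C_def transport_add right_diff_distrib)
      also have "\<dots> = ennreal (exp (- t)) * L1_enorm P (\<lambda>z. (\<lambda>z. C t (transport (?x - t) z) - C t z) (transport t z))"
        by (subst L1_enorm_cmult) simp_all
      also have "\<dots> = ennreal (exp (- t)) * L1_enorm P (\<lambda>z. C t (transport (?x - t) z) - C t z)"
        by (subst L1_enorm_transport) simp_all
      also have "\<dots> \<le> 1 * L1_enorm P (\<lambda>z. C t (transport (?x - t) z) - C t z)"
        using t by (intro mult_right_mono) (auto simp flip: ennreal_1 intro!: ennreal_leI)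
      finally show "L1_enorm P (\<lambda>z. exp (- t) * C t (transport ?x z) - duhamel f0 H t z)
          \<le> L1_enorm P (\<lambda>z. C t (transport (?x - t) z) - C t z)" by simp
    qed
    finally show "L1_enorm P (\<lambda>z. duhamel f0 H ?x z - duhamel f0 H t z) \<le> U n" by (simp add: U_def)
  qed
qed

end

lemma (in free_transport) AE_phase_snd:
  assumes "AE m in \<nu>. R m"
  shows "AE z in P. R (snd z)"
proof -
  obtain N where N: "{m \<in> space \<nu>. \<not> R m} \<subseteq> N" "N \<in> null_sets \<nu>"
    using assms unfolding eventually_ae_filter by auto
  have "emeasure P (UNIV \<times> N) = 0"
    unfolding phase_measure_def using N(2) by (subst emeasure_pair_measure_Times) auto
  moreover have "UNIV \<times> N \<in> sets P"
    unfolding sets_phase_measure using N(2) by (intro pair_measureI) auto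
  ultimately have "UNIV \<times> N \<in> null_sets P" by auto
  then show ?thesis by (rule AE_I') (use N(1) in \<open>auto simp: space_phase_measure\<close>)
qed

text \<open>
  Transport leaves \<open>m\<close> unchanged, so that for almost every \<open>(x, m)\<close> the whole time integral sees the
  law at one good value of \<open>m\<close> only.
\<close>

lemma (in free_transport) BGK_solution_cong_law:
  assumes ae: "AE m in \<nu>. \<forall>J. Q J m = Q' J m"
  shows "BGK_solution \<nu> \<Phi> K Q T f0 f \<longleftrightarrow> BGK_solution \<nu> \<Phi> K Q' T f0 f"
proof -
  have "AE z in P. ((f t z = exp (- t) * f0 (fst z - t *\<^sub>R \<Phi> (snd z), snd z) +
      (LINT s:{0..t}|lborel. exp (- (t - s)) * BGK_gain \<nu> K Q (g s) (fst z - (t - s) *\<^sub>R \<Phi> (snd z), snd z)))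
    \<longleftrightarrow> (f t z = exp (- t) * f0 (fst z - t *\<^sub>R \<Phi> (snd z), snd z) +
      (LINT s:{0..t}|lborel. exp (- (t - s)) * BGK_gain \<nu> K Q' (g s) (fst z - (t - s) *\<^sub>R \<Phi> (snd z), snd z))))" for t g
    using AE_phase_snd[OF ae] by eventually_elim (simp add: BGK_gain_def)
  from eventually_subst[OF this]
  have "(AE (x, m) in P. f t (x, m) = exp (- t) * f0 (x - t *\<^sub>R \<Phi> m, m) +
      (LINT s:{0..t}|lborel. exp (- (t - s)) * BGK_gain \<nu> K Q (g s) (x - (t - s) *\<^sub>R \<Phi> m, m)))
    \<longleftrightarrow> (AE (x, m) in P. f t (x, m) = exp (- t) * f0 (x - t *\<^sub>R \<Phi> m, m) +
      (LINT s:{0..t}|lborel. exp (- (t - s)) * BGK_gain \<nu> K Q' (g s) (x - (t - s) *\<^sub>R \<Phi> m, m)))" for t g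
    by (simp add: case_prod_beta)
  then show ?thesis unfolding BGK_solution_def by simp
qed

section \<open>Stability by an exponentially weighted Gronwall argument\<close>

text \<open>
  A bound of order \<open>exp (L s)\<close> reproduces itself exactly under the integral, and one of order
  \<open>exp (2 L s)\<close> is halved. The first half of this drives the Gronwall estimate and the second the
  geometric convergence of the Picard iteration.
\<close>

lemma exp_comparison_step:
  fixes u :: "real \<Rightarrow> ennreal"
  assumes L: "L > 0" and t: "0 \<le> t" and A: "0 \<le> A" and R: "0 \<le> R"
    and u: "\<And>s. s \<in> {0..t} \<Longrightarrow> u s \<le> ennreal (A * exp (L * s) + R * exp (2 * L * s))"
  shows "ennreal A + (\<integral>\<^sup>+s\<in>{0..t}. ennreal L * u s \<partial>lborel)
    \<le> ennreal (A * exp (L * t) + R / 2 * exp (2 * L * t))"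
proof -
  have "(\<integral>\<^sup>+s\<in>{0..t}. ennreal L * u s \<partial>lborel)
      \<le> (\<integral>\<^sup>+s. ennreal (L * A) * (ennreal (exp (L * s)) * indicator {0..t} s)
            + ennreal (L * R) * (ennreal (exp (2 * L * s)) * indicator {0..t} s) \<partial>lborel)"
  proof (rule nn_integral_mono)
    fix s
    show "ennreal L * u s * indicator {0..t} s
        \<le> ennreal (L * A) * (ennreal (exp (L * s)) * indicator {0..t} s)
            + ennreal (L * R) * (ennreal (exp (2 * L * s)) * indicator {0..t} s)"
    proof (cases "s \<in> {0..t}")
      case True
      have "ennreal L * u s \<le> ennreal L * ennreal (A * exp (L * s) + R * exp (2 * L * s))"
        by (intro mult_left_mono u True) simp
      also have "\<dots> = ennreal (L * A * exp (L * s) + L * R * exp (2 * L * s))"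
        using L A R by (simp add: ennreal_mult[symmetric] algebra_simps)
      also have "\<dots> = ennreal (L * A) * ennreal (exp (L * s)) + ennreal (L * R) * ennreal (exp (2 * L * s))"
        using L A R by (simp add: ennreal_mult[symmetric])
      finally show ?thesis using True by simp
    qed simp
  qed
  also have "\<dots> = ennreal (L * A) * (\<integral>\<^sup>+s\<in>{0..t}. ennreal (exp (L * s)) \<partial>lborel)
      + ennreal (L * R) * (\<integral>\<^sup>+s\<in>{0..t}. ennreal (exp (2 * L * s)) \<partial>lborel)"
    by (subst nn_integral_add) (simp_all add: nn_integral_cmult)
  also have "\<dots> = ennreal (L * A) * ennreal ((exp (L * t) - 1) / L)
      + ennreal (L * R) * ennreal ((exp (2 * L * t) - 1) / (2 * L))"
    using L t by (simp add: nn_integral_exp_Icc)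
  also have "\<dots> = ennreal (A * (exp (L * t) - 1) + R / 2 * (exp (2 * L * t) - 1))"
    using L t A R by (simp add: ennreal_mult[symmetric] ennreal_plus[symmetric] del: ennreal_plus)
  finally have "ennreal A + (\<integral>\<^sup>+s\<in>{0..t}. ennreal L * u s \<partial>lborel)
      \<le> ennreal A + ennreal (A * (exp (L * t) - 1) + R / 2 * (exp (2 * L * t) - 1))"
    by (rule add_left_mono)
  also have "\<dots> = ennreal (A * exp (L * t) + R / 2 * (exp (2 * L * t) - 1))"
  proof (subst ennreal_plus[symmetric])
    have "0 \<le> A * (exp (L * t) - 1)" "0 \<le> R / 2 * (exp (2 * L * t) - 1)"
      using L t A R by (intro mult_nonneg_nonneg; simp)+
    then show "0 \<le> A * (exp (L * t) - 1) + R / 2 * (exp (2 * L * t) - 1)" by simp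
  qed (simp_all add: A algebra_simps)
  also have "\<dots> \<le> ennreal (A * exp (L * t) + R / 2 * exp (2 * L * t))"
    using R by (intro ennreal_leI) (simp add: algebra_simps)
  finally show ?thesis .
qed

lemma tendsto_div_power2_0: "(\<lambda>n::nat. C / 2 ^ n) \<longlonglongrightarrow> (0 :: real)"
  using tendsto_mult_right_zero[OF LIMSEQ_power_zero[of "1/2 :: real"], of C]
  by (simp add: power_divide)

text \<open>
  An a priori bound \<open>B\<close> is improved \<open>n\<close> times by \<open>exp_comparison_step\<close>, which leaves the fraction
  \<open>B / 2 ^ n\<close> of it in front of \<open>exp (2 L t)\<close>.
\<close>

lemma gronwall_ennreal:
  fixes u :: "real \<Rightarrow> ennreal"
  assumes L: "L > 0" and A: "0 \<le> A" and B: "0 \<le> B" "\<And>s. s \<in> {0..T} \<Longrightarrow> u s \<le> ennreal B"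
    and u: "\<And>t. t \<in> {0..T} \<Longrightarrow> u t \<le> ennreal A + (\<integral>\<^sup>+s\<in>{0..t}. ennreal L * u s \<partial>lborel)"
    and t: "t \<in> {0..T}"
  shows "u t \<le> ennreal (A * exp (L * t))"
proof -
  \<comment> \<open>For \<open>n = 0\<close> this is the a priori bound, because \<open>exp (2 * L * t) \<ge> 1\<close>.\<close>
  have *: "u t \<le> ennreal (A * exp (L * t) + B / 2 ^ n * exp (2 * L * t))" if "t \<in> {0..T}" for n :: nat and t
    using that
  proof (induction n arbitrary: t)
    case 0
    have "B * 1 \<le> B * exp (2 * L * t)" using 0 L B(1) by (intro mult_left_mono) auto
    then have "B \<le> A * exp (L * t) + B / 2 ^ 0 * exp (2 * L * t)"
      using mult_nonneg_nonneg[OF A, of "exp (L * t)"] by simp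
    then show ?case using B(2)[OF 0] by (meson ennreal_leI order_trans)
  next
    case (Suc n)
    have "ennreal A + (\<integral>\<^sup>+s\<in>{0..t}. ennreal L * u s \<partial>lborel)
        \<le> ennreal (A * exp (L * t) + B / 2 ^ n / 2 * exp (2 * L * t))"
      by (rule exp_comparison_step) (use L A B(1) Suc in auto)
    with u[OF Suc.prems] show ?case by (simp add: field_simps)
  qed
  have "(\<lambda>n. A * exp (L * t) + B / 2 ^ n * exp (2 * L * t)) \<longlonglongrightarrow> A * exp (L * t) + 0 * exp (2 * L * t)"
    by (intro tendsto_intros tendsto_div_power2_0)
  then have "(\<lambda>n. ennreal (A * exp (L * t) + B / 2 ^ n * exp (2 * L * t))) \<longlonglongrightarrow> ennreal (A * exp (L * t))"
    by (intro tendsto_ennrealI) simp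
  then show ?thesis by (rule LIMSEQ_le_const) (use *[OF t] in auto)
qed

context bgk_gain
begin

abbreviation "gain \<equiv> BGK_gain \<nu> K Q"
abbreviation "Lip \<equiv> 1 + a * c"

lemma Lip_pos: "Lip > 0" using a_nonneg c_nonneg by (simp add: add_pos_nonneg)

lemma measurable_path_section:
  "(\<lambda>(t, z). g t z) \<in> borel_measurable (borel \<Otimes>\<^sub>M P) \<Longrightarrow> g t \<in> borel_measurable P"
  using measurable_compose[of "\<lambda>z. (t, z)" P "borel \<Otimes>\<^sub>M P" "\<lambda>(t, z). g t z"] by simp

lemma BGK_solutionD:
  assumes "BGK_solution \<nu> \<Phi> K Q T f0 f"
  obtains g where "(\<lambda>(t, z). g t z) \<in> borel_measurable (borel \<Otimes>\<^sub>M P)"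
    "\<And>t. t \<in> {0..T} \<Longrightarrow> AE z in P. g t z = f t z"
    "\<And>t. t \<in> {0..T} \<Longrightarrow> L1_enorm P (g t) = 1"
    "\<And>t. t \<in> {0..T} \<Longrightarrow> AE z in P. f t z = duhamel f0 (\<lambda>s. gain (g s)) t z"
proof -
  obtain g where g: "(\<lambda>(t, z). g t z) \<in> borel_measurable (borel \<Otimes>\<^sub>M P)"
    "\<forall>t\<in>{0..T}. AE z in P. g t z = f t z"
    "\<forall>t\<in>{0..T}. AE (x, m) in P. f t (x, m) = exp (- t) * f0 (x - t *\<^sub>R \<Phi> m, m) +
               (LINT s:{0..t}|lborel. exp (- (t - s)) * gain (g s) (x - (t - s) *\<^sub>R \<Phi> m, m))"
    using assms unfolding BGK_solution_def by blast
  have "L1_enorm P (g t) = 1" if "t \<in> {0..T}" for t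
    using assms that g(2) L1_enorm_cong_AE[of "g t" "f t" P]
    unfolding BGK_solution_def continuous_density_path_def prob_density_iff_L1_enorm by auto
  moreover have "AE z in P. f t z = duhamel f0 (\<lambda>s. gain (g s)) t z" if "t \<in> {0..T}" for t
    using bspec[OF g(3) that] by eventually_elim (auto simp: duhamel_eq)
  ultimately show thesis using that g by blast
qed

text \<open>
  The basic estimate for both uniqueness and existence: stability of the linear formula together
  with the Lipschitz bound of the gain.
\<close>

lemma duhamel_gain_stability:
  assumes g1: "(\<lambda>(t, z). g1 t z) \<in> borel_measurable (borel \<Otimes>\<^sub>M P)"
    and g2: "(\<lambda>(t, z). g2 t z) \<in> borel_measurable (borel \<Otimes>\<^sub>M P)"
    and mass: "\<And>s. s \<in> {0..t} \<Longrightarrow> L1_enorm P (g1 s) = 1" "\<And>s. s \<in> {0..t} \<Longrightarrow> L1_enorm P (g2 s) = 1"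
    and f: "f1 \<in> borel_measurable P" "f2 \<in> borel_measurable P" and t: "0 \<le> t"
  shows "L1_enorm P (\<lambda>z. duhamel f1 (\<lambda>s. gain (g1 s)) t z - duhamel f2 (\<lambda>s. gain (g2 s)) t z)
    \<le> L1_enorm P (\<lambda>z. f1 z - f2 z)
      + (\<integral>\<^sup>+s\<in>{0..t}. ennreal Lip * L1_enorm P (\<lambda>z. g1 s z - g2 s z) \<partial>lborel)"
proof -
  note meas = measurable_path_section[OF g1] measurable_path_section[OF g2]
  have "L1_enorm P (\<lambda>z. duhamel f1 (\<lambda>s. gain (g1 s)) t z - duhamel f2 (\<lambda>s. gain (g2 s)) t z)
    \<le> L1_enorm P (\<lambda>z. f1 z - f2 z)
      + (\<integral>\<^sup>+s\<in>{0..t}. L1_enorm P (\<lambda>z. gain (g1 s) z - gain (g2 s) z) \<partial>lborel)"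
    using L1_enorm_gain_le[OF meas(1)] L1_enorm_gain_le[OF meas(2)] mass
    by (intro duhamel_stability measurable_gain_path g1 g2 f t) (metis order_trans order_refl)+
  also have "\<dots> \<le> L1_enorm P (\<lambda>z. f1 z - f2 z)
      + (\<integral>\<^sup>+s\<in>{0..t}. ennreal Lip * L1_enorm P (\<lambda>z. g1 s z - g2 s z) \<partial>lborel)"
    using gain_Lipschitz[OF meas] mass
    by (intro add_left_mono nn_integral_mono) (auto simp: indicator_def)
  finally show ?thesis .
qed

text \<open>
  Both solutions satisfy Duhamel's formula for their own gain at almost every point, so that
  \<open>duhamel_gain_stability\<close> bounds their distance in terms of its past. The distance of two probability
  densities is at most 2, which is the a priori bound for the Gronwall estimate.
\<close>

lemma BGK_solution_stability:
  assumes f01: "prob_density P f01" and f02: "prob_density P f02"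
    and f1: "BGK_solution \<nu> \<Phi> K Q T f01 f1" and f2: "BGK_solution \<nu> \<Phi> K Q T f02 f2" and t: "t \<in> {0..T}"
  shows "L1_norm P (\<lambda>z. f1 t z - f2 t z) \<le> L1_norm P (\<lambda>z. f01 z - f02 z) * exp (Lip * t)"
proof -
  obtain g1 where g1: "(\<lambda>(t, z). g1 t z) \<in> borel_measurable (borel \<Otimes>\<^sub>M P)"
    "\<And>t. t \<in> {0..T} \<Longrightarrow> AE z in P. g1 t z = f1 t z"
    "\<And>t. t \<in> {0..T} \<Longrightarrow> L1_enorm P (g1 t) = 1"
    "\<And>t. t \<in> {0..T} \<Longrightarrow> AE z in P. f1 t z = duhamel f01 (\<lambda>s. gain (g1 s)) t z"
    using BGK_solutionD[OF f1] by blast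
  obtain g2 where g2: "(\<lambda>(t, z). g2 t z) \<in> borel_measurable (borel \<Otimes>\<^sub>M P)"
    "\<And>t. t \<in> {0..T} \<Longrightarrow> AE z in P. g2 t z = f2 t z"
    "\<And>t. t \<in> {0..T} \<Longrightarrow> L1_enorm P (g2 t) = 1"
    "\<And>t. t \<in> {0..T} \<Longrightarrow> AE z in P. f2 t z = duhamel f02 (\<lambda>s. gain (g2 s)) t z"
    using BGK_solutionD[OF f2] by blast
  have meas0: "f01 \<in> borel_measurable P" "f02 \<in> borel_measurable P"
    and mass0: "L1_enorm P f01 = 1" "L1_enorm P f02 = 1"
    using f01 f02 by (auto simp: prob_density_iff_L1_enorm)
  have meas: "f1 s \<in> borel_measurable P" "f2 s \<in> borel_measurable P" if "s \<in> {0..T}" for s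
    using f1 f2 that unfolding BGK_solution_def continuous_density_path_def prob_density_iff_L1_enorm by auto
  define u where "u = (\<lambda>s. L1_enorm P (\<lambda>z. g1 s z - g2 s z))"
  define A where "A = L1_norm P (\<lambda>z. f01 z - f02 z)"
  have "L1_enorm P (\<lambda>z. f01 z - f02 z) \<le> 1 + 1"
    using L1_enorm_diff_le[OF meas0] mass0 by simp
  then have A: "L1_enorm P (\<lambda>z. f01 z - f02 z) = ennreal A"
  proof -
    have "L1_enorm P (\<lambda>z. f01 z - f02 z) < top"
      using \<open>L1_enorm P (\<lambda>z. f01 z - f02 z) \<le> 1 + 1\<close> by (auto intro: le_less_trans)
    then show ?thesis
      unfolding A_def using meas0 by (subst L1_norm_eq_L1_enorm) auto
  qed
  have A0: "0 \<le> A" by (simp add: A_def L1_norm_def)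
  have "u t \<le> ennreal (A * exp (Lip * t))"
  proof (rule gronwall_ennreal[OF Lip_pos A0, where B = 2 and T = T])
    fix s assume s: "s \<in> {0..T}"
    have "u s \<le> 1 + 1"
      unfolding u_def
      using L1_enorm_diff_le[OF measurable_path_section[OF g1(1)] measurable_path_section[OF g2(1)], of s s] g1(3)[OF s] g2(3)[OF s]
      by simp
    then show "u s \<le> ennreal 2" by simp
    have "u s = L1_enorm P (\<lambda>z. duhamel f01 (\<lambda>s. gain (g1 s)) s z - duhamel f02 (\<lambda>s. gain (g2 s)) s z)"
      unfolding u_def using g1(2)[OF s] g2(2)[OF s] g1(4)[OF s] g2(4)[OF s]
      by (intro L1_enorm_cong_AE, eventually_elim) simp
    also have "\<dots> \<le> L1_enorm P (\<lambda>z. f01 z - f02 z) + (\<integral>\<^sup>+r\<in>{0..s}. ennreal Lip * u r \<partial>lborel)"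
      unfolding u_def using s by (intro duhamel_gain_stability g1 g2 meas0) auto
    finally show "u s \<le> ennreal A + (\<integral>\<^sup>+r\<in>{0..s}. ennreal Lip * u r \<partial>lborel)" unfolding A .
  qed (use t in auto)
  moreover have "u t = L1_enorm P (\<lambda>z. f1 t z - f2 t z)"
    unfolding u_def using g1(2)[OF t] g2(2)[OF t]
    by (intro L1_enorm_cong_AE, eventually_elim) simp
  ultimately have "enn2real (L1_enorm P (\<lambda>z. f1 t z - f2 t z)) \<le> A * exp (Lip * t)"
    using A0 by (auto intro!: enn2real_leI)
  then show ?thesis
    using meas[OF t] by (subst L1_norm_eq_L1_enorm) (auto simp: A_def)
qed

end

section \<open>Existence by Picard iteration\<close>

context bgk_gain
begin

primrec picard :: "((real^'d) \<times> 'e \<Rightarrow> real) \<Rightarrow> nat \<Rightarrow> real \<Rightarrow> (real^'d) \<times> 'e \<Rightarrow> real" where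
  "picard f0 0 = (\<lambda>t. f0)"
| "picard f0 (Suc n) = duhamel f0 (\<lambda>s. gain (picard f0 n s))"

text \<open>
  The pointwise limit, so that joint measurability in time and phase variables is inherited from
  the iterates. Where the iterates diverge \<open>lim\<close> is unspecified; at each time \<open>t \<ge> 0\<close> this is a null set.
\<close>

definition picard_limit where
  "picard_limit f0 t z = lim (\<lambda>n. picard f0 n t z)"

context
  fixes f0 :: "(real^'d) \<times> 'e \<Rightarrow> real"
  assumes f0_meas[measurable]: "f0 \<in> borel_measurable P"
    and f0_nonneg: "\<And>z. 0 \<le> f0 z" and f0_mass: "L1_enorm P f0 = 1"
begin

lemma measurable_picard_path:
  "(\<lambda>(t, z). picard f0 n t z) \<in> borel_measurable (borel \<Otimes>\<^sub>M P)"
proof (induction n)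
  case 0
  have "(\<lambda>w. f0 (snd w)) \<in> borel_measurable (borel \<Otimes>\<^sub>M P)" by measurable
  then show ?case by (simp add: case_prod_beta)
next
  case (Suc n)
  then show ?case
    using measurable_duhamel_path[OF measurable_gain_path[OF Suc] f0_meas] by simp
qed

lemma measurable_picard[measurable]: "picard f0 n t \<in> borel_measurable P"
  by (rule measurable_path_section[OF measurable_picard_path])

lemma picard_nonneg: "0 \<le> picard f0 n t z"
proof (induction n arbitrary: t z)
  case (Suc n)
  then show ?case by (auto intro!: duhamel_nonneg gain_nonneg f0_nonneg)
qed (simp add: f0_nonneg)

lemma picard_mass: "0 \<le> t \<Longrightarrow> L1_enorm P (picard f0 n t) = 1"
proof (induction n arbitrary: t)
  case (Suc n)
  have "L1_enorm P (gain (picard f0 n s)) = 1" if "s \<in> {0..t}" for s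
    using L1_enorm_gain_nonneg[of "picard f0 n s"] Suc.IH[of s] that picard_nonneg
    by (simp add: integrable_iff_L1_enorm)
  then show ?case
    using Suc.prems
    by (auto intro!: duhamel_mass measurable_gain_path measurable_picard_path f0_meas f0_nonneg
        gain_nonneg picard_nonneg f0_mass)
qed (simp add: f0_mass)

text \<open>
  The sum of the geometric tail that starts with the bound of \<open>picard_step\<close>.
\<close>

definition picard_error :: "nat \<Rightarrow> real \<Rightarrow> real" where
  "picard_error n t = 4 / 2 ^ n * exp (2 * Lip * t)"

lemma picard_error_tendsto_0: "(\<lambda>n. ennreal (picard_error n t)) \<longlonglongrightarrow> 0"
  using tendsto_ennrealI[OF tendsto_mult_left_zero[OF tendsto_div_power2_0], of 4 "exp (2 * Lip * t)"]
  by (simp add: picard_error_def)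

lemma picard_step:
  "0 \<le> t \<Longrightarrow> L1_enorm P (\<lambda>z. picard f0 (Suc n) t z - picard f0 n t z) \<le> ennreal (2 / 2 ^ n * exp (2 * Lip * t))"
proof (induction n arbitrary: t)
  case 0
  have "L1_enorm P (\<lambda>z. picard f0 (Suc 0) t z - picard f0 0 t z) \<le> 1 + 1"
    using L1_enorm_diff_le[OF measurable_picard measurable_picard, of "Suc 0" t 0 t]
      picard_mass[OF 0, of "Suc 0"] picard_mass[OF 0, of 0] by simp
  also have "\<dots> = ennreal 2" by simp
  also have "\<dots> \<le> ennreal (2 / 2 ^ 0 * exp (2 * Lip * t))"
    using 0 Lip_pos by (intro ennreal_leI) simp
  finally show ?case .
next
  case (Suc n)
  have "L1_enorm P (\<lambda>z. picard f0 (Suc (Suc n)) t z - picard f0 (Suc n) t z)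
     \<le> L1_enorm P (\<lambda>z. f0 z - f0 z)
       + (\<integral>\<^sup>+s\<in>{0..t}. ennreal Lip * L1_enorm P (\<lambda>z. picard f0 (Suc n) s z - picard f0 n s z) \<partial>lborel)"
    unfolding picard.simps(2)[of f0 "Suc n"] picard.simps(2)[of f0 n, THEN fun_cong, of t]
    by (intro duhamel_gain_stability measurable_picard_path picard_mass f0_meas) (use Suc.prems in auto)
  also have "\<dots> = ennreal 0 + (\<integral>\<^sup>+s\<in>{0..t}. ennreal Lip * L1_enorm P (\<lambda>z. picard f0 (Suc n) s z - picard f0 n s z) \<partial>lborel)"
    by (simp add: L1_enorm_def)
  also have "\<dots> \<le> ennreal (0 * exp (Lip * t) + (2 / 2 ^ n) / 2 * exp (2 * Lip * t))"
    by (rule exp_comparison_step) (use Suc Lip_pos in auto)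
  finally show ?case by (simp add: mult.commute)
qed

lemma picard_Cauchy:
  assumes t: "0 \<le> t"
  shows "L1_enorm P (\<lambda>z. picard f0 n t z - picard f0 (n + k) t z) \<le> ennreal (picard_error n t)"
proof -
  \<comment> \<open>The bounds of the steps telescope, since \<open>2 / 2 ^ n = 4 / 2 ^ n - 4 / 2 ^ Suc n\<close>.\<close>
  have "L1_enorm P (\<lambda>z. picard f0 n t z - picard f0 (n + k) t z)
     \<le> ennreal (picard_error n t - picard_error (n + k) t)"
  proof (induction k)
    case 0
    then show ?case by (simp add: L1_enorm_def)
  next
    case (Suc k)
    have "L1_enorm P (\<lambda>z. picard f0 n t z - picard f0 (n + Suc k) t z)
        \<le> L1_enorm P (\<lambda>z. picard f0 n t z - picard f0 (n + k) t z)
          + L1_enorm P (\<lambda>z. picard f0 (n + k) t z - picard f0 (n + Suc k) t z)"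
      by (intro L1_enorm_triangle) measurable
    also have "\<dots> \<le> ennreal (picard_error n t - picard_error (n + k) t)
        + ennreal (2 / 2 ^ (n + k) * exp (2 * Lip * t))"
      using picard_step[OF t, of "n + k"] Suc
      by (intro add_mono) (simp_all add: L1_enorm_minus_commute[of P "picard f0 (n + k) t"])
    also have "\<dots> = ennreal (picard_error n t - picard_error (n + Suc k) t)"
    proof (subst ennreal_plus[symmetric])
      have "4 / 2 ^ (n + k) \<le> (4 / 2 ^ n :: real)" by (simp add: field_simps power_add)
      then have "4 / 2 ^ (n + k) * exp (2 * Lip * t) \<le> 4 / 2 ^ n * exp (2 * Lip * t)"
        by (rule mult_right_mono) simp
      then show "0 \<le> picard_error n t - picard_error (n + k) t"
        unfolding picard_error_def by linarith
    qed (simp_all add: picard_error_def field_simps)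
    finally show ?case .
  qed
  also have "\<dots> \<le> ennreal (picard_error n t)"
    by (intro ennreal_leI) (simp add: picard_error_def)
  finally show ?thesis .
qed

text \<open>
  The increments have a summable series of norms, so by monotone convergence they are absolutely
  summable at almost every point.
\<close>

lemma picard_AE_converges:
  assumes t: "0 \<le> t"
  shows "AE z in P. (\<lambda>n. picard f0 n t z) \<longlonglongrightarrow> picard_limit f0 t z"
proof -
  let ?d = "\<lambda>n z. \<bar>picard f0 (Suc n) t z - picard f0 n t z\<bar>"
  have "(\<integral>\<^sup>+z. (\<Sum>n. ennreal (?d n z)) \<partial>P) = (\<Sum>n. \<integral>\<^sup>+z. ennreal (?d n z) \<partial>P)"
    by (intro nn_integral_suminf) measurable
  also have "\<dots> \<le> (\<Sum>n. ennreal (2 / 2 ^ n * exp (2 * Lip * t)))"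
    using picard_step[OF t] unfolding L1_enorm_def by (intro suminf_le summableI) auto
  also have "\<dots> < top"
  proof -
    have "summable (\<lambda>n. 2 * exp (2 * Lip * t) * (1 / 2 :: real) ^ n)"
      by (intro summable_mult summable_geometric) simp
    then have "summable (\<lambda>n. 2 / 2 ^ n * exp (2 * Lip * t))"
      by (simp add: power_divide field_simps)
    then show ?thesis by (subst suminf_ennreal2) auto
  qed
  finally have "AE z in P. (\<Sum>n. ennreal (?d n z)) \<noteq> \<infinity>"
    by (intro nn_integral_PInf_AE borel_measurable_suminf_order measurable_compose[OF _ measurable_ennreal]
        borel_measurable_abs borel_measurable_diff measurable_picard) simp
  then show ?thesis
  proof eventually_elim
    fix z assume "(\<Sum>n. ennreal (?d n z)) \<noteq> \<infinity>"
    then have "summable (\<lambda>n. ?d n z)" by (intro summable_suminf_not_top) auto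
    then have "summable (\<lambda>n. picard f0 (Suc n) t z - picard f0 n t z)" by (rule summable_rabs_cancel)
    then have "convergent (\<lambda>n. \<Sum>k<n. picard f0 (Suc k) t z - picard f0 k t z)"
      by (simp add: summable_iff_convergent)
    then have "convergent (\<lambda>n. picard f0 n t z - picard f0 0 t z)"
      by (simp only: sum_lessThan_telescope[of "\<lambda>n. picard f0 n t z"])
    then have "convergent (\<lambda>n. (picard f0 n t z - picard f0 0 t z) + picard f0 0 t z)"
      by (intro convergent_add convergent_const)
    then show "(\<lambda>n. picard f0 n t z) \<longlonglongrightarrow> picard_limit f0 t z"
      unfolding picard_limit_def convergent_LIMSEQ_iff by simp
  qed
qed

lemma measurable_picard_limit_path:
  "(\<lambda>(t, z). picard_limit f0 t z) \<in> borel_measurable (borel \<Otimes>\<^sub>M P)"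
proof -
  have "(\<lambda>w. lim (\<lambda>n. (\<lambda>(t, z). picard f0 n t z) w)) \<in> borel_measurable (borel \<Otimes>\<^sub>M P)"
    by (intro borel_measurable_lim_metric measurable_picard_path)
  then show ?thesis by (simp add: picard_limit_def case_prod_beta)
qed

lemma measurable_picard_limit[measurable]: "picard_limit f0 t \<in> borel_measurable P"
  by (rule measurable_path_section[OF measurable_picard_limit_path])

text \<open>
  Fatou's lemma transfers the Cauchy estimate to the almost everywhere limit.
\<close>

lemma picard_limit_error:
  assumes t: "0 \<le> t"
  shows "L1_enorm P (\<lambda>z. picard f0 n t z - picard_limit f0 t z) \<le> ennreal (picard_error n t)"
proof -
  let ?d = "\<lambda>k z. ennreal \<bar>picard f0 n t z - picard f0 (n + k) t z\<bar>"
  have "L1_enorm P (\<lambda>z. picard f0 n t z - picard_limit f0 t z) = (\<integral>\<^sup>+z. liminf (\<lambda>k. ?d k z) \<partial>P)"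
    unfolding L1_enorm_def using picard_AE_converges[OF t]
  proof (intro nn_integral_cong_AE, eventually_elim)
    fix z assume "(\<lambda>k. picard f0 k t z) \<longlonglongrightarrow> picard_limit f0 t z"
    then have "(\<lambda>k. picard f0 (k + n) t z) \<longlonglongrightarrow> picard_limit f0 t z" by (rule LIMSEQ_ignore_initial_segment)
    then have "(\<lambda>k. ?d k z) \<longlonglongrightarrow> ennreal \<bar>picard f0 n t z - picard_limit f0 t z\<bar>"
      by (intro tendsto_ennrealI tendsto_intros) (simp add: add.commute)
    then show "ennreal \<bar>picard f0 n t z - picard_limit f0 t z\<bar> = liminf (\<lambda>k. ?d k z)"
      by (intro lim_imp_Liminf[symmetric]) auto
  qed
  also have "\<dots> \<le> liminf (\<lambda>k. \<integral>\<^sup>+z. ?d k z \<partial>P)"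
    by (intro nn_integral_liminf) measurable
  also have "\<dots> \<le> limsup (\<lambda>k. \<integral>\<^sup>+z. ?d k z \<partial>P)"
    by (intro Liminf_le_Limsup) simp
  also have "\<dots> \<le> ennreal (picard_error n t)"
    using picard_Cauchy[OF t, of n] unfolding L1_enorm_def by (intro Limsup_bounded always_eventually) simp
  finally show ?thesis .
qed

lemma picard_limit_mass:
  assumes t: "0 \<le> t"
  shows "L1_enorm P (picard_limit f0 t) = 1"
proof (rule antisym)
  have "(\<lambda>n. 1 + ennreal (picard_error n t)) \<longlonglongrightarrow> 1 + 0"
    by (intro tendsto_add tendsto_const picard_error_tendsto_0)
  moreover have "L1_enorm P (picard_limit f0 t) \<le> 1 + ennreal (picard_error n t)" for n
  proof -
    have "L1_enorm P (picard_limit f0 t) \<le> L1_enorm P (picard f0 n t) + L1_enorm P (\<lambda>z. picard f0 n t z - picard_limit f0 t z)"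
      using L1_enorm_diff_le[of "picard f0 n t" P "\<lambda>z. picard f0 n t z - picard_limit f0 t z"] by simp
    then show ?thesis
      using picard_limit_error[OF t, of n] picard_mass[OF t] by (auto elim!: order_trans intro: add_left_mono)
  qed
  ultimately show "L1_enorm P (picard_limit f0 t) \<le> 1" by (intro LIMSEQ_le_const) auto
  have "(\<lambda>n. L1_enorm P (picard_limit f0 t) + ennreal (picard_error n t)) \<longlonglongrightarrow> L1_enorm P (picard_limit f0 t) + 0"
    by (intro tendsto_add tendsto_const picard_error_tendsto_0)
  moreover have "1 \<le> L1_enorm P (picard_limit f0 t) + ennreal (picard_error n t)" for n
  proof -
    have "L1_enorm P (picard f0 n t) \<le> L1_enorm P (picard_limit f0 t) + L1_enorm P (\<lambda>z. picard f0 n t z - picard_limit f0 t z)"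
      using L1_enorm_add_le[of "picard_limit f0 t" P "\<lambda>z. picard f0 n t z - picard_limit f0 t z"] by simp
    then show ?thesis
      using picard_limit_error[OF t, of n] picard_mass[OF t, of n] by (auto elim!: order_trans intro: add_left_mono)
  qed
  ultimately show "1 \<le> L1_enorm P (picard_limit f0 t)" by (intro LIMSEQ_le_const) auto
qed

lemma prob_density_picard_limit:
  assumes t: "0 \<le> t"
  shows "prob_density P (picard_limit f0 t)"
  unfolding prob_density_iff_L1_enorm
proof (intro conjI measurable_picard_limit picard_limit_mass[OF t])
  show "AE z in P. 0 \<le> picard_limit f0 t z"
    using picard_AE_converges[OF t]
    by eventually_elim (rule LIMSEQ_le_const, assumption, use picard_nonneg in blast)
qed

text \<open>
  Both the limit and its image under the Duhamel map lie within \<open>picard_error (Suc n)\<close> of the next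
  iterate.
\<close>

lemma picard_limit_solves:
  assumes t: "0 \<le> t"
  shows "AE z in P. picard_limit f0 t z = duhamel f0 (\<lambda>s. gain (picard_limit f0 s)) t z"
proof (rule L1_enorm_eq_0D)
  let ?F = "picard_limit f0" and ?D = "duhamel f0 (\<lambda>s. gain (picard_limit f0 s))"
  show D[measurable]: "?D t \<in> borel_measurable P"
    by (intro measurable_duhamel measurable_gain_path measurable_picard_limit_path f0_meas)
  have "L1_enorm P (\<lambda>z. ?F t z - ?D t z) \<le> ennreal (picard_error (Suc n) t) + ennreal (picard_error (Suc n) t)" for n
  proof -
    have "L1_enorm P (\<lambda>z. picard f0 (Suc n) t z - ?D t z)
       \<le> L1_enorm P (\<lambda>z. f0 z - f0 z)
         + (\<integral>\<^sup>+s\<in>{0..t}. ennreal Lip * L1_enorm P (\<lambda>z. picard f0 n s z - ?F s z) \<partial>lborel)"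
      unfolding picard.simps(2)
      by (intro duhamel_gain_stability measurable_picard_path measurable_picard_limit_path picard_mass
          picard_limit_mass f0_meas t) auto
    also have "\<dots> = ennreal 0 + (\<integral>\<^sup>+s\<in>{0..t}. ennreal Lip * L1_enorm P (\<lambda>z. picard f0 n s z - ?F s z) \<partial>lborel)"
      by (simp add: L1_enorm_def)
    also have "\<dots> \<le> ennreal (0 * exp (Lip * t) + (4 / 2 ^ n) / 2 * exp (2 * Lip * t))"
      using picard_limit_error[of _ n] unfolding picard_error_def
      by (intro exp_comparison_step Lip_pos t) auto
    finally have "L1_enorm P (\<lambda>z. picard f0 (Suc n) t z - ?D t z) \<le> ennreal (picard_error (Suc n) t)"
      by (simp add: picard_error_def mult.commute)
    moreover have "L1_enorm P (\<lambda>z. ?F t z - picard f0 (Suc n) t z) \<le> ennreal (picard_error (Suc n) t)"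
      using picard_limit_error[OF t, of "Suc n"] by (subst L1_enorm_minus_commute)
    moreover have "L1_enorm P (\<lambda>z. ?F t z - ?D t z)
       \<le> L1_enorm P (\<lambda>z. ?F t z - picard f0 (Suc n) t z) + L1_enorm P (\<lambda>z. picard f0 (Suc n) t z - ?D t z)"
      by (intro L1_enorm_triangle) measurable
    ultimately show ?thesis by (meson add_mono order_trans)
  qed
  moreover have "(\<lambda>n. ennreal (picard_error (Suc n) t) + ennreal (picard_error (Suc n) t)) \<longlonglongrightarrow> 0 + 0"
    by (intro tendsto_add LIMSEQ_Suc[OF picard_error_tendsto_0])
  ultimately have "L1_enorm P (\<lambda>z. ?F t z - ?D t z) \<le> 0" by (intro LIMSEQ_le_const) auto
  then show "L1_enorm P (\<lambda>z. ?F t z - ?D t z) = 0" by simp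
qed measurable

lemma BGK_solution_picard_limit: "BGK_solution \<nu> \<Phi> K Q T f0 (picard_limit f0)"
  unfolding BGK_solution_def continuous_density_path_def
proof (intro conjI ballI exI[of _ "picard_limit f0"])
  let ?F = "picard_limit f0" and ?H = "\<lambda>s. gain (picard_limit f0 s)"
  show "(\<lambda>(t, z). ?F t z) \<in> borel_measurable (borel \<Otimes>\<^sub>M P)" by (rule measurable_picard_limit_path)
  fix t assume t: "t \<in> {0..T}"
  show "prob_density P (?F t)" using t by (intro prob_density_picard_limit) simp
  show "AE z in P. ?F t z = ?F t z" by simp
  have sol: "AE z in P. ?F t z = duhamel f0 ?H t z" if "t \<in> {0..T}" for t
    using that by (intro picard_limit_solves) simp
  show "AE (x, m) in P. ?F t (x, m) = exp (- t) * f0 (x - t *\<^sub>R \<Phi> m, m) +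
      (LINT s:{0..t}|lborel. exp (- (t - s)) * gain (?F s) (x - (t - s) *\<^sub>R \<Phi> m, m))"
    using sol[OF t] by eventually_elim (auto simp: duhamel_eq)
  have H: "(\<lambda>(s, z). ?H s z) \<in> borel_measurable (borel \<Otimes>\<^sub>M P)"
    by (intro measurable_gain_path measurable_picard_limit_path)
  show "((\<lambda>s. L1_norm P (\<lambda>z. ?F s z - ?F t z)) \<longlongrightarrow> 0) (at t within {0..T})"
    unfolding tendsto_at_iff_sequentially
  proof (intro allI impI)
    fix X :: "nat \<Rightarrow> real" assume X: "\<forall>n. X n \<in> {0..T} - {t}" "X \<longlonglongrightarrow> t"
    have "(\<lambda>n. L1_enorm P (\<lambda>z. duhamel f0 ?H (X n) z - duhamel f0 ?H t z)) \<longlonglongrightarrow> 0"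
    proof (rule duhamel_continuous[OF H _ _ t _ X(2)])
      show "L1_enorm P (?H s) \<le> 1" if "s \<in> {0..T}" for s
        using L1_enorm_gain_le[OF measurable_picard_limit, of s] picard_limit_mass[of s] that by simp
      show "integrable P f0" using f0_mass by (simp add: integrable_iff_L1_enorm)
    qed (use X in auto)
    moreover have "L1_enorm P (\<lambda>z. duhamel f0 ?H (X n) z - duhamel f0 ?H t z) = L1_enorm P (\<lambda>z. ?F (X n) z - ?F t z)" for n
    proof -
      have "X n \<in> {0..T}" using X(1) by blast
      from sol[OF this] sol[OF t] show ?thesis
        by (intro L1_enorm_cong_AE, eventually_elim) simp
    qed
    ultimately have "(\<lambda>n. L1_enorm P (\<lambda>z. ?F (X n) z - ?F t z)) \<longlonglongrightarrow> ennreal 0" by simp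
    then have "(\<lambda>n. enn2real (L1_enorm P (\<lambda>z. ?F (X n) z - ?F t z))) \<longlonglongrightarrow> 0"
      by (rule tendsto_enn2real) simp
    then show "((\<lambda>s. L1_norm P (\<lambda>z. ?F s z - ?F t z)) \<circ> X) \<longlonglongrightarrow> 0"
      by (simp add: comp_def L1_norm_eq_L1_enorm)
  qed
qed

end

lemma BGK_solution_cong_initial:
  assumes f: "BGK_solution \<nu> \<Phi> K Q T f0 f" and ae: "AE z in P. f0 z = f0' z"
  shows "BGK_solution \<nu> \<Phi> K Q T f0' f"
  unfolding BGK_solution_def
proof (intro conjI)
  show "continuous_density_path \<nu> T f" using f unfolding BGK_solution_def by blast
  obtain g where g: "(\<lambda>(t, z). g t z) \<in> borel_measurable (borel \<Otimes>\<^sub>M P)"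
    "\<forall>t\<in>{0..T}. AE z in P. g t z = f t z"
    "\<forall>t\<in>{0..T}. AE (x, m) in P. f t (x, m) = exp (- t) * f0 (x - t *\<^sub>R \<Phi> m, m) +
               (LINT s:{0..t}|lborel. exp (- (t - s)) * gain (g s) (x - (t - s) *\<^sub>R \<Phi> m, m))"
    using f unfolding BGK_solution_def by blast
  have "AE (x, m) in P. f t (x, m) = exp (- t) * f0' (x - t *\<^sub>R \<Phi> m, m) +
      (LINT s:{0..t}|lborel. exp (- (t - s)) * gain (g s) (x - (t - s) *\<^sub>R \<Phi> m, m))"
    if "t \<in> {0..T}" for t
    using bspec[OF g(3) that] AE_transport[OF ae, of t]
    by eventually_elim (auto simp: transport_def)
  with g(1,2) show "\<exists>g. (\<lambda>(t, z). g t z) \<in> borel_measurable (borel \<Otimes>\<^sub>M P) \<and>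
      (\<forall>t\<in>{0..T}. AE z in P. g t z = f t z) \<and>
      (\<forall>t\<in>{0..T}. AE (x, m) in P. f t (x, m) = exp (- t) * f0' (x - t *\<^sub>R \<Phi> m, m) +
         (LINT s:{0..t}|lborel. exp (- (t - s)) * gain (g s) (x - (t - s) *\<^sub>R \<Phi> m, m)))"
    by blast
qed

text \<open>
  The positive part of the initial density is nonnegative everywhere, as the iteration asks for,
  and agrees with it almost everywhere.
\<close>

lemma BGK_solution_exists:
  assumes "prob_density P f0"
  shows "\<exists>f. BGK_solution \<nu> \<Phi> K Q T f0 f"
proof -
  define f0' where "f0' = (\<lambda>z. max 0 (f0 z))"
  have ae: "AE z in P. f0' z = f0 z"
    using assms unfolding prob_density_iff_L1_enorm f0'_def by (auto elim: eventually_mono)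
  have "BGK_solution \<nu> \<Phi> K Q T f0' (picard_limit f0')"
  proof (rule BGK_solution_picard_limit)
    show "f0' \<in> borel_measurable P"
      using assms unfolding f0'_def prob_density_iff_L1_enorm by (intro borel_measurable_max) auto
    show "L1_enorm P f0' = 1" using L1_enorm_cong_AE[OF ae] assms by (simp add: prob_density_iff_L1_enorm)
  qed (simp add: f0'_def)
  from BGK_solution_cong_initial[OF this ae] show ?thesis by blast
qed

end

section \<open>Existence, uniqueness and stability\<close>

theorem proposition2p2:
  fixes \<M> :: "'e::euclidean_space set"
    and k :: nat
    and \<nu> :: "'e measure"
    and \<Phi> :: "'e \<Rightarrow> real^'d"
    and lam :: real
    and K :: "real^'d \<Rightarrow> real"
    and \<alpha> L \<theta> :: "real \<Rightarrow> real"
    and Q :: "'e \<Rightarrow> 'e \<Rightarrow> real"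
  assumes "compact \<M>" and "embedded_submanifold k \<M>"
    and "normalised_volume \<M> \<nu>"
    and "\<forall>m\<in>\<M>. norm m \<le> 1"
    and "lam \<ge> 0"
    and "\<forall>m1\<in>\<M>. \<forall>m2\<in>\<M>.
           ereal (norm (\<Phi> m1 - \<Phi> m2)) \<le> ereal lam * riemannian_dist \<M> m1 m2"
    and "observation_kernel K"
    and "interaction_law \<M> \<nu> \<alpha> L \<theta> Q"
  shows
    "(\<forall>f0 T. prob_density (phase_measure \<nu>) f0 \<longrightarrow> T > 0 \<longrightarrow>
        (\<exists>f. BGK_solution \<nu> \<Phi> K Q T f0 f) \<and>
        (\<forall>f f'. BGK_solution \<nu> \<Phi> K Q T f0 f \<longrightarrow> BGK_solution \<nu> \<Phi> K Q T f0 f' \<longrightarrow>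
           (\<forall>t\<in>{0..T}. AE z in phase_measure \<nu>. f t z = f' t z))) \<and>
     (\<forall>f01 f02 T f1 f2.
        prob_density (phase_measure \<nu>) f01 \<longrightarrow> prob_density (phase_measure \<nu>) f02 \<longrightarrow> T > 0 \<longrightarrow>
        BGK_solution \<nu> \<Phi> K Q T f01 f1 \<longrightarrow> BGK_solution \<nu> \<Phi> K Q T f02 f2 \<longrightarrow>
        (let K_inf = real_of_ereal (Linf_norm lborel K) in
          (SUP t\<in>{0..T}. L1_norm (phase_measure \<nu>) (\<lambda>z. f1 t z - f2 t z))
            \<le> L1_norm (phase_measure \<nu>) (\<lambda>z. f01 z - f02 z)
               * exp ((\<alpha> K_inf + K_inf * \<theta> K_inf) * T)))"
proof -
  note compact = assms(1) and manifold = assms(2) and law = assms(8)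
  note sets = normalised_volumeD(1)[OF assms(3)] and prob = normalised_volumeD(2)[OF assms(3)]
  have space: "space \<nu> = \<M>" using sets_eq_imp_space_eq[OF sets] by (simp add: space_restrict_space)
  define a where "a = real_of_ereal (Linf_norm lborel K)"
  have K: "continuous_on UNIV K" "\<And>x. \<bar>K x\<bar> \<le> a" "a > 0"
    using observation_kernel_sup[OF assms(7)] by (simp_all add: a_def)
  define S where "S = measure_support \<nu>"
  \<comment> \<open>The jointly measurable version of the law, which has the same solutions.\<close>
  define Q' where "Q' = (\<lambda>J m. indicator S m * Q J m)"
  note reg = interaction_law_regular_on_support[OF manifold compact sets law, folded S_def]
  have S: "AE m in \<nu>. m \<in> S" unfolding S_def by (rule AE_in_measure_support[OF sets])
  have \<Phi>: "\<Phi> \<in> borel_measurable \<nu>"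
  proof -
    have "continuous_on \<M> \<Phi>"
      using assms(6) by (intro Lipschitz_riemannian_imp_continuous_on[OF manifold]) (auto simp: dist_norm)
    then have "\<Phi> \<in> borel_measurable (restrict_space borel \<M>)" by (rule borel_measurable_continuous_on_restrict)
    then show ?thesis using measurable_cong_sets[OF sets refl] by blast
  qed
  interpret prob_space \<nu> by (rule prob)
  interpret bgk_gain \<nu> \<Phi> K Q' a "\<theta> a"
  proof unfold_locales
    show "\<Phi> \<in> borel_measurable \<nu>" by (rule \<Phi>)
    show "(\<lambda>m. m) \<in> borel_measurable \<nu>"
      using measurable_restrict_space1[OF measurable_ident_sets[OF refl]] measurable_cong_sets[OF sets refl] by blast
    show "norm m \<le> 1" if "m \<in> space \<nu>" for m using assms(4) that space by blast
    show "K \<in> borel_measurable borel" using K(1) by (rule borel_measurable_continuous_onI)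
    show "\<bar>K x\<bar> \<le> a" for x by (rule K(2))
    show "(\<lambda>(J, m). Q' J m) \<in> borel_measurable (borel \<Otimes>\<^sub>M \<nu>)" unfolding Q'_def by (rule reg(3))
    show "0 \<le> Q' J m" for J m unfolding Q'_def by (rule reg(1))
    \<comment> \<open>The law is changed on a null set only.\<close>
    show "(\<integral>\<^sup>+m. ennreal (Q' J m) \<partial>\<nu>) = 1" for J
    proof -
      have Q: "prob_density \<nu> (Q J)" using law unfolding interaction_law_def by blast
      then have "(\<integral>\<^sup>+m. ennreal (Q' J m) \<partial>\<nu>) = (\<integral>\<^sup>+m. ennreal \<bar>Q J m\<bar> \<partial>\<nu>)"
        using S unfolding prob_density_def
        by (intro nn_integral_cong_AE) (auto elim!: AE_mp simp: Q'_def)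
      then show ?thesis using Q by (simp add: prob_density_iff_L1_enorm L1_enorm_def)
    qed
    show \<theta>: "0 \<le> \<theta> a" by (rule interaction_law_constants(2)[OF prob law K(3)])
    show "\<bar>Q' J m - Q' J' m\<bar> \<le> \<theta> a * norm (J - J')"
      if "norm J \<le> a" "norm J' \<le> a" for J J' m
      using reg(2)[OF K(3) that, of m] \<theta> by (cases "m \<in> S") (auto simp: Q'_def)
  qed
  have sol_iff: "BGK_solution \<nu> \<Phi> K Q T f0 f \<longleftrightarrow> BGK_solution \<nu> \<Phi> K Q' T f0 f" for T f0 f
    using S by (intro BGK_solution_cong_law) (auto elim!: eventually_mono simp: Q'_def)
  \<comment> \<open>The estimates above give the constant \<open>1 + a * \<theta> a\<close>.\<close>
  have Lip_le: "Lip \<le> \<alpha> a + a * \<theta> a"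
    using interaction_law_constants(1)[OF prob law K(3)] by simp
  have exist: "\<exists>f. BGK_solution \<nu> \<Phi> K Q T f0 f" if "prob_density P f0" for f0 T
    unfolding sol_iff using that by (rule BGK_solution_exists)
  have stable: "L1_norm P (\<lambda>z. f1 t z - f2 t z) \<le> L1_norm P (\<lambda>z. f01 z - f02 z) * exp (Lip * t)"
    if "prob_density P f01" "prob_density P f02" "BGK_solution \<nu> \<Phi> K Q T f01 f1" "BGK_solution \<nu> \<Phi> K Q T f02 f2" "t \<in> {0..T}"
    for f01 f02 f1 f2 T t
    using that unfolding sol_iff by (rule BGK_solution_stability)
  have unique: "AE z in P. f t z = f' t z"
    if "prob_density P f0" "BGK_solution \<nu> \<Phi> K Q T f0 f" "BGK_solution \<nu> \<Phi> K Q T f0 f'" "t \<in> {0..T}" for f0 f f' T t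
  proof -
    have int: "integrable P (f t)" "integrable P (f' t)"
      using that unfolding BGK_solution_def continuous_density_path_def prob_density_def by (auto simp: has_bochner_integral_iff)
    have "L1_norm P (\<lambda>z. f t z - f' t z) \<le> 0"
      using stable[OF that(1,1-4)] by (simp add: L1_norm_def)
    moreover have "0 \<le> L1_norm P (\<lambda>z. f t z - f' t z)" by (simp add: L1_norm_def)
    ultimately have "(LINT z|P. \<bar>f t z - f' t z\<bar>) = 0" unfolding L1_norm_def by (rule antisym)
    then have "AE z in P. \<bar>f t z - f' t z\<bar> = 0"
      using int by (subst (asm) integral_nonneg_eq_0_iff_AE) auto
    then show ?thesis by eventually_elim simp
  qed
  have sup: "(SUP t\<in>{0..T}. L1_norm P (\<lambda>z. f1 t z - f2 t z))
      \<le> L1_norm P (\<lambda>z. f01 z - f02 z) * exp ((\<alpha> a + a * \<theta> a) * T)"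
    if "prob_density P f01" "prob_density P f02" "T > 0" "BGK_solution \<nu> \<Phi> K Q T f01 f1" "BGK_solution \<nu> \<Phi> K Q T f02 f2"
    for f01 f02 f1 f2 T
  proof (rule cSUP_least)
    show "{0..T} \<noteq> {}" using \<open>T > 0\<close> by simp
    fix t assume t: "t \<in> {0..T}"
    have "Lip * t \<le> (\<alpha> a + a * \<theta> a) * T"
      using t Lip_le Lip_pos by (intro mult_mono) auto
    then have "L1_norm P (\<lambda>z. f01 z - f02 z) * exp (Lip * t) \<le> L1_norm P (\<lambda>z. f01 z - f02 z) * exp ((\<alpha> a + a * \<theta> a) * T)"
      by (intro mult_left_mono) (auto simp: L1_norm_def)
    with stable[OF that(1,2,4,5) t]
    show "L1_norm P (\<lambda>z. f1 t z - f2 t z) \<le> L1_norm P (\<lambda>z. f01 z - f02 z) * exp ((\<alpha> a + a * \<theta> a) * T)"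
      by (rule order_trans)
  qed
  show ?thesis
    unfolding Let_def a_def[symmetric] using exist unique sup by blast
qed

end
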